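(* (a) Let $f:[0,1]^d\to\mathbb{R}$ be right-continuous (right-continuous in each coordinate at every point) with bounded Hardy–Krause variation. Then there exists a unique signed Borel measure $\nu$ on $[0,1]^d$ with $f(\mathbf{x})=\nu([\mathbf{0},\mathbf{x}])$ for all $\mathbf{x}\in[0,1]^d$, and for it $\operatorname{Var}_{\mathrm{tot}}\nu=\operatorname{Var}_{HK\mathbf{0}} f+|f(\mathbf{0})|$. Moreover, if $f=f(\mathbf{0})+f^+-f^-$ is the Jordan decomposition of $f$ and $\nu=\nu^+-\nu^-$ is the Jordan decomposition of $\nu$, then $f^+(\mathbf{x})=\nu^+([\mathbf{0},\mathbf{x}]\setminus\{\mathbf{0}\})$ and $f^-(\mathbf{x})=\nu^-([\mathbf{0},\mathbf{x}]\setminus\{\mathbf{0}\})$ for all $\mathbf{x}\in[0,1]^d$. (b) Let $\nu$ be a finite signed Borel measure on $[0,1]^d$. Then there exists a unique right-continuous function $f$ of bounded Hardy–Krause variation on $[0,1]^d$ such that $f(\mathbf{x})=\nu([\mathbf{0},\mathbf{x}])$ for all $\mathbf{x}$ and $\operatorname{Var}_{\mathrm{tot}}\nu=\operatorname{Var}_{HK\mathbf{0}} f+|f(\mathbf{0})|$; moreover, with the Jordan decompositions as in (a), $f^\pm(\mathbf{x})=\nu^\pm([\mathbf{0},\mathbf{x}]\setminus\{\mathbf{0}\})$ for all $\mathbf{x}$.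
   Context: Quasi-volumes $\Delta^{(s)}$ of $s$-dimensional closed axis-parallel boxes: for $[\mathbf{a},\mathbf{b}]$, $\Delta^{(d)}(f;[\mathbf{a},\mathbf{b}])=\sum_{j\in\{0,1\}^d}(-1)^{\sum j_i}f(b_1+j_1(a_1-b_1),\dots,b_d+j_d(a_d-b_d))$, and analogously in lower dimension. Vitali variation of $f$ on a box: supremum over grid partitions of the box of $\sum|\Delta|$ over the cells. $\operatorname{Var}_{HK} f$ (anchored at $\mathbf{1}$) is the sum over nonempty $\{i_1<\dots<i_s\}\subseteq\{1,\dots,d\}$ of the Vitali variation of $f$ restricted to the face $\{x_j=1, j\notin\{i_1,\dots,i_s\}\}$; bounded HK-variation means this is finite. $\operatorname{Var}_{HK\mathbf{0}} f$ is the same sum over the faces $\{x_j=0, j\notin\{i_1,\dots,i_s\}\}$. A function is completely monotone if all its quasi-volumes of all closed axis-parallel boxes of all dimensions are $\ge0$. For $f$ of bounded HK-variation, its Jordan decomposition is the unique representation $f(\mathbf{x})=f(\mathbf{0})+f^+(\mathbf{x})-f^-(\mathbf{x})$ with $f^\pm$ completely monotone, $f^\pm(\mathbf{0})=0$ and $\operatorname{Var}_{HK\mathbf{0}} f=\operatorname{Var}_{HK\mathbf{0}} f^++\operatorname{Var}_{HK\mathbf{0}} f^-$ (existence and uniqueness being known). For a signed measure $\nu$, its Jordan decomposition $\nu=\nu^+-\nu^-$ is the unique one with mutually singular measures $\nu^\pm$, and $\operatorname{Var}_{\mathrm{tot}}\nu=\nu^+([0,1]^d)+\nu^-([0,1]^d)$.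 *)

theory Defs
  imports "HOL-Analysis.Analysis"
begin

abbreviation unit_cube :: "(real^'n) set" where
  "unit_cube \<equiv> cbox 0 1"

definition borel_cube :: "(real^'n) set set" where
  "borel_cube = {A. A \<in> sets borel \<and> A \<subseteq> unit_cube}"

definition qvol :: "(real^'n \<Rightarrow> real) \<Rightarrow> 'n set \<Rightarrow> real^'n \<Rightarrow> real^'n \<Rightarrow> real^'n \<Rightarrow> real" where
  "qvol f S a b c = (\<Sum>J\<in>Pow S. (-1) ^ card J *
      f (\<chi> i. if i \<in> J then a$i else if i \<in> S then b$i else c$i))"

definition grid :: "('n \<Rightarrow> real set) \<Rightarrow> 'n set \<Rightarrow> bool" where
  "grid P S \<longleftrightarrow> (\<forall>i\<in>S. finite (P i) \<and> 0 \<in> P i \<and> 1 \<in> P i \<and> P i \<subseteq> {0..1})"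

definition nxt :: "real set \<Rightarrow> real \<Rightarrow> real" where
  "nxt A t = Min {s\<in>A. t < s}"

text \<open>Cells of a grid, identified with their lower corners.\<close>
definition cells :: "('n \<Rightarrow> real set) \<Rightarrow> 'n set \<Rightarrow> ('n \<Rightarrow> real) set" where
  "cells P S = {k. (\<forall>i\<in>S. k i \<in> P i - {1}) \<and> (\<forall>i. i \<notin> S \<longrightarrow> k i = 0)}"

text \<open>Vitali variation of f restricted to the face {x_j = c, j not in S}.\<close>
definition vitali :: "(real^'n \<Rightarrow> real) \<Rightarrow> 'n set \<Rightarrow> real \<Rightarrow> ereal" where
  "vitali f S c = (SUP P\<in>{P. grid P S}. ereal (\<Sum>k\<in>cells P S.
      \<bar>qvol f S (\<chi> i. k i) (\<chi> i. if i \<in> S then nxt (P i) (k i) else c) (\<chi> i. c)\<bar>))"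

definition Var_HK :: "(real^'n \<Rightarrow> real) \<Rightarrow> ereal" where
  "Var_HK f = (\<Sum>S\<in>{S. S \<noteq> {}}. vitali f S 1)"

definition Var_HK0 :: "(real^'n \<Rightarrow> real) \<Rightarrow> ereal" where
  "Var_HK0 f = (\<Sum>S\<in>{S. S \<noteq> {}}. vitali f S 0)"

definition bounded_HK :: "(real^'n \<Rightarrow> real) \<Rightarrow> bool" where
  "bounded_HK f \<longleftrightarrow> Var_HK f < \<infinity>"

definition compl_mono :: "(real^'n \<Rightarrow> real) \<Rightarrow> bool" where
  "compl_mono f \<longleftrightarrow> (\<forall>S a b. S \<noteq> {} \<and> a \<in> unit_cube \<and> b \<in> unit_cube \<and>
      (\<forall>i\<in>S. a$i \<le> b$i) \<and> (\<forall>i. i \<notin> S \<longrightarrow> a$i = b$i) \<longrightarrow> 0 \<le> qvol f S a b b)"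

definition jordan_fun :: "(real^'n \<Rightarrow> real) \<Rightarrow> (real^'n \<Rightarrow> real) \<Rightarrow> (real^'n \<Rightarrow> real) \<Rightarrow> bool" where
  "jordan_fun f fp fm \<longleftrightarrow> (\<forall>x\<in>unit_cube. f x = f 0 + fp x - fm x) \<and>
     compl_mono fp \<and> compl_mono fm \<and> fp 0 = 0 \<and> fm 0 = 0 \<and>
     Var_HK0 f = Var_HK0 fp + Var_HK0 fm"

definition upd :: "real^'n \<Rightarrow> 'n \<Rightarrow> real \<Rightarrow> real^'n" where
  "upd x i t = (\<chi> j. if j = i then t else x$j)"

definition right_cont :: "(real^'n \<Rightarrow> real) \<Rightarrow> bool" where
  "right_cont f \<longleftrightarrow> (\<forall>x\<in>unit_cube. \<forall>i.
      ((\<lambda>t. f (upd x i t)) \<longlongrightarrow> f x) (at (x$i) within {x$i..1}))"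

definition signed_measure :: "((real^'n) set \<Rightarrow> real) \<Rightarrow> bool" where
  "signed_measure \<nu> \<longleftrightarrow> \<nu> {} = 0 \<and>
     (\<forall>A::nat \<Rightarrow> (real^'n) set. range A \<subseteq> borel_cube \<and> disjoint_family A \<longrightarrow>
        (\<lambda>n. \<nu> (A n)) sums \<nu> (\<Union>n. A n))"

definition jordan_meas :: "((real^'n) set \<Rightarrow> real) \<Rightarrow> ((real^'n) set \<Rightarrow> real) \<Rightarrow> ((real^'n) set \<Rightarrow> real) \<Rightarrow> bool" where
  "jordan_meas \<nu> p m \<longleftrightarrow> signed_measure p \<and> signed_measure m \<and>
     (\<forall>A\<in>borel_cube. 0 \<le> p A \<and> 0 \<le> m A \<and> \<nu> A = p A - m A) \<and>
     (\<exists>P\<in>borel_cube. p (unit_cube - P) = 0 \<and> m P = 0)"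

definition Var_tot :: "((real^'n) set \<Rightarrow> real) \<Rightarrow> real" where
  "Var_tot \<nu> = (THE v. \<exists>p m. jordan_meas \<nu> p m \<and> v = p unit_cube + m unit_cube)"

end

theory Submission
  imports Defs
begin

text \<open>
  On a finite grid, \<open>f\<close> is the distribution function of a unique family of signed point masses, by Moebius
  inversion; quasi-volumes are sums of these masses over half-open boxes. Splitting the grid points by
  their support shows that \<open>Var_HK0 f + \<bar>f 0\<bar>\<close> is the supremum over all grids of the total absolute mass.

  Given a right-continuous \<open>f\<close>, the absolute masses increase along the dyadic refinements to a consistent
  positive family \<open>A\<close> on the dyadic tree. Half of \<open>A\<close> plus or minus the masses of \<open>f\<close> gives two consistent positive
  families, hence two measures whose difference represents \<open>f\<close>. Their total mass is at most
  \<open>Var_HK0 f + \<bar>f 0\<bar>\<close>, whereas the masses of \<open>f\<close> on a grid are the measures of the grid cells, so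
  \<open>Var_tot\<close> is at least this supremum.
\<close>

section \<open>Masses on finite grids\<close>

text \<open>Three obstacles shape the proof. The absolute masses of one grid do not add up under
  refinement, because masses of opposite sign cancel inside a coarse cell; positive and negative
  parts taken grid by grid are therefore not consistent, and only the limit along a chain of grids
  is additive. Secondly, the measures are built from values of \<open>f\<close> at dyadic points
  that approach \<open>x\<close> from above in all coordinates at once, while the hypothesis moves
  one coordinate at a time; bounded variation upgrades it to joint right-continuity. Thirdly,
  boundedness is assumed with anchor 1, whereas masses at grid points describe anchor 0, so the
  anchors are compared in both directions. Half-open cells are rounding classes: a grid point stands
  for the points of the cube that round up to it. As 0 is a grid value, rounding never changes the
  support, so the faces through the origin remain separate strata. The atom at the origin is the
  constant \<open>f 0\<close>, invisible to quasi-volumes of positive dimension; this accounts for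
  the term \<open>\<bar>f 0\<bar>\<close> and for the removal of \<open>{0}\<close> in the Jordan
  parts.\<close>

definition gpts :: "('n \<Rightarrow> real set) \<Rightarrow> (real^'n) set" where
  "gpts P = {x. \<forall>i. x$i \<in> P i}"

text \<open>Meant for \<open>x\<close> in the cube, where the grid value 1 makes the set under
  \<open>Min\<close> nonempty.\<close>

definition up :: "('n \<Rightarrow> real set) \<Rightarrow> real^'n \<Rightarrow> real^'n" where
  "up P x = (\<chi> i. Min {t\<in>P i. x$i \<le> t})"

definition supp :: "real^'n \<Rightarrow> 'n set" where
  "supp y = {i. y$i \<noteq> 0}"

lemma mem_cube: "x \<in> unit_cube \<longleftrightarrow> (\<forall>i. 0 \<le> x$i \<and> x$i \<le> 1)"
  by (simp add: mem_box_cart)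

lemma gpts_iff: "x \<in> gpts P \<longleftrightarrow> (\<forall>i. x$i \<in> P i)"
  by (simp add: gpts_def)

lemma gridD:
  assumes "grid P S" "i \<in> S"
  shows "finite (P i)" "0 \<in> P i" "1 \<in> P i" "\<And>t. t \<in> P i \<Longrightarrow> 0 \<le> t \<and> t \<le> 1"
  using assms unfolding grid_def by (simp_all add: subset_iff)

lemma gpts_cube: "grid P UNIV \<Longrightarrow> gpts P \<subseteq> unit_cube"
  using gridD(4)[of P UNIV] by (metis UNIV_I gpts_iff mem_cube subsetI)

lemma zero_in_gpts: "grid P UNIV \<Longrightarrow> 0 \<in> gpts P"
  and one_in_gpts: "grid P UNIV \<Longrightarrow> 1 \<in> gpts P"
  by (simp_all add: gpts_iff gridD)

lemma finite_gpts:
  assumes "grid P UNIV" shows "finite (gpts P)"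
proof -
  have "gpts P \<subseteq> vec_lambda ` (\<Pi>\<^sub>E i\<in>UNIV. P i)"
  proof
    fix x assume "x \<in> gpts P"
    then have "vec_nth x \<in> (\<Pi>\<^sub>E i\<in>UNIV. P i)" by (auto simp: gpts_iff)
    then show "x \<in> vec_lambda ` (\<Pi>\<^sub>E i\<in>UNIV. P i)"
      by (metis image_eqI vec_nth_inverse)
  qed
  moreover have "finite (\<Pi>\<^sub>E i\<in>UNIV. P i)"
    using assms by (intro finite_PiE) (auto simp: gridD)
  ultimately show ?thesis using finite_subset by blast
qed

lemma gpts_mono: "(\<And>i. P i \<subseteq> Q i) \<Longrightarrow> gpts P \<subseteq> gpts Q"
  by (simp add: gpts_iff subset_iff)

lemma up_nth:
  assumes "grid P UNIV" "x \<in> unit_cube"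
  shows "up P x $ i \<in> P i" "x$i \<le> up P x $ i" "\<And>t. t \<in> P i \<Longrightarrow> up P x $ i \<le> t \<longleftrightarrow> x$i \<le> t"
proof -
  let ?A = "{t\<in>P i. x$i \<le> t}"
  have fin: "finite ?A" and ne: "?A \<noteq> {}"
    using assms gridD[OF assms(1), of i] by (auto simp: mem_cube)
  have "Min ?A \<in> ?A" using fin ne by (rule Min_in)
  then show "up P x $ i \<in> P i" "x$i \<le> up P x $ i" by (auto simp: up_def)
  then show "up P x $ i \<le> t \<longleftrightarrow> x$i \<le> t" if "t \<in> P i" for t
    using that fin by (auto simp: up_def)
qed

lemma up_in_gpts: "grid P UNIV \<Longrightarrow> x \<in> unit_cube \<Longrightarrow> up P x \<in> gpts P"
  by (simp add: gpts_iff up_nth)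

text \<open>Rounding up is left adjoint to the inclusion of the grid. In this form it lets a sum
  over points below a grid point be regrouped by rounding classes.\<close>

lemma up_le_iff: "grid P UNIV \<Longrightarrow> x \<in> unit_cube \<Longrightarrow> g \<in> gpts P \<Longrightarrow> up P x \<le> g \<longleftrightarrow> x \<le> g"
  by (auto simp: gpts_iff less_eq_vec_def up_nth)

text \<open>A zero coordinate stays at the grid value 0, and a positive one cannot be rounded down
  to 0, so refinement never moves mass between strata.\<close>

lemma up_supp: "grid P UNIV \<Longrightarrow> x \<in> unit_cube \<Longrightarrow> supp (up P x) = supp x"
  unfolding supp_def mem_cube
  by (metis (lifting) antisym_conv gridD(2) iso_tuple_UNIV_I mem_cube up_nth(2,3))

lemma le_vec_one: "x \<in> unit_cube \<Longrightarrow> x \<le> 1" and zero_le_vec: "x \<in> unit_cube \<Longrightarrow> 0 \<le> x"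
  by (auto simp: mem_cube less_eq_vec_def)

lemma up_eqI:
  assumes "grid P UNIV" "x \<in> unit_cube" "y \<in> gpts P" "\<And>g. g \<in> gpts P \<Longrightarrow> y \<le> g \<longleftrightarrow> x \<le> g"
  shows "up P x = y"
  using assms up_le_iff up_in_gpts by (metis order.refl order_antisym)

lemma up_up:
  assumes "grid P UNIV" "grid Q UNIV" "\<And>i. P i \<subseteq> Q i" "x \<in> unit_cube"
  shows "up P (up Q x) = up P x"
proof (rule up_eqI)
  show "up Q x \<in> unit_cube" using assms up_in_gpts gpts_cube by blast
  show "up P x \<le> g \<longleftrightarrow> up Q x \<le> g" if "g \<in> gpts P" for g
    using that assms gpts_mono[of P Q] up_le_iff[of P x g] up_le_iff[of Q x g] by auto
qed (use assms up_in_gpts in auto)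

section \<open>Moebius inversion on finite posets and the masses of a function\<close>

lemma poset_moebius_exists:
  fixes f :: "'a::order \<Rightarrow> real"
  assumes "finite G"
  shows "\<exists>m. \<forall>x\<in>G. f x = (\<Sum>y | y \<in> G \<and> y \<le> x. m y)"
  using assms
proof (induction rule: finite_psubset_induct)
  case (psubset G)
  show ?case
  proof (cases "G = {}")
    case False
    \<comment> \<open>A maximal \<open>a\<close> lies below no other point of \<open>G\<close>, so
      its value can be fixed last to repair the equation at \<open>a\<close> without disturbing the
      others.\<close>
    obtain a where a: "a \<in> G" "\<And>b. b \<in> G \<Longrightarrow> a \<le> b \<Longrightarrow> a = b"
      using finite_has_maximal[OF psubset.hyps False] by blast
    obtain m where m: "\<And>x. x \<in> G - {a} \<Longrightarrow> f x = (\<Sum>y | y \<in> G - {a} \<and> y \<le> x. m y)"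
      using psubset.IH[of "G - {a}"] a by auto
    define m' where "m' = m(a := f a - (\<Sum>y | y \<in> G - {a} \<and> y \<le> a. m y))"
    have "f x = (\<Sum>y | y \<in> G \<and> y \<le> x. m' y)" if "x \<in> G" for x
    proof (cases "x = a")
      case True
      have "{y \<in> G. y \<le> a} = insert a {y. y \<in> G - {a} \<and> y \<le> a}" using a by auto
      then have "(\<Sum>y | y \<in> G \<and> y \<le> a. m' y) = m' a + (\<Sum>y | y \<in> G - {a} \<and> y \<le> a. m' y)"
        using psubset.hyps by simp
      also have "(\<Sum>y | y \<in> G - {a} \<and> y \<le> a. m' y) = (\<Sum>y | y \<in> G - {a} \<and> y \<le> a. m y)"
        by (intro sum.cong) (auto simp: m'_def)
      finally show ?thesis using True by (simp add: m'_def)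
    next
      case False
      have "{y \<in> G. y \<le> x} = {y. y \<in> G - {a} \<and> y \<le> x}" using a that False by auto
      then have "(\<Sum>y | y \<in> G \<and> y \<le> x. m' y) = (\<Sum>y | y \<in> G - {a} \<and> y \<le> x. m y)"
        by (auto intro!: sum.cong simp: m'_def)
      then show ?thesis using m[of x] that False by auto
    qed
    then show ?thesis by blast
  qed simp
qed

text \<open>At a minimal point of disagreement all strictly smaller terms coincide, so equality of
  the sums there forces equality of the last term.\<close>

lemma poset_moebius_unique:
  fixes m m' :: "'a::order \<Rightarrow> real"
  assumes "finite G" and eq: "\<And>x. x \<in> G \<Longrightarrow> (\<Sum>y | y \<in> G \<and> y \<le> x. m y) = (\<Sum>y | y \<in> G \<and> y \<le> x. m' y)"
    and "x \<in> G"
  shows "m x = m' x"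
proof (rule ccontr)
  assume "m x \<noteq> m' x"
  let ?D = "{x\<in>G. m x \<noteq> m' x}"
  have "finite ?D" "?D \<noteq> {}" using assms \<open>m x \<noteq> m' x\<close> by auto
  then obtain a where a: "a \<in> ?D" "\<And>b. b \<in> ?D \<Longrightarrow> b \<le> a \<Longrightarrow> a = b"
    using finite_has_minimal[of ?D] by auto
  have split: "(\<Sum>y | y \<in> G \<and> y \<le> a. h y) = h a + (\<Sum>y | y \<in> G \<and> y < a. h y)" for h :: "'a \<Rightarrow> real"
  proof -
    have "{y \<in> G. y \<le> a} = insert a {y \<in> G. y < a}" using a by auto
    then show ?thesis using assms(1) by simp
  qed
  have "(\<Sum>y | y \<in> G \<and> y < a. m y) = (\<Sum>y | y \<in> G \<and> y < a. m' y)"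
    using a by (intro sum.cong) (auto simp: less_le)
  then show False using eq[of a] split[of m] split[of m'] a by auto
qed

text \<open>The Moebius inverse of \<open>f\<close> on the grid; the choice by \<open>SOME\<close>
  is determined only at grid points.\<close>

definition mass :: "(real^'n \<Rightarrow> real) \<Rightarrow> ('n \<Rightarrow> real set) \<Rightarrow> real^'n \<Rightarrow> real" where
  "mass f P = (SOME m. \<forall>x\<in>gpts P. f x = (\<Sum>y | y \<in> gpts P \<and> y \<le> x. m y))"

lemma sum_mass:
  assumes "grid P UNIV" "x \<in> gpts P"
  shows "(\<Sum>y | y \<in> gpts P \<and> y \<le> x. mass f P y) = f x"
  using someI_ex[OF poset_moebius_exists[OF finite_gpts[OF assms(1)]], of f] assms(2)
  unfolding mass_def by auto

lemma mass_eqI: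
  assumes "grid P UNIV" "\<And>x. x \<in> gpts P \<Longrightarrow> (\<Sum>y | y \<in> gpts P \<and> y \<le> x. m y) = f x" "y \<in> gpts P"
  shows "mass f P y = m y"
  by (rule poset_moebius_unique[OF finite_gpts[OF assms(1)]]) (use assms sum_mass in auto)

lemma mass_zero:
  assumes "grid P UNIV" shows "mass f P 0 = f 0"
proof -
  have "{y \<in> gpts P. y \<le> 0} = {0}"
    using zero_in_gpts[OF assms] gpts_cube[OF assms] zero_le_vec
    by (auto intro: order_antisym)
  then show ?thesis using sum_mass[OF assms zero_in_gpts[OF assms], of f] by simp
qed

text \<open>The class sums on the right solve the defining equations on the coarse grid, since a
  fine point lies below a coarse \<open>x\<close> exactly when its rounding does; uniqueness does
  the rest.\<close>

lemma mass_refine: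
  assumes P: "grid P UNIV" and Q: "grid Q UNIV" and sub: "\<And>i. P i \<subseteq> Q i" and y: "y \<in> gpts P"
  shows "mass f P y = (\<Sum>z | z \<in> gpts Q \<and> up P z = y. mass f Q z)"
proof (rule mass_eqI[OF P _ y])
  fix x assume x: "x \<in> gpts P"
  have xQ: "x \<in> gpts Q" using x gpts_mono[of P Q] sub by auto
  have cube: "z \<in> unit_cube" if "z \<in> gpts Q" for z using that gpts_cube[OF Q] by auto
  have "(\<Sum>y | y \<in> gpts P \<and> y \<le> x. \<Sum>z | z \<in> gpts Q \<and> up P z = y. mass f Q z) =
      (\<Sum>y | y \<in> gpts P \<and> y \<le> x. \<Sum>z | z \<in> {z\<in>gpts Q. z \<le> x} \<and> up P z = y. mass f Q z)"
    using up_le_iff[OF P cube x] by (intro sum.cong) auto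
  also have "\<dots> = (\<Sum>z | z \<in> gpts Q \<and> z \<le> x. mass f Q z)"
    using up_le_iff[OF P cube x] up_in_gpts[OF P cube]
    by (intro sum.group) (auto simp: finite_gpts P Q)
  finally show "(\<Sum>y | y \<in> gpts P \<and> y \<le> x. \<Sum>z | z \<in> gpts Q \<and> up P z = y. mass f Q z) = f x"
    using sum_mass[OF Q xQ] by simp
qed

text \<open>Triangle inequality inside each rounding class. The predicate \<open>D\<close> confines
  the comparison to a region, such as a stratum or a slab, that is a union of classes.\<close>

lemma mass_abs_mono:
  assumes P: "grid P UNIV" and Q: "grid Q UNIV" and sub: "\<And>i. P i \<subseteq> Q i"
    and D: "\<And>z. z \<in> gpts Q \<Longrightarrow> D (up P z) \<longleftrightarrow> D z"
  shows "(\<Sum>y | y \<in> gpts P \<and> D y. \<bar>mass f P y\<bar>) \<le> (\<Sum>z | z \<in> gpts Q \<and> D z. \<bar>mass f Q z\<bar>)"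
proof -
  have cube: "z \<in> unit_cube" if "z \<in> gpts Q" for z using that gpts_cube[OF Q] by auto
  have "(\<Sum>y | y \<in> gpts P \<and> D y. \<bar>mass f P y\<bar>) \<le>
      (\<Sum>y | y \<in> gpts P \<and> D y. \<Sum>z | z \<in> gpts Q \<and> up P z = y. \<bar>mass f Q z\<bar>)"
    by (intro sum_mono) (auto simp: mass_refine[OF P Q sub] intro!: sum_abs)
  also have "\<dots> = (\<Sum>y | y \<in> gpts P \<and> D y. \<Sum>z | z \<in> {z\<in>gpts Q. D z} \<and> up P z = y. \<bar>mass f Q z\<bar>)"
    using D by (intro sum.cong) auto
  also have "\<dots> = (\<Sum>z | z \<in> gpts Q \<and> D z. \<bar>mass f Q z\<bar>)"
    using D up_in_gpts[OF P cube] by (intro sum.group) (auto simp: finite_gpts P Q)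
  finally show ?thesis .
qed

text \<open>Every corner value is a sum of masses against indicators. For a fixed grid point the
  alternating sum over corners factorises by coordinates, and each factor
  \<open>v y i - u y i\<close> is the indicator of a half-open interval.\<close>

lemma qvol_mass:
  assumes P: "grid P UNIV"
    and ab: "\<And>i. i \<in> S \<Longrightarrow> a$i \<in> P i \<and> b$i \<in> P i \<and> a$i \<le> b$i" and c: "\<And>i. i \<notin> S \<Longrightarrow> c$i \<in> P i"
  shows "qvol f S a b c =
    (\<Sum>y | y \<in> gpts P \<and> (\<forall>i\<in>S. a$i < y$i \<and> y$i \<le> b$i) \<and> (\<forall>i. i \<notin> S \<longrightarrow> y$i \<le> c$i). mass f P y)"
proof -
  define cor where "cor J = (\<chi> i. if i \<in> J then a$i else if i \<in> S then b$i else c$i)" for J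
  define v where "v y i = (of_bool (y$i \<le> b$i) :: real)" for y i
  define u where "u y i = (of_bool (y$i \<le> a$i) :: real)" for y i
  define w where "w y = (of_bool (\<forall>i. i \<notin> S \<longrightarrow> y$i \<le> c$i) :: real)" for y
  have cor: "cor J \<in> gpts P" if "J \<subseteq> S" for J
    using that ab c by (auto simp: cor_def gpts_iff)
  have prod_bool: "(\<Prod>i\<in>A. of_bool (Q i)) = (of_bool (\<forall>i\<in>A. Q i) :: real)" if "finite A" for Q and A :: "'a set"
    using that by (induction A rule: finite_induct) auto
  have ind: "of_bool (y \<le> cor J) = prod (u y) J * prod (v y) (S - J) * w y" if "J \<subseteq> S" for y J
    using that unfolding u_def v_def w_def
    by (subst (1 2) prod_bool) (auto simp: cor_def less_eq_vec_def of_bool_def)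
  have "qvol f S a b c = (\<Sum>J\<in>Pow S. (-1) ^ card J * (\<Sum>y\<in>gpts P. of_bool (y \<le> cor J) * mass f P y))"
    unfolding qvol_def cor_def[symmetric]
  proof (intro sum.cong refl, goal_cases)
    case (1 J)
    have "(\<Sum>y\<in>gpts P. of_bool (y \<le> cor J) * mass f P y) = (\<Sum>y | y \<in> gpts P \<and> y \<le> cor J. mass f P y)"
      by (intro sum.mono_neutral_cong_right) (auto simp: finite_gpts[OF P])
    then show ?case using sum_mass[OF P cor[of J], of f] 1 by simp
  qed
  also have "\<dots> = (\<Sum>J\<in>Pow S. \<Sum>y\<in>gpts P. ((-1) ^ card J * prod (u y) J * prod (v y) (S - J)) * w y * mass f P y)"
    unfolding sum_distrib_left by (intro sum.cong) (auto simp: ind)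
  also have "\<dots> = (\<Sum>y\<in>gpts P. \<Sum>J\<in>Pow S. ((-1) ^ card J * prod (u y) J * prod (v y) (S - J)) * w y * mass f P y)"
    by (rule sum.swap)
  also have "\<dots> = (\<Sum>y\<in>gpts P. (\<Prod>i\<in>S. v y i - u y i) * w y * mass f P y)"
    by (simp add: prod_diff_conv_sum sum_distrib_right)
  also have "\<dots> = (\<Sum>y\<in>gpts P. of_bool ((\<forall>i\<in>S. a$i < y$i \<and> y$i \<le> b$i) \<and> (\<forall>i. i \<notin> S \<longrightarrow> y$i \<le> c$i)) * mass f P y)"
  proof (intro sum.cong refl, goal_cases)
    case (1 y)
    have "v y i - u y i = of_bool (a$i < y$i \<and> y$i \<le> b$i)" if "i \<in> S" for i
      using ab[OF that] by (auto simp: u_def v_def)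
    then have "(\<Prod>i\<in>S. v y i - u y i) = of_bool (\<forall>i\<in>S. a$i < y$i \<and> y$i \<le> b$i)"
      by (simp add: prod_bool)
    then show ?case by (simp add: w_def)
  qed
  also have "\<dots> = (\<Sum>y | y \<in> gpts P \<and> (\<forall>i\<in>S. a$i < y$i \<and> y$i \<le> b$i) \<and> (\<forall>i. i \<notin> S \<longrightarrow> y$i \<le> c$i). mass f P y)"
    by (intro sum.mono_neutral_cong_right) (auto simp: finite_gpts[OF P])
  finally show ?thesis .
qed

section \<open>Vitali variations as sums of masses\<close>

lemma nxt_props:
  assumes "finite A" "1 \<in> A" "t < 1"
  shows "nxt A t \<in> A" "t < nxt A t" "\<And>s. s \<in> A \<Longrightarrow> t < s \<Longrightarrow> nxt A t \<le> s"
proof -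
  have fin: "finite {s\<in>A. t < s}" and ne: "{s\<in>A. t < s} \<noteq> {}" using assms by auto
  show "nxt A t \<in> A" "t < nxt A t" using Min_in[OF fin ne] by (auto simp: nxt_def)
  show "nxt A t \<le> s" if "s \<in> A" "t < s" for s using fin that by (simp add: nxt_def)
qed

lemma nxt_inj:
  assumes "finite A" "1 \<in> A" "s \<in> A" "t \<in> A" "s < 1" "t < 1" "nxt A s = nxt A t"
  shows "s = t"
  using nxt_props(2,3)[OF assms(1,2,5)] nxt_props(2,3)[OF assms(1,2,6)] assms(3,4,7)
  by (metis linorder_less_linear not_less)

lemma nxt_surj:
  assumes "finite A" "0 \<in> A" "t \<in> A" "0 < t"
  shows "\<exists>s\<in>A. s < t \<and> nxt A s = t"
proof -
  have fin: "finite {s\<in>A. s < t}" and ne: "{s\<in>A. s < t} \<noteq> {}" using assms by auto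
  let ?s = "Max {s\<in>A. s < t}"
  have s: "?s \<in> A" "?s < t" using Max_in[OF fin ne] by auto
  have "nxt A ?s = t"
    unfolding nxt_def
  proof (rule Min_eqI)
    show "t \<le> u" if u: "u \<in> {s \<in> A. ?s < s}" for u
    proof (rule ccontr)
      assume "\<not> t \<le> u"
      then have "u \<le> ?s" using fin u by (intro Max_ge) auto
      then show False using u by auto
    qed
  qed (use assms s in auto)
  then show ?thesis using s by blast
qed

text \<open>Indexing cells by upper instead of lower corners turns them into the grid points with
  support exactly \<open>S\<close>. Since no grid value lies strictly between neighbours, a
  half-open cell fixes the coordinates in \<open>S\<close>; the others are free up to the anchor
  \<open>c\<close>, which for \<open>c = 0\<close> leaves one point and for \<open>c = 1\<close> a
  whole fibre.\<close>

lemma cells_sum: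
  assumes P: "grid P UNIV" and c: "c = 0 \<or> c = 1"
  shows "(\<Sum>k\<in>cells P S. \<bar>qvol f S (\<chi> i. k i) (\<chi> i. if i \<in> S then nxt (P i) (k i) else c) (\<chi> i. c)\<bar>)
    = (\<Sum>y | y \<in> gpts P \<and> supp y = S.
        \<bar>\<Sum>z | z \<in> gpts P \<and> (\<forall>i\<in>S. z$i = y$i) \<and> (\<forall>i. i \<notin> S \<longrightarrow> z$i \<le> c). mass f P z\<bar>)"
    (is "?L = (\<Sum>y | y \<in> gpts P \<and> supp y = S. ?F y)")
proof -
  define h where "h k = (\<chi> i. if i \<in> S then nxt (P i) (k i) else 0)" for k :: "'a \<Rightarrow> real"
  note gr = gridD[OF P UNIV_I]
  have kD: "k i \<in> P i" "k i < 1" "0 \<le> k i" if "k \<in> cells P S" "i \<in> S" for k i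
    using that gr(4)[of "k i" i] by (auto simp: cells_def order_less_le)
  have nx: "nxt (P i) (k i) \<in> P i" "k i < nxt (P i) (k i)"
      "\<And>s. s \<in> P i \<Longrightarrow> k i < s \<Longrightarrow> nxt (P i) (k i) \<le> s" if "k \<in> cells P S" "i \<in> S" for k i
    using nxt_props[OF gr(1,3) kD(2)[OF that]] by auto
  have bij: "bij_betw h (cells P S) {y \<in> gpts P. supp y = S}"
    unfolding bij_betw_def
  proof safe
    show "inj_on h (cells P S)"
    proof
      fix k k' assume k: "k \<in> cells P S" "k' \<in> cells P S" "h k = h k'"
      show "k = k'"
      proof
        fix i
        show "k i = k' i"
        proof (cases "i \<in> S")
          case True
          then have "nxt (P i) (k i) = nxt (P i) (k' i)"
            using arg_cong[OF k(3), of "\<lambda>v. v$i"] by (simp add: h_def)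
          then show ?thesis using nxt_inj[OF gr(1,3)] kD k True by blast
        qed (use k in \<open>auto simp: cells_def\<close>)
      qed
    qed
    show "h k \<in> gpts P" if "k \<in> cells P S" for k
      using nx[OF that] gr by (auto simp: gpts_iff h_def)
    show "i \<in> S" if "i \<in> supp (h k)" for i k
      using that by (auto simp: supp_def h_def split: if_splits)
    show "i \<in> supp (h k)" if "k \<in> cells P S" "i \<in> S" for i k
      using that nx[OF that] kD[OF that] by (auto simp: supp_def h_def)
    show "y \<in> h ` cells P (supp y)" if y: "y \<in> gpts P" "S = supp y" for y
    proof -
      have "\<exists>s. s \<in> P i - {1} \<and> nxt (P i) s = y$i" if "i \<in> S" for i
        using nxt_surj[OF gr(1,2), of "y$i" i] y gr(4)[of "y$i" i] that
        by (fastforce simp: gpts_iff supp_def)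
      then obtain k where k: "\<And>i. i \<in> S \<Longrightarrow> k i \<in> P i - {1} \<and> nxt (P i) (k i) = y$i" by metis
      let ?k = "\<lambda>i. if i \<in> S then k i else 0"
      have "?k \<in> cells P S" using k by (auto simp: cells_def)
      moreover have "h ?k = y" using k y by (auto simp: h_def vec_eq_iff supp_def)
      ultimately have "y \<in> h ` cells P S" by (intro rev_image_eqI[of ?k]) simp_all
      then show ?thesis by (simp only: y(2))
    qed
  qed
  have "?L = (\<Sum>k\<in>cells P S. ?F (h k))"
  proof (intro sum.cong refl arg_cong[of _ _ abs])
    fix k assume k: "k \<in> cells P S"
    have eq: "k i < z$i \<and> z$i \<le> nxt (P i) (k i) \<longleftrightarrow> z$i = nxt (P i) (k i)" if "z \<in> gpts P" "i \<in> S" for z i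
      using nx[OF k that(2)] that(1) by (force simp: gpts_iff)
    show "qvol f S (\<chi> i. k i) (\<chi> i. if i \<in> S then nxt (P i) (k i) else c) (\<chi> i. c) =
      (\<Sum>z | z \<in> gpts P \<and> (\<forall>i\<in>S. z$i = h k$i) \<and> (\<forall>i. i \<notin> S \<longrightarrow> z$i \<le> c). mass f P z)"
      by (subst qvol_mass[OF P])
        (use kD[OF k] nx[OF k] gr c eq in \<open>auto simp: h_def less_imp_le intro!: sum.cong\<close>)
  qed
  also have "\<dots> = (\<Sum>y | y \<in> gpts P \<and> supp y = S. ?F y)"
    using sum.reindex_bij_betw[OF bij] .
  finally show ?thesis .
qed

definition stratum_var :: "(real^'n \<Rightarrow> real) \<Rightarrow> 'n set \<Rightarrow> ('n \<Rightarrow> real set) \<Rightarrow> real" where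
  "stratum_var f S P = (\<Sum>y | y \<in> gpts P \<and> supp y = S. \<bar>mass f P y\<bar>)"

lemma grid_extend:
  assumes "grid P S" shows "grid (\<lambda>i. if i \<in> S then P i else {0,1}) UNIV"
  using assms by (auto simp: grid_def)

text \<open>Grid values in directions outside \<open>S\<close> enter neither the cells nor their
  quasi-volumes, so a grid on \<open>S\<close> may be completed by \<open>{0,1}\<close>. The
  supremum then runs over full grids, the same family for all \<open>S\<close>.\<close>

lemma vitali_eq_SUP:
  assumes c: "c = 0 \<or> c = 1"
  shows "vitali f S c = (SUP P\<in>{P. grid P UNIV}. ereal (\<Sum>y | y \<in> gpts P \<and> supp y = S.
        \<bar>\<Sum>z | z \<in> gpts P \<and> (\<forall>i\<in>S. z$i = y$i) \<and> (\<forall>i. i \<notin> S \<longrightarrow> z$i \<le> c). mass f P z\<bar>))"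
    (is "_ = (SUP P\<in>_. ereal (?F P))")
proof -
  define H where "H P = (\<Sum>k\<in>cells P S.
      \<bar>qvol f S (\<chi> i. k i) (\<chi> i. if i \<in> S then nxt (P i) (k i) else c) (\<chi> i. c)\<bar>)" for P
  have H: "?F P = H P" if "grid P UNIV" for P
    unfolding H_def cells_sum[OF that c] ..
  have ext: "H P = H (\<lambda>i. if i \<in> S then P i else {0,1})" for P
  proof -
    have "cells (\<lambda>i. if i \<in> S then P i else {0,1}) S = cells P S" by (auto simp: cells_def)
    moreover have "(\<chi> i. if i \<in> S then nxt (if i \<in> S then P i else {0,1}) (k i) else c)
      = (\<chi> i. if i \<in> S then nxt (P i) (k i) else c)" for k
      by (simp add: vec_eq_iff)
    ultimately show ?thesis by (simp add: H_def)
  qed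
  have "vitali f S c = (SUP P\<in>{P. grid P S}. ereal (H P))"
    by (simp add: vitali_def H_def)
  also have "\<dots> = (SUP P\<in>{P. grid P UNIV}. ereal (H P))"
  proof (rule antisym; rule SUP_least)
    fix P assume "P \<in> {P. grid P S}"
    then show "ereal (H P) \<le> (SUP P\<in>{P. grid P UNIV}. ereal (H P))"
      by (subst ext) (intro SUP_upper, auto intro!: grid_extend)
  next
    fix P :: "'a \<Rightarrow> real set" assume "P \<in> {P. grid P UNIV}"
    then show "ereal (H P) \<le> (SUP P\<in>{P. grid P S}. ereal (H P))"
      by (intro SUP_upper) (auto simp: grid_def)
  qed
  also have "\<dots> = (SUP P\<in>{P. grid P UNIV}. ereal (?F P))"
    by (intro SUP_cong) (simp_all add: H)
  finally show ?thesis .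
qed

lemma vitali_0_eq_SUP: "vitali f S 0 = (SUP P\<in>{P. grid P UNIV}. ereal (stratum_var f S P))"
  unfolding vitali_eq_SUP[OF disjI1[OF refl]]
proof (intro SUP_cong refl arg_cong[of _ _ ereal])
  fix P :: "'a \<Rightarrow> real set" assume "P \<in> {P. grid P UNIV}"
  then have P: "grid P UNIV" by simp
  \<comment> \<open>With anchor 0 the coordinates outside \<open>S\<close> are squeezed to 0, so the
    inner sum collapses to the mass at \<open>y\<close>.\<close>
  have "{z \<in> gpts P. (\<forall>i\<in>S. z$i = y$i) \<and> (\<forall>i. i \<notin> S \<longrightarrow> z$i \<le> 0)} = {y}"
    if y: "y \<in> gpts P" "supp y = S" for y
  proof -
    have "z = y" if z: "z \<in> gpts P" "\<forall>i\<in>S. z$i = y$i" "\<forall>i. i \<notin> S \<longrightarrow> z$i \<le> 0" for z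
      unfolding vec_eq_iff
    proof
      fix i show "z$i = y$i"
      proof (cases "i \<in> S")
        case False
        have "z \<in> unit_cube" using z gpts_cube[OF P] by auto
        then have "z$i = 0" using z(3) False by (auto simp: mem_cube intro: order_antisym)
        moreover have "y$i = 0" using y False by (auto simp: supp_def)
        ultimately show ?thesis by simp
      qed (use z in auto)
    qed
    moreover have "\<forall>i. i \<notin> S \<longrightarrow> y$i \<le> 0" using y by (auto simp: supp_def)
    ultimately show ?thesis using y by blast
  qed
  then show "(\<Sum>y | y \<in> gpts P \<and> supp y = S.
      \<bar>\<Sum>z | z \<in> gpts P \<and> (\<forall>i\<in>S. z$i = y$i) \<and> (\<forall>i. i \<notin> S \<longrightarrow> z$i \<le> 0). mass f P z\<bar>) = stratum_var f S P"
    unfolding stratum_var_def by (intro sum.cong) auto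
qed

lemma stratum_var_nonneg: "0 \<le> stratum_var f S P"
  by (simp add: stratum_var_def sum_nonneg)

lemma sum_strata:
  assumes "grid P UNIV"
  shows "(\<Sum>S\<in>T. stratum_var f S P) = (\<Sum>y | y \<in> gpts P \<and> supp y \<in> T. \<bar>mass f P y\<bar>)"
proof -
  have "(\<Sum>S\<in>T. stratum_var f S P) = (\<Sum>S\<in>T. \<Sum>y | y \<in> {y \<in> gpts P. supp y \<in> T} \<and> supp y = S. \<bar>mass f P y\<bar>)"
    unfolding stratum_var_def by (intro sum.cong) auto
  also have "\<dots> = (\<Sum>y | y \<in> gpts P \<and> supp y \<in> T. \<bar>mass f P y\<bar>)"
    by (intro sum.group) (auto simp: finite_gpts[OF assms])
  finally show ?thesis .
qed

lemma supp_eq_empty_iff: "supp y = {} \<longleftrightarrow> y = 0"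
  by (auto simp: supp_def vec_eq_iff)

definition grid_var :: "(real^'n \<Rightarrow> real) \<Rightarrow> ('n \<Rightarrow> real set) \<Rightarrow> real" where
  "grid_var f P = (\<Sum>y | y \<in> gpts P \<and> y \<noteq> 0. \<bar>mass f P y\<bar>)"

lemma grid_var_strata:
  assumes "grid P UNIV" shows "grid_var f P = (\<Sum>S | S \<noteq> {}. stratum_var f S P)"
  unfolding sum_strata[OF assms] grid_var_def by (simp add: supp_eq_empty_iff)

lemma stratum_var_mono:
  assumes "grid P UNIV" "grid Q UNIV" "\<And>i. P i \<subseteq> Q i"
  shows "stratum_var f S P \<le> stratum_var f S Q"
  unfolding stratum_var_def
  using gpts_cube[OF assms(2)] by (intro mass_abs_mono assms) (auto simp: up_supp assms)

lemma grid_UN: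
  assumes "finite I" "I \<noteq> {}" "\<And>j. j \<in> I \<Longrightarrow> grid (P j) UNIV"
  shows "grid (\<lambda>i. \<Union>j\<in>I. P j i) UNIV"
  using assms unfolding grid_def by blast

text \<open>A sum of suprema becomes a supremum of sums because each stratum variation grows under
  refinement: grids that are nearly optimal for different \<open>S\<close> can be merged into
  one.\<close>

lemma Var_HK0_eq_SUP:
  fixes f :: "real^'n \<Rightarrow> real"
  shows "Var_HK0 f = (SUP P\<in>{P. grid P UNIV}. ereal (grid_var f P))" (is "_ = ?R")
proof (rule antisym)
  show "?R \<le> Var_HK0 f"
  proof (rule SUP_least)
    fix P :: "'n \<Rightarrow> real set" assume "P \<in> {P. grid P UNIV}"
    then have P: "grid P UNIV" by simp
    have "ereal (grid_var f P) = (\<Sum>S | S \<noteq> {}. ereal (stratum_var f S P))"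
      by (simp add: grid_var_strata[OF P])
    also have "\<dots> \<le> Var_HK0 f"
      unfolding Var_HK0_def vitali_0_eq_SUP by (intro sum_mono SUP_upper) (simp add: P)
    finally show "ereal (grid_var f P) \<le> Var_HK0 f" .
  qed
  show "Var_HK0 f \<le> ?R"
  proof (rule ereal_le_real)
    fix B assume B: "?R \<le> ereal B"
    have vB: "grid_var f P \<le> B" if "grid P UNIV" for P
      using SUP_upper[of P "{P. grid P UNIV}" "\<lambda>P. ereal (grid_var f P)"] that B
      by (metis ereal_less_eq(3) mem_Collect_eq order_trans)
    have triv: "grid (\<lambda>i. {0,1}) (UNIV :: 'n set)" by (simp add: grid_def)
    have "\<exists>r. vitali f S 0 = ereal r" if "S \<noteq> {}" for S
    proof -
      have "stratum_var f S P \<le> grid_var f P" if "grid P UNIV" for P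
        unfolding grid_var_strata[OF that] using \<open>S \<noteq> {}\<close>
        by (intro member_le_sum) (auto simp: stratum_var_nonneg)
      then have "vitali f S 0 \<le> ereal B"
        unfolding vitali_0_eq_SUP using vB by (intro SUP_least) (auto intro: order_trans)
      moreover have "ereal 0 \<le> vitali f S 0"
        unfolding vitali_0_eq_SUP
        by (rule SUP_upper2[of "\<lambda>i. {0,1}"]) (auto simp: triv stratum_var_nonneg)
      ultimately show ?thesis by (cases "vitali f S 0") auto
    qed
    then obtain r where r: "\<And>S. S \<noteq> {} \<Longrightarrow> vitali f S 0 = ereal (r S)" by metis
    let ?I = "{S :: 'n set. S \<noteq> {}}"
    have I: "finite ?I" "?I \<noteq> {}" "card ?I > 0" by (auto simp: card_gt_0_iff)
    have "(\<Sum>S\<in>?I. r S) \<le> B"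
    proof (rule field_le_epsilon)
      fix e :: real assume e: "e > 0"
      have "\<exists>P. grid P UNIV \<and> r S - e / card ?I < stratum_var f S P" if "S \<in> ?I" for S
      proof -
        have "ereal (r S - e / card ?I) < vitali f S 0" using r[of S] that e I by simp
        then show ?thesis unfolding vitali_0_eq_SUP less_SUP_iff by auto
      qed
      then obtain P where P: "\<And>S. S \<in> ?I \<Longrightarrow> grid (P S) UNIV"
        "\<And>S. S \<in> ?I \<Longrightarrow> r S - e / card ?I < stratum_var f S (P S)" by metis
      \<comment> \<open>The common refinement loses at most \<open>e / card ?I\<close> on each
        stratum, hence at most \<open>e\<close> in total.\<close>
      define Q where "Q = (\<lambda>i. \<Union>S\<in>?I. P S i)"
      have Q: "grid Q UNIV" unfolding Q_def using P(1) I by (intro grid_UN) auto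
      have "(\<Sum>S\<in>?I. r S) = (\<Sum>S\<in>?I. r S - e / card ?I) + e"
        using I by (simp add: sum_subtractf)
      also have "(\<Sum>S\<in>?I. r S - e / card ?I) \<le> (\<Sum>S\<in>?I. stratum_var f S Q)"
      proof (rule sum_mono)
        fix S assume S: "S \<in> ?I"
        have "stratum_var f S (P S) \<le> stratum_var f S Q"
          using S by (intro stratum_var_mono P Q) (auto simp: Q_def)
        then show "r S - e / card ?I \<le> stratum_var f S Q" using P(2)[OF S] by linarith
      qed
      also have "\<dots> \<le> B" using vB[OF Q] grid_var_strata[OF Q] by metis
      finally show "(\<Sum>S\<in>?I. r S) \<le> B + e" by simp
    qed
    then show "Var_HK0 f \<le> ereal B" by (simp add: Var_HK0_def r)
  qed
qed

lemma Var_HK0_le_iff: "Var_HK0 f \<le> ereal B \<longleftrightarrow> (\<forall>P. grid P UNIV \<longrightarrow> grid_var f P \<le> B)"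
  unfolding Var_HK0_eq_SUP by (simp add: SUP_le_iff)

text \<open>Passing from the anchor 1 to the anchor 0: on a cell in the stratum \<open>S\<close>, the mass differs from
  the quasi-volume anchored at 1 only by masses of strata properly containing \<open>S\<close>.\<close>

lemma stratum_var_bounded:
  fixes f :: "real^'n \<Rightarrow> real"
  assumes "bounded_HK f" "S \<noteq> {}"
  shows "\<exists>B. \<forall>P. grid P UNIV \<longrightarrow> stratum_var f S P \<le> B"
  using assms(2)
\<comment> \<open>Descending induction from the full index set: the error terms for \<open>S\<close>
  live on strictly larger supports, whose complements are smaller.\<close>
proof (induction "card (- S)" arbitrary: S rule: less_induct)
  case less
  let ?sup = "{T. S \<subset> T}"
  have "\<exists>B. \<forall>P. grid P UNIV \<longrightarrow> stratum_var f T P \<le> B" if "S \<subset> T" for T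
    using that less.prems by (intro less.hyps) (auto intro!: psubset_card_mono)
  then obtain B where B: "\<And>T P. S \<subset> T \<Longrightarrow> grid P UNIV \<Longrightarrow> stratum_var f T P \<le> B T" by metis
  have "vitali f S 1 \<noteq> \<infinity>"
    using assms(1) less.prems sum_Pinfty[of "\<lambda>S. vitali f S 1" "{S. S \<noteq> {}}"]
    unfolding bounded_HK_def Var_HK_def by auto
  then obtain b where b: "vitali f S 1 \<le> ereal b" by (cases "vitali f S 1") auto
  have "stratum_var f S P \<le> b + (\<Sum>T\<in>?sup. B T)" if P: "grid P UNIV" for P
  proof -
    let ?G = "{y \<in> gpts P. supp y = S}" and ?m = "mass f P"
    let ?Z = "\<lambda>y. {z \<in> gpts P. (\<forall>i\<in>S. z$i = y$i) \<and> (\<forall>i. i \<notin> S \<longrightarrow> z$i \<le> 1)}"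
    define res where "res z = (\<chi> i. if i \<in> S then z$i else 0)" for z :: "real^'n"
    note fin = finite_gpts[OF P]
    \<comment> \<open>Points over \<open>y\<close> agree with it on \<open>S\<close>, where
      \<open>y\<close> is nonzero, so their support contains \<open>S\<close>; if it equals
      \<open>S\<close>, the point is \<open>y\<close>.\<close>
    have Z: "?Z y = insert y {z. z \<in> {z \<in> gpts P. supp z \<in> ?sup} \<and> res z = y}" if y: "y \<in> ?G" for y
    proof (intro set_eqI iffI)
      fix z assume z: "z \<in> ?Z y"
      have "res z = y" using z y by (auto simp: res_def vec_eq_iff supp_def)
      moreover have "S \<subseteq> supp z" using z y by (auto simp: supp_def)
      moreover have "z = y" if "supp z = S"
        unfolding vec_eq_iff
      proof
        fix i
        have "y$i = (if i \<in> S then z$i else 0)" using \<open>res z = y\<close> by (auto simp: res_def)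
        moreover have "i \<in> S \<or> z$i = 0" using that by (auto simp: supp_def)
        ultimately show "z$i = y$i" by auto
      qed
      ultimately show "z \<in> insert y {z. z \<in> {z \<in> gpts P. supp z \<in> ?sup} \<and> res z = y}"
        using z by auto
    next
      fix z assume z: "z \<in> insert y {z. z \<in> {z \<in> gpts P. supp z \<in> ?sup} \<and> res z = y}"
      have "z \<in> unit_cube" using z y gpts_cube[OF P] by auto
      moreover have "z$i = y$i" if "i \<in> S" for i
        using z that by (auto simp: res_def)
      ultimately show "z \<in> ?Z y" using z y by (auto simp: mem_cube)
    qed
    have "stratum_var f S P \<le> (\<Sum>y\<in>?G. \<bar>\<Sum>z\<in>?Z y. ?m z\<bar> + (\<Sum>z | z \<in> {z \<in> gpts P. supp z \<in> ?sup} \<and> res z = y. \<bar>?m z\<bar>))"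
      unfolding stratum_var_def
    proof (rule sum_mono)
      fix y assume y: "y \<in> ?G"
      let ?W = "{z. z \<in> {z \<in> gpts P. supp z \<in> ?sup} \<and> res z = y}"
      have "(\<Sum>z\<in>?Z y. ?m z) = ?m y + (\<Sum>z\<in>?W. ?m z)"
        unfolding Z[OF y] using y fin by (subst sum.insert) auto
      moreover have "\<bar>\<Sum>z\<in>?W. ?m z\<bar> \<le> (\<Sum>z\<in>?W. \<bar>?m z\<bar>)" by (rule sum_abs)
      ultimately show "\<bar>?m y\<bar> \<le> \<bar>\<Sum>z\<in>?Z y. ?m z\<bar> + (\<Sum>z\<in>?W. \<bar>?m z\<bar>)" by linarith
    qed
    \<comment> \<open>Each point of larger support projects to a single \<open>y\<close>, so the
      error terms add up without repetition.\<close>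
    also have "\<dots> = (\<Sum>y\<in>?G. \<bar>\<Sum>z\<in>?Z y. ?m z\<bar>) + (\<Sum>z | z \<in> gpts P \<and> supp z \<in> ?sup. \<bar>?m z\<bar>)"
    proof -
      have "res ` {z \<in> gpts P. supp z \<in> ?sup} \<subseteq> ?G"
        using gridD(2)[OF P] by (auto simp: res_def gpts_iff supp_def split: if_splits)
      then show ?thesis unfolding sum.distrib using fin by (subst sum.group) auto
    qed
    also have "(\<Sum>z | z \<in> gpts P \<and> supp z \<in> ?sup. \<bar>?m z\<bar>) = (\<Sum>T\<in>?sup. stratum_var f T P)"
      by (simp add: sum_strata[OF P])
    also have "\<dots> \<le> (\<Sum>T\<in>?sup. B T)" using B P by (intro sum_mono) auto
    also have "(\<Sum>y\<in>?G. \<bar>\<Sum>z\<in>?Z y. ?m z\<bar>) \<le> b"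
      using b P unfolding vitali_eq_SUP[OF disjI2[OF refl]] SUP_le_iff by simp
    finally show ?thesis by simp
  qed
  then show ?case by blast
qed

lemma bounded_HK_grid_var:
  fixes f :: "real^'n \<Rightarrow> real"
  assumes "bounded_HK f"
  shows "\<exists>B. \<forall>P. grid P UNIV \<longrightarrow> grid_var f P \<le> B"
proof -
  obtain B where B: "\<And>S P. S \<noteq> {} \<Longrightarrow> grid P UNIV \<Longrightarrow> stratum_var f S P \<le> B S"
    using stratum_var_bounded[OF assms] by metis
  have "grid_var f P \<le> (\<Sum>S | S \<noteq> {}. B S)" if "grid P UNIV" for P
    unfolding grid_var_strata[OF that] using B that by (intro sum_mono) auto
  then show ?thesis by blast
qed

section \<open>Variation including the origin, and the bound for anchor 1\<close>

definition total_var :: "(real^'n \<Rightarrow> real) \<Rightarrow> ('n \<Rightarrow> real set) \<Rightarrow> real" where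
  "total_var f P = (\<Sum>y\<in>gpts P. \<bar>mass f P y\<bar>)"

lemma total_var_eq:
  assumes "grid P UNIV" shows "total_var f P = grid_var f P + \<bar>f 0\<bar>"
proof -
  have "gpts P = insert 0 {y \<in> gpts P. y \<noteq> 0}" using zero_in_gpts[OF assms] by auto
  then have "total_var f P = (\<Sum>y\<in>insert 0 {y \<in> gpts P. y \<noteq> 0}. \<bar>mass f P y\<bar>)"
    unfolding total_var_def by simp
  also have "\<dots> = \<bar>mass f P 0\<bar> + grid_var f P"
    unfolding grid_var_def using finite_gpts[OF assms] by (subst sum.insert) auto
  finally show ?thesis by (simp add: mass_zero[OF assms])
qed

text \<open>The easy direction of the comparison of anchors: points collected over distinct
  \<open>y\<close> lie in distinct fibres of \<open>res\<close>, so no mass is counted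
  twice.\<close>

lemma vitali_1_le:
  fixes f :: "real^'n \<Rightarrow> real"
  assumes B: "\<And>P. grid P UNIV \<Longrightarrow> total_var f P \<le> B"
  shows "vitali f S 1 \<le> ereal B"
  unfolding vitali_eq_SUP[OF disjI2[OF refl]]
proof (rule SUP_least, unfold ereal_less_eq mem_Collect_eq)
  fix P :: "'n \<Rightarrow> real set" assume P: "grid P UNIV"
  define res where "res z = (\<chi> i. if i \<in> S then z$i else 0)" for z :: "real^'n"
  let ?Z = "\<lambda>y. {z \<in> gpts P. (\<forall>i\<in>S. z$i = y$i) \<and> (\<forall>i. i \<notin> S \<longrightarrow> z$i \<le> 1)}"
  have "(\<Sum>y | y \<in> gpts P \<and> supp y = S. \<bar>\<Sum>z\<in>?Z y. mass f P z\<bar>)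
      \<le> (\<Sum>y | y \<in> gpts P \<and> supp y = S. \<Sum>z\<in>?Z y. \<bar>mass f P z\<bar>)"
    by (intro sum_mono sum_abs)
  also have "\<dots> \<le> (\<Sum>y \<in> gpts P. \<Sum>z | z \<in> gpts P \<and> res z = y. \<bar>mass f P z\<bar>)"
  proof (rule sum_mono2[OF finite_gpts[OF P], THEN order_trans[rotated]])
    show "(\<Sum>y | y \<in> gpts P \<and> supp y = S. \<Sum>z\<in>?Z y. \<bar>mass f P z\<bar>) \<le>
        (\<Sum>y | y \<in> gpts P \<and> supp y = S. \<Sum>z | z \<in> gpts P \<and> res z = y. \<bar>mass f P z\<bar>)"
      by (intro sum_mono sum_mono2) (auto simp: finite_gpts[OF P] res_def vec_eq_iff supp_def)
  qed (auto intro: sum_nonneg)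
  also have "\<dots> = total_var f P"
    unfolding total_var_def using gridD(2)[OF P]
    by (intro sum.group) (auto simp: finite_gpts[OF P] res_def gpts_iff)
  finally show "(\<Sum>y | y \<in> gpts P \<and> supp y = S. \<bar>\<Sum>z\<in>?Z y. mass f P z\<bar>) \<le> B" using B[OF P] by simp
qed

section \<open>Right-continuity\<close>

text \<open>Step back to the previous grid value in the directions of the support and stay put
  elsewhere. Off the support \<open>y\<close> is 0, so the resulting half-open box holds no other
  grid point. This brings continuity and complete monotonicity to bear on single masses.\<close>

lemma mass_eq_qvol:
  fixes f :: "real^'n \<Rightarrow> real"
  assumes P: "grid P UNIV" and y: "y \<in> gpts P"
  obtains a where "a \<in> gpts P" "mass f P y = qvol f (supp y) a y y"
    "\<And>i. i \<in> supp y \<Longrightarrow> a$i < y$i" "\<And>i w. i \<in> supp y \<Longrightarrow> w \<in> P i \<Longrightarrow> a$i < w \<Longrightarrow> y$i \<le> w"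
    "\<And>i. i \<notin> supp y \<Longrightarrow> a$i = y$i"
proof -
  note gr = gridD[OF P UNIV_I]
  have yP: "y$i \<in> P i" for i using y by (simp add: gpts_iff)
  have "\<exists>s. s \<in> P i \<and> (if i \<in> supp y then s < y$i \<and> (\<forall>w\<in>P i. s < w \<longrightarrow> y$i \<le> w) else s = y$i)" for i
  proof (cases "i \<in> supp y")
    case True
    then have "0 < y$i" using gr(4)[OF yP, of i] by (auto simp: supp_def)
    then obtain s where s: "s \<in> P i" "s < y$i" "nxt (P i) s = y$i"
      using nxt_surj[OF gr(1,2) yP] by blast
    moreover have "s < 1" using s(2) gr(4)[OF yP, of i] by simp
    ultimately show ?thesis using nxt_props(3)[OF gr(1,3)] True by metis
  qed (use yP in auto)
  then obtain s where s: "\<And>i. s i \<in> P i"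
    "\<And>i. if i \<in> supp y then s i < y$i \<and> (\<forall>w\<in>P i. s i < w \<longrightarrow> y$i \<le> w) else s i = y$i"
    by metis
  define a where "a = (\<chi> i. s i)"
  have a: "a$i = s i" for i by (simp add: a_def)
  have aS: "a$i < y$i" "\<And>w. w \<in> P i \<Longrightarrow> a$i < w \<Longrightarrow> y$i \<le> w" if "i \<in> supp y" for i
    using s(2)[of i] that by (simp_all add: a)
  have "{z \<in> gpts P. (\<forall>i\<in>supp y. a$i < z$i \<and> z$i \<le> y$i) \<and> (\<forall>i. i \<notin> supp y \<longrightarrow> z$i \<le> y$i)} = {y}"
  proof -
    have "z = y" if z: "z \<in> gpts P" "\<forall>i\<in>supp y. a$i < z$i \<and> z$i \<le> y$i" "\<forall>i. i \<notin> supp y \<longrightarrow> z$i \<le> y$i" for z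
      unfolding vec_eq_iff
    proof
      fix i
      have zP: "z$i \<in> P i" using z(1) by (simp add: gpts_iff)
      show "z$i = y$i"
      proof (cases "i \<in> supp y")
        case True
        then show ?thesis using aS(2)[OF True zP] z(2) by force
      next
        case False
        then show ?thesis using z(3) gr(4)[OF zP] by (force simp: supp_def)
      qed
    qed
    then show ?thesis using y aS by auto
  qed
  then have "qvol f (supp y) a y y = mass f P y"
    by (subst qvol_mass[OF P]) (use s(1) yP aS in \<open>auto simp: a less_imp_le\<close>)
  then show thesis using that[of a] s aS by (auto simp: gpts_iff a)
qed

lemma total_var_mono:
  assumes "grid P UNIV" "grid Q UNIV" "\<And>i. P i \<subseteq> Q i"
  shows "total_var f P \<le> total_var f Q"
  using mass_abs_mono[OF assms, of "\<lambda>_. True" f] by (simp add: total_var_def)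

lemma upd_nth [simp]: "upd x i t $ j = (if j = i then t else x$j)"
  by (simp add: upd_def)

lemma upd_upd [simp]: "upd (upd x i s) i t = upd x i t"
  by (simp add: vec_eq_iff)

text \<open>Pairing the corners that differ only in coordinate \<open>i\<close> writes the
  quasi-volume as a signed sum of at most \<open>2 ^ CARD('n)\<close> differences in that
  direction.\<close>

lemma qvol_abs_le:
  fixes f :: "real^'n \<Rightarrow> real"
  assumes i: "i \<in> S"
    and F: "\<And>x. (\<forall>j. j \<noteq> i \<longrightarrow> x$j \<in> {a$j, b$j}) \<Longrightarrow> \<bar>f (upd x i (b$i)) - f (upd x i (a$i))\<bar> \<le> e"
  shows "\<bar>qvol f S a b b\<bar> \<le> 2 ^ CARD('n) * e"
proof -
  define cor where "cor J = (\<chi> j. if j \<in> J then a$j else if j \<in> S then b$j else b$j)" for J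
  let ?S = "S - {i}"
  have e: "0 \<le> e" using F[of a] by force
  have S: "S = insert i ?S" using i by auto
  have "qvol f S a b b = (\<Sum>J\<in>Pow (insert i ?S). (-1) ^ card J * f (cor J))"
    using S by (simp add: qvol_def cor_def)
  also have "\<dots> = (\<Sum>J\<in>Pow ?S. (-1) ^ card J * f (cor J)) + (\<Sum>J\<in>insert i ` Pow ?S. (-1) ^ card J * f (cor J))"
    unfolding Pow_insert by (rule sum.union_disjoint) auto
  also have "(\<Sum>J\<in>insert i ` Pow ?S. (-1) ^ card J * f (cor J)) = (\<Sum>J\<in>Pow ?S. (-1) ^ card (insert i J) * f (cor (insert i J)))"
    by (subst sum.reindex) (auto simp: inj_on_def)
  also have "(\<Sum>J\<in>Pow ?S. (-1) ^ card J * f (cor J)) + \<dots> = (\<Sum>J\<in>Pow ?S. (-1) ^ card J * (f (cor J) - f (cor (insert i J))))"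
    unfolding sum.distrib[symmetric]
  proof (intro sum.cong refl, goal_cases)
    case (1 J)
    then have "i \<notin> J" by auto
    then show ?case by (simp add: algebra_simps)
  qed
  finally have "\<bar>qvol f S a b b\<bar> \<le> (\<Sum>J\<in>Pow ?S. \<bar>f (cor J) - f (cor (insert i J))\<bar>)"
    by (simp add: sum_abs[THEN order_trans] abs_mult power_abs)
  also have "\<dots> \<le> (\<Sum>J\<in>Pow ?S. e)"
  proof (rule sum_mono)
    fix J assume "J \<in> Pow ?S"
    then have "cor J = upd (cor J) i (b$i)" "cor (insert i J) = upd (cor J) i (a$i)"
      by (auto simp: vec_eq_iff cor_def)
    moreover have "\<forall>j. j \<noteq> i \<longrightarrow> cor J$j \<in> {a$j, b$j}" by (auto simp: cor_def)
    ultimately show "\<bar>f (cor J) - f (cor (insert i J))\<bar> \<le> e" using F[of "cor J"] by simp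
  qed
  also have "\<dots> = 2 ^ card ?S * e" by (simp add: card_Pow)
  also have "\<dots> \<le> 2 ^ CARD('n) * e"
    using e by (intro mult_right_mono power_increasing card_mono) auto
  finally show ?thesis .
qed

lemma grid_Un: "grid P UNIV \<Longrightarrow> grid Q UNIV \<Longrightarrow> grid (\<lambda>i. P i \<union> Q i) UNIV"
  by (simp add: grid_def)

lemma grid_insert: "grid P UNIV \<Longrightarrow> 0 \<le> t \<Longrightarrow> t \<le> 1 \<Longrightarrow> grid (P(i := insert t (P i))) UNIV"
  by (simp add: grid_def)

text \<open>A grid nearly attaining the supremum leaves almost no variation to any refinement; since the
  cells of the thin slab behind the hyperplane \<open>x\<^sub>i = t\<close> have small masses by right-continuity of \<open>f\<close>,
  the whole variation of \<open>f\<close> in that slab is small.\<close>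

lemma slab_variation_small:
  fixes f :: "real^'n \<Rightarrow> real"
  assumes rc: "right_cont f" and B: "\<And>P. grid P UNIV \<Longrightarrow> total_var f P \<le> B"
    and t: "0 \<le> t" "t < 1" and e: "0 < e"
  obtains s where "t < s" "s \<le> 1"
    "\<And>Q. grid Q UNIV \<Longrightarrow> t \<in> Q i \<Longrightarrow> s \<in> Q i \<Longrightarrow>
      (\<Sum>y | y \<in> gpts Q \<and> (t < y$i \<and> y$i \<le> s). \<bar>mass f Q y\<bar>) \<le> e"
proof -
  define v where "v = (SUP P\<in>{P. grid P UNIV}. total_var f P)"
  have bdd: "bdd_above (total_var f ` {P. grid P UNIV})" using B by (auto intro!: bdd_aboveI)
  have v: "total_var f P \<le> v" if "grid P UNIV" for P
    unfolding v_def using that bdd by (intro cSUP_upper) auto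
  have "{P. grid P (UNIV :: 'n set)} \<noteq> {}"
  proof -
    have "grid (\<lambda>i. {0,1}) (UNIV :: 'n set)" by (simp add: grid_def)
    then show ?thesis by blast
  qed
  then obtain P0 where P0: "grid P0 UNIV" "v - e/2 < total_var f P0"
    using less_cSUP_iff[OF _ bdd, of "v - e/2"] e by (auto simp: v_def)
  define P where "P = P0(i := insert t (P0 i))"
  have P: "grid P UNIV" using grid_insert[OF P0(1)] t by (simp add: P_def)
  note gr = gridD[OF P UNIV_I]
  have P0P: "total_var f P0 \<le> total_var f P"
    by (rule total_var_mono[OF P0(1) P]) (auto simp: P_def)
  have tP: "t \<in> P i" by (simp add: P_def)
  define u where "u = nxt (P i) t"
  have u: "u \<in> P i" "t < u" "\<And>w. w \<in> P i \<Longrightarrow> t < w \<Longrightarrow> u \<le> w"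
    unfolding u_def using nxt_props[OF gr(1,3) t(2)] by auto
  \<comment> \<open>\<open>K\<close> bounds the number of grid points in the slab times the number
    of corner differences at each; \<open>h\<close> is chosen so that together they give at most
    \<open>e/2\<close>.\<close>
  define K where "K = real (card (gpts P)) * 2 ^ CARD('n)"
  have "card (gpts P) > 0" using zero_in_gpts[OF P] finite_gpts[OF P] by (metis card_gt_0_iff empty_iff)
  then have K: "K > 0" by (simp add: K_def)
  define h where "h = e / (2 * K)"
  have h: "h > 0" using e K by (simp add: h_def)
  \<comment> \<open>Only finitely many right limits matter, at the points of \<open>P\<close> with
    coordinate \<open>i\<close> set to \<open>t\<close>, so one \<open>s\<close> serves them
    all.\<close>
  have ev: "\<forall>\<^sub>F s in at_right t. \<bar>f (upd x i s) - f (upd x i t)\<bar> < h" if "x \<in> gpts P" for x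
  proof -
    have "x \<in> unit_cube" using that gpts_cube[OF P] by auto
    then have "upd x i t \<in> unit_cube" using t by (auto simp: mem_cube)
    then have "((\<lambda>s. f (upd x i s)) \<longlongrightarrow> f (upd x i t)) (at t within {t..1})"
      using rc[unfolded right_cont_def, rule_format, of "upd x i t" i] by simp
    then have "((\<lambda>s. f (upd x i s)) \<longlongrightarrow> f (upd x i t)) (at_right t)"
      using at_within_Icc_at_right[OF t(2)] by simp
    from tendstoD[OF this h] show ?thesis by (simp add: dist_real_def)
  qed
  have "\<forall>\<^sub>F s in at_right t. \<forall>x\<in>gpts P. \<bar>f (upd x i s) - f (upd x i t)\<bar> < h"
    using ev by (intro eventually_ball_finite finite_gpts[OF P]) auto
  moreover have "\<forall>\<^sub>F s in at_right t. s < u"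
    using u(2) by (intro eventually_at_rightI[of t u]) auto
  moreover have "\<forall>\<^sub>F s in at_right t. t < s" by (rule eventually_at_right_less)
  ultimately have "\<forall>\<^sub>F s in at_right t. (\<forall>x\<in>gpts P. \<bar>f (upd x i s) - f (upd x i t)\<bar> < h) \<and> s < u \<and> t < s"
    by (intro eventually_conj)
  then obtain s where s: "\<And>x. x \<in> gpts P \<Longrightarrow> \<bar>f (upd x i s) - f (upd x i t)\<bar> < h" "s < u" "t < s"
    using eventually_happens'[OF trivial_limit_at_right_real] by blast
  have s1: "s \<le> 1" using s(2) gr(4)[OF u(1)] by simp
  \<comment> \<open>As \<open>s\<close> lies before the next grid value \<open>u\<close>, the slab
    contains the single layer \<open>y$i = s\<close>, whose preceding grid value is
    \<open>t\<close>.\<close>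
  define P' where "P' = P(i := insert s (P i))"
  have P': "grid P' UNIV" using grid_insert[OF P] t s s1 by (simp add: P'_def)
  have PP': "total_var f P \<le> total_var f P'"
    by (rule total_var_mono[OF P P']) (auto simp: P'_def)
  have tsP': "t \<in> P' i" "s \<in> P' i" using tP by (auto simp: P'_def)
  define D where "D y \<longleftrightarrow> t < y$i \<and> y$i \<le> s" for y :: "real^'n"
  have D_up: "D (up Q z) \<longleftrightarrow> D z" if "grid Q UNIV" "t \<in> Q i" "s \<in> Q i" "z \<in> unit_cube" for Q z
    using up_nth(3)[OF that(1,4)] that unfolding D_def by (metis not_less)
  have D_P': "y$i = s" if "y \<in> gpts P'" "D y" for y
    using that u(3)[of "y$i"] s(2) by (auto simp: gpts_iff P'_def D_def split: if_splits)
  have small: "\<bar>mass f P' y\<bar> \<le> 2 ^ CARD('n) * h" if y: "y \<in> gpts P'" "D y" for y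
  proof -
    have yi: "y$i = s" using D_P' y .
    then have iS: "i \<in> supp y" using s t by (auto simp: supp_def)
    obtain a where a: "a \<in> gpts P'" "mass f P' y = qvol f (supp y) a y y"
      "a$i < y$i" "\<And>w. w \<in> P' i \<Longrightarrow> a$i < w \<Longrightarrow> y$i \<le> w"
      using mass_eq_qvol[OF P' y(1), of f] iS by metis
    have ai: "a$i = t"
    proof -
      have "t \<le> a$i" using a(4)[OF tsP'(1)] yi s(3) by force
      moreover have "a$i \<in> P i" using a(1,3) yi by (force simp: gpts_iff P'_def split: if_splits)
      ultimately show ?thesis using u(3)[of "a$i"] a(3) yi s(2) by force
    qed
    show ?thesis
      unfolding a(2)
    proof (rule qvol_abs_le[OF iS])
      fix x :: "real^'n" assume x: "\<forall>j. j \<noteq> i \<longrightarrow> x$j \<in> {a$j, y$j}"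
      have "upd x i t \<in> gpts P"
        unfolding gpts_iff
      proof
        fix j show "upd x i t $ j \<in> P j"
          using x[rule_format, of j] tP a(1) y(1) by (cases "j = i") (auto simp: gpts_iff P'_def split: if_splits)
      qed
      from s(1)[OF this] show "\<bar>f (upd x i (y$i)) - f (upd x i (a$i))\<bar> \<le> h"
        by (simp add: yi ai)
    qed
  qed
  have slab: "(\<Sum>y | y \<in> gpts P' \<and> D y. \<bar>mass f P' y\<bar>) \<le> e/2"
  proof -
    have "card {y. y \<in> gpts P' \<and> D y} \<le> card (gpts P)"
    proof (rule card_inj_on_le)
      show "inj_on (\<lambda>y. upd y i t) {y \<in> gpts P'. D y}"
      proof
        fix y z assume yz: "y \<in> {y \<in> gpts P'. D y}" "z \<in> {y \<in> gpts P'. D y}" "upd y i t = upd z i t"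
        then have "y$i = z$i" using D_P' by simp
        moreover have "y$j = z$j" if "j \<noteq> i" for j
          using arg_cong[OF yz(3), of "\<lambda>x. x$j"] that by simp
        ultimately show "y = z" unfolding vec_eq_iff by metis
      qed
      show "(\<lambda>y. upd y i t) ` {y \<in> gpts P'. D y} \<subseteq> gpts P"
        using tP by (auto simp: gpts_iff P'_def split: if_splits)
    qed (rule finite_gpts[OF P])
    then have "real (card {y. y \<in> gpts P' \<and> D y}) * (2 ^ CARD('n) * h) \<le> real (card (gpts P)) * (2 ^ CARD('n) * h)"
      using h by (intro mult_right_mono) auto
    moreover have "(\<Sum>y | y \<in> gpts P' \<and> D y. \<bar>mass f P' y\<bar>) \<le> real (card {y. y \<in> gpts P' \<and> D y}) * (2 ^ CARD('n) * h)"
      using small by (intro sum_bounded_above) auto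
    moreover have "real (card (gpts P)) * (2 ^ CARD('n) * h) = e/2"
    proof -
      have "K * h = e/2" using K by (simp add: h_def)
      then show ?thesis by (simp add: K_def mult.assoc)
    qed
    ultimately show ?thesis by linarith
  qed
  have split: "total_var f Q = (\<Sum>y | y \<in> gpts Q \<and> D y. \<bar>mass f Q y\<bar>) + (\<Sum>y | y \<in> gpts Q \<and> \<not> D y. \<bar>mass f Q y\<bar>)"
    if "grid Q UNIV" for Q
  proof -
    have "total_var f Q = (\<Sum>y\<in>{y \<in> gpts Q. D y} \<union> {y \<in> gpts Q. \<not> D y}. \<bar>mass f Q y\<bar>)"
      unfolding total_var_def by (intro sum.cong) auto
    also have "\<dots> = (\<Sum>y | y \<in> gpts Q \<and> D y. \<bar>mass f Q y\<bar>) + (\<Sum>y | y \<in> gpts Q \<and> \<not> D y. \<bar>mass f Q y\<bar>)"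
      using finite_gpts[OF that] by (intro sum.union_disjoint) auto
    finally show ?thesis .
  qed
  show thesis
  proof
    fix Q :: "'n \<Rightarrow> real set" assume Q: "grid Q UNIV" "t \<in> Q i" "s \<in> Q i"
    \<comment> \<open>On the common refinement the part outside the slab already exceeds
      \<open>v - e\<close>, while the whole is at most \<open>v\<close>; no more than
      \<open>e\<close> is left inside.\<close>
    define R where "R = (\<lambda>j. P' j \<union> Q j)"
    have R: "grid R UNIV" using grid_Un[OF P' Q(1)] by (simp add: R_def)
    have cube: "z \<in> unit_cube" if "z \<in> gpts R" for z using that gpts_cube[OF R] by auto
    have "(\<Sum>y | y \<in> gpts Q \<and> D y. \<bar>mass f Q y\<bar>) \<le> (\<Sum>y | y \<in> gpts R \<and> D y. \<bar>mass f R y\<bar>)"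
      using Q cube D_up by (intro mass_abs_mono R) (auto simp: R_def)
    moreover have "(\<Sum>y | y \<in> gpts P' \<and> \<not> D y. \<bar>mass f P' y\<bar>) \<le> (\<Sum>y | y \<in> gpts R \<and> \<not> D y. \<bar>mass f R y\<bar>)"
      using P' tsP' cube D_up by (intro mass_abs_mono R) (auto simp: R_def)
    moreover note split[OF R] split[OF P'] v[OF R] P0(2) P0P PP' slab
    ultimately have "(\<Sum>y | y \<in> gpts Q \<and> D y. \<bar>mass f Q y\<bar>) \<le> e" by linarith
    then show "(\<Sum>y | y \<in> gpts Q \<and> (t < y$i \<and> y$i \<le> s). \<bar>mass f Q y\<bar>) \<le> e" by (simp add: D_def)
  qed (use s s1 in auto)
qed

text \<open>The increment from \<open>x\<close> to \<open>X n\<close> is the mass of the points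
  below \<open>X n\<close> but not below \<open>x\<close>. Each of them lies in a thin slab behind
  \<open>x\<close> in some coordinate, and every slab carries variation at most \<open>e\<close>,
  however the other coordinates move.\<close>

lemma right_cont_joint:
  fixes f :: "real^'n \<Rightarrow> real"
  assumes rc: "right_cont f" and B: "\<And>P. grid P UNIV \<Longrightarrow> total_var f P \<le> B"
    and x: "x \<in> unit_cube" and X: "\<And>n. X n \<in> unit_cube" "\<And>n. x \<le> X n" "X \<longlonglongrightarrow> x"
  shows "(\<lambda>n. f (X n)) \<longlonglongrightarrow> f x"
proof (rule LIMSEQ_I)
  fix r :: real assume r: "0 < r"
  \<comment> \<open>One slab per coordinate; the factor 2 makes the final inequality strict.\<close>
  define e where "e = r / (2 * real CARD('n))"
  have e: "e > 0" using r by (simp add: e_def)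
  \<comment> \<open>A coordinate equal to 1 cannot grow, so it has no slab; its default
    \<open>s = 1\<close> keeps the grid built below inside the cube.\<close>
  define good where "good i s \<longleftrightarrow> (x$i < 1 \<longrightarrow> x$i < s \<and> s \<le> 1 \<and> (\<forall>Q. grid Q UNIV \<longrightarrow> x$i \<in> Q i \<longrightarrow> s \<in> Q i \<longrightarrow>
      (\<Sum>y | y \<in> gpts Q \<and> (x$i < y$i \<and> y$i \<le> s). \<bar>mass f Q y\<bar>) \<le> e)) \<and> (x$i = 1 \<longrightarrow> s = 1)" for i s
  have "\<exists>s. good i s" for i
  proof (cases "x$i < 1")
    case True
    moreover have "0 \<le> x$i" using x by (simp add: mem_cube)
    ultimately obtain s where "x$i < s" "s \<le> 1" "\<And>Q. grid Q UNIV \<Longrightarrow> x$i \<in> Q i \<Longrightarrow> s \<in> Q i \<Longrightarrow>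
        (\<Sum>y | y \<in> gpts Q \<and> (x$i < y$i \<and> y$i \<le> s). \<bar>mass f Q y\<bar>) \<le> e"
      using slab_variation_small[OF rc B _ True e] by blast
    then show ?thesis using True unfolding good_def by (intro exI[of _ s]) auto
  qed (auto simp: good_def)
  then obtain s where "\<And>i. good i (s i)" by metis
  then have s: "\<And>i. x$i < 1 \<Longrightarrow> x$i < s i \<and> s i \<le> 1"
    "\<And>i Q. x$i < 1 \<Longrightarrow> grid Q UNIV \<Longrightarrow> x$i \<in> Q i \<Longrightarrow> s i \<in> Q i \<Longrightarrow>
      (\<Sum>y | y \<in> gpts Q \<and> (x$i < y$i \<and> y$i \<le> s i). \<bar>mass f Q y\<bar>) \<le> e"
    "\<And>i. x$i = 1 \<Longrightarrow> s i = 1" unfolding good_def by simp_all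
  have "\<forall>\<^sub>F n in sequentially. \<forall>i\<in>{i. x$i < 1}. X n $ i < s i"
  proof (rule eventually_ball_finite)
    show "\<forall>i\<in>{i. x$i < 1}. \<forall>\<^sub>F n in sequentially. X n $ i < s i"
    proof
      fix i assume "i \<in> {i. x$i < 1}"
      then have "x$i < s i" using s(1) by simp
      then show "\<forall>\<^sub>F n in sequentially. X n $ i < s i"
        by (rule order_tendstoD(2)[OF tendsto_vec_nth[OF X(3)]])
    qed
  qed simp
  then obtain N where N: "\<And>n i. N \<le> n \<Longrightarrow> x$i < 1 \<Longrightarrow> X n $ i < s i"
    unfolding eventually_sequentially by auto
  have "norm (f (X n) - f x) < r" if n: "N \<le> n" for n
  proof -
    define Q where "Q j = {0, 1, x$j, X n$j, s j}" for j
    have xc: "0 \<le> x$j \<and> x$j \<le> 1" "0 \<le> X n$j \<and> X n$j \<le> 1" for j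
      using x X(1)[of n] by (auto simp: mem_cube)
    have sc: "0 \<le> s j \<and> s j \<le> 1" for j
      using s(1,3)[of j] xc(1)[of j] by (cases "x$j < 1") auto
    have Q: "grid Q UNIV" using xc sc by (auto simp: grid_def Q_def)
    have pts: "x \<in> gpts Q" "X n \<in> gpts Q" by (auto simp: gpts_iff Q_def)
    define m where "m y = \<bar>mass f Q y\<bar>" for y
    let ?I = "{i. x$i < 1}"
    have "{y \<in> gpts Q. y \<le> X n} = {y \<in> gpts Q. y \<le> x} \<union> {y \<in> gpts Q. y \<le> X n \<and> \<not> y \<le> x}"
      using X(2)[of n] by auto
    then have "f (X n) = (\<Sum>y\<in>{y \<in> gpts Q. y \<le> x} \<union> {y \<in> gpts Q. y \<le> X n \<and> \<not> y \<le> x}. mass f Q y)"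
      using sum_mass[OF Q pts(2), of f] by simp
    also have "\<dots> = f x + (\<Sum>y | y \<in> gpts Q \<and> y \<le> X n \<and> \<not> y \<le> x. mass f Q y)"
      using finite_gpts[OF Q] sum_mass[OF Q pts(1), of f] by (subst sum.union_disjoint) auto
    finally have "norm (f (X n) - f x) \<le> (\<Sum>y | y \<in> gpts Q \<and> y \<le> X n \<and> \<not> y \<le> x. m y)"
      unfolding m_def by (simp add: sum_abs)
    also have "\<dots> \<le> (\<Sum>y | y \<in> gpts Q \<and> y \<le> X n \<and> \<not> y \<le> x. \<Sum>i\<in>?I. of_bool (x$i < y$i \<and> y$i \<le> s i) * m y)"
    proof (rule sum_mono)
      fix y assume "y \<in> {y \<in> gpts Q. y \<le> X n \<and> \<not> y \<le> x}"
      then obtain i where i: "x$i < y$i" "y$i \<le> X n $ i" by (auto simp: less_eq_vec_def not_le)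
      then have "x$i < 1" using xc(2)[of i] by linarith
      then have "i \<in> ?I" "x$i < y$i \<and> y$i \<le> s i" using i N[OF n, of i] by auto
      then have "m y = of_bool (x$i < y$i \<and> y$i \<le> s i) * m y" by simp
      also have "\<dots> \<le> (\<Sum>i\<in>?I. of_bool (x$i < y$i \<and> y$i \<le> s i) * m y)"
        by (rule member_le_sum[OF \<open>i \<in> ?I\<close>]) (auto simp: m_def)
      finally show "m y \<le> (\<Sum>i\<in>?I. of_bool (x$i < y$i \<and> y$i \<le> s i) * m y)" .
    qed
    also have "\<dots> \<le> (\<Sum>y\<in>gpts Q. \<Sum>i\<in>?I. of_bool (x$i < y$i \<and> y$i \<le> s i) * m y)"
      by (rule sum_mono2) (auto simp: finite_gpts[OF Q] m_def intro!: sum_nonneg)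
    also have "\<dots> = (\<Sum>i\<in>?I. \<Sum>y\<in>gpts Q. of_bool (x$i < y$i \<and> y$i \<le> s i) * m y)"
      by (rule sum.swap)
    also have "\<dots> = (\<Sum>i\<in>?I. \<Sum>y | y \<in> gpts Q \<and> (x$i < y$i \<and> y$i \<le> s i). m y)"
      by (intro sum.cong refl sum.mono_neutral_cong_right) (auto simp: finite_gpts[OF Q])
    also have "\<dots> \<le> (\<Sum>i\<in>?I. e)"
      unfolding m_def using s(2)[OF _ Q] by (intro sum_mono) (auto simp: Q_def)
    also have "\<dots> \<le> real CARD('n) * e"
      using e by (simp add: mult_right_mono card_mono)
    also have "\<dots> < r" using r by (simp add: e_def)
    finally show ?thesis .
  qed
  then show "\<exists>N. \<forall>n\<ge>N. norm (f (X n) - f x) < r" by blast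
qed

section \<open>Measures on the dyadic tree\<close>

definition dyadic :: "nat \<Rightarrow> 'n \<Rightarrow> real set" where
  "dyadic n = (\<lambda>_. (\<lambda>k. real k / 2 ^ n) ` {..2 ^ n})"

text \<open>One dyadic step beyond the rounding of \<open>x\<close>, capped at 1 to stay in the
  cube. The extra step is there because dyadic values may decrease to a limit not exceeding
  \<open>x\<close> and still exceed the rounding of \<open>x\<close> at every level.\<close>

definition dyadic_above :: "nat \<Rightarrow> real^'n \<Rightarrow> real^'n" where
  "dyadic_above n x = (\<chi> i. min 1 (up (dyadic n) x $ i + 1 / 2 ^ n))"

lemma grid_dyadic [simp]: "grid (dyadic n) UNIV"
proof -
  have "1 \<in> (\<lambda>k. real k / 2 ^ n) ` {..2 ^ n}" by (rule image_eqI[of _ _ "2 ^ n"]) auto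
  moreover have "0 \<in> (\<lambda>k. real k / 2 ^ n) ` {..2 ^ n}" by (rule image_eqI[of _ _ 0]) auto
  moreover have "(\<lambda>k. real k / 2 ^ n) ` {..2 ^ n} \<subseteq> {0..1}" by (auto simp: divide_le_eq)
  ultimately show ?thesis by (simp add: grid_def dyadic_def)
qed

lemma dyadic_Suc: "dyadic n i \<subseteq> dyadic (Suc n) i"
proof
  fix t assume "t \<in> dyadic n i"
  then obtain k where "t = real k / 2 ^ n" "k \<le> 2 ^ n" by (auto simp: dyadic_def)
  then show "t \<in> dyadic (Suc n) i"
    unfolding dyadic_def by (intro image_eqI[of _ _ "2 * k"]) auto
qed

lemma dyadic_mono: "n \<le> m \<Longrightarrow> dyadic n i \<subseteq> dyadic m i"
  using lift_Suc_mono_le[of "\<lambda>n. dyadic n i", OF dyadic_Suc] by blast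

lemmas fin_dyadic [simp] = finite_gpts[OF grid_dyadic]
lemmas dyadic_cube = subsetD[OF gpts_cube[OF grid_dyadic]]
lemmas up_dyadic = up_in_gpts[OF grid_dyadic]

lemma dyadic_gpts_mono: "n \<le> m \<Longrightarrow> gpts (dyadic n) \<subseteq> gpts (dyadic m)"
  by (rule gpts_mono[OF dyadic_mono])

lemma up_dyadic_up: "n \<le> m \<Longrightarrow> x \<in> unit_cube \<Longrightarrow> up (dyadic n) (up (dyadic m) x) = up (dyadic n) x"
  by (rule up_up[OF grid_dyadic grid_dyadic dyadic_mono])

lemma up_dyadic_ge: "x \<in> unit_cube \<Longrightarrow> x$i \<le> up (dyadic n) x $ i"
  by (rule up_nth(2)[OF grid_dyadic])

lemma up_dyadic_le:
  assumes "x \<in> unit_cube" shows "up (dyadic n) x $ i \<le> x$i + 1 / 2 ^ n"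
proof -
  define k where "k = nat \<lceil>2 ^ n * x$i\<rceil>"
  have x: "0 \<le> x$i" "x$i \<le> 1" using assms by (auto simp: mem_cube)
  have k: "real k = of_int \<lceil>2 ^ n * x$i\<rceil>" using x by (simp add: k_def)
  have "2 ^ n * x$i \<le> 2 ^ n" using x by simp
  then have "\<lceil>2 ^ n * x$i\<rceil> \<le> 2 ^ n" by (simp add: ceiling_le_iff)
  then have "k \<le> 2 ^ n" by (simp add: k_def nat_le_iff)
  then have kdy: "real k / 2 ^ n \<in> dyadic n i" by (auto simp: dyadic_def)
  have "2 ^ n * x$i \<le> real k" unfolding k by (rule le_of_int_ceiling)
  then have "x$i \<le> real k / 2 ^ n" by (simp add: le_divide_eq mult.commute)
  then have "up (dyadic n) x $ i \<le> real k / 2 ^ n" using up_nth(3)[OF grid_dyadic assms kdy] by simp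
  also have "\<dots> \<le> (2 ^ n * x$i + 1) / 2 ^ n"
    unfolding k using of_int_ceiling_le_add_one[of "2 ^ n * x$i"] by (intro divide_right_mono) auto
  also have "\<dots> = x$i + 1 / 2 ^ n" by (simp add: add_divide_distrib)
  finally show ?thesis .
qed

lemma dyadic_above_in_gpts:
  assumes "x \<in> unit_cube" shows "dyadic_above n x \<in> gpts (dyadic n)"
  unfolding gpts_iff
proof
  fix i
  have "up (dyadic n) x $ i \<in> dyadic n i" using up_dyadic[OF assms] by (simp add: gpts_iff)
  then obtain k where k: "k \<le> 2 ^ n" "up (dyadic n) x $ i = real k / 2 ^ n" by (auto simp: dyadic_def)
  have eq: "dyadic_above n x $ i = min 1 (real (Suc k) / 2 ^ n)"
    by (simp add: dyadic_above_def k(2) add_divide_distrib add.commute)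
  show "dyadic_above n x $ i \<in> dyadic n i"
  proof (cases "Suc k \<le> 2 ^ n")
    case True
    then have "real (Suc k) \<le> 2 ^ n" by (metis of_nat_le_iff of_nat_numeral of_nat_power)
    then have "dyadic_above n x $ i = real (Suc k) / 2 ^ n" unfolding eq by (simp add: min_def divide_le_eq)
    then show ?thesis using True by (auto simp: dyadic_def simp del: of_nat_Suc)
  next
    case False
    then have "2 ^ n \<le> real (Suc k)" by (metis nat_le_linear of_nat_le_iff of_nat_numeral of_nat_power)
    then have "dyadic_above n x $ i = 1" unfolding eq by (simp add: min_def divide_le_eq)
    then show ?thesis using gridD(3)[OF grid_dyadic] by auto
  qed
qed

lemma dyadic_above_ge: "x \<in> unit_cube \<Longrightarrow> x \<le> dyadic_above n x"
  unfolding less_eq_vec_def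
proof
  fix i assume "x \<in> unit_cube"
  moreover have "0 < (1 / 2 ^ n :: real)" by simp
  ultimately show "x$i \<le> dyadic_above n x $ i"
    using up_dyadic_ge[of x i n] unfolding dyadic_above_def by (auto simp: mem_cube intro: order_trans)
qed

lemma dyadic_above_le: "x \<in> unit_cube \<Longrightarrow> dyadic_above n x $ i \<le> x$i + 2 / 2 ^ n"
  using up_dyadic_le[of x n i] by (simp add: dyadic_above_def min_le_iff_disj)

lemma dyadic_above_mono:
  assumes x: "x \<in> unit_cube" shows "dyadic_above (Suc n) x \<le> dyadic_above n x"
  unfolding less_eq_vec_def
proof
  fix i
  have "up (dyadic n) x \<in> gpts (dyadic (Suc n))" using up_dyadic[OF x] dyadic_gpts_mono[of n "Suc n"] by auto
  then have "up (dyadic (Suc n)) x \<le> up (dyadic n) x"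
    using up_le_iff[OF grid_dyadic x] up_dyadic_ge[OF x] by (auto simp: less_eq_vec_def)
  moreover have "1 / 2 ^ Suc n \<le> (1 / 2 ^ n :: real)" by (simp add: field_simps)
  ultimately have "up (dyadic (Suc n)) x $ i + 1 / 2 ^ Suc n \<le> up (dyadic n) x $ i + 1 / 2 ^ n"
    by (intro add_mono) (auto simp: less_eq_vec_def)
  then show "dyadic_above (Suc n) x $ i \<le> dyadic_above n x $ i" unfolding dyadic_above_def by auto
qed

lemma pow2_tendsto_0: "(\<lambda>n. c / 2 ^ n :: real) \<longlonglongrightarrow> 0"
  using tendsto_mult_right_zero[OF LIMSEQ_power_zero[of "1/2::real"], of c] by (simp add: power_divide)

lemma dyadic_above_tendsto:
  assumes x: "x \<in> unit_cube" shows "(\<lambda>n. dyadic_above n x) \<longlonglongrightarrow> x"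
proof (rule vec_tendstoI)
  fix i
  have lim: "(\<lambda>n. x$i + 2 / 2 ^ n) \<longlonglongrightarrow> x$i"
    using tendsto_add[OF tendsto_const pow2_tendsto_0[of 2], of "x$i"] by simp
  show "(\<lambda>n. dyadic_above n x $ i) \<longlonglongrightarrow> x$i"
    by (rule tendsto_sandwich[OF _ _ tendsto_const lim])
      (use dyadic_above_ge[OF x] dyadic_above_le[OF x] in \<open>auto simp: less_eq_vec_def\<close>)
qed

section \<open>Realising a tree of masses by nested intervals\<close>

lemma interval_partition:
  fixes w :: "'a \<Rightarrow> real"
  assumes "finite Z" "\<And>z. z \<in> Z \<Longrightarrow> 0 \<le> w z"
  shows "\<exists>A. (\<forall>z\<in>Z. {A z..<A z + w z} \<subseteq> {c..<c + sum w Z}) \<and>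
    (\<forall>\<omega>\<in>{c..<c + sum w Z}. \<exists>!z. z \<in> Z \<and> \<omega> \<in> {A z..<A z + w z})"
  using assms
proof (induction Z rule: finite_induct)
  case (insert a Z)
  have "\<exists>A. (\<forall>z\<in>Z. {A z..<A z + w z} \<subseteq> {c..<c + sum w Z}) \<and>
    (\<forall>\<omega>\<in>{c..<c + sum w Z}. \<exists>!z. z \<in> Z \<and> \<omega> \<in> {A z..<A z + w z})"
    by (rule insert.IH) (simp add: insert.prems)
  then obtain A where "\<forall>z\<in>Z. {A z..<A z + w z} \<subseteq> {c..<c + sum w Z}"
    "\<forall>\<omega>\<in>{c..<c + sum w Z}. \<exists>!z. z \<in> Z \<and> \<omega> \<in> {A z..<A z + w z}"
    by (elim exE conjE)
  note A = this[rule_format]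
  \<comment> \<open>The intervals are laid end to end, the new one behind the others; zero weights
    give empty intervals, so uniqueness of the piece is unaffected.\<close>
  define A' where "A' = A(a := c + sum w Z)"
  have A': "A' a = c + sum w Z" "\<And>z. z \<in> Z \<Longrightarrow> A' z = A z" using insert.hyps by (auto simp: A'_def)
  have S: "sum w (insert a Z) = sum w Z + w a" using insert.hyps by simp
  have w: "0 \<le> w a" "0 \<le> sum w Z" using insert.prems by (auto intro: sum_nonneg)
  have "{A' z..<A' z + w z} \<subseteq> {c..<c + sum w (insert a Z)}" if "z \<in> insert a Z" for z
  proof (cases "z = a")
    case True
    then show ?thesis using w by (auto simp: A' S)
  next
    case False
    then have "{A' z..<A' z + w z} \<subseteq> {c..<c + sum w Z}" using A(1) that A'(2) by simp
    also have "\<dots> \<subseteq> {c..<c + sum w (insert a Z)}" using w by (auto simp: S)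
    finally show ?thesis .
  qed
  moreover have "\<exists>!z. z \<in> insert a Z \<and> \<omega> \<in> {A' z..<A' z + w z}" if "\<omega> \<in> {c..<c + sum w (insert a Z)}" for \<omega>
  proof (cases "\<omega> < c + sum w Z")
    case True
    then have "\<exists>!z. z \<in> Z \<and> \<omega> \<in> {A z..<A z + w z}" using that by (intro A(2)) auto
    then obtain z where "z \<in> Z \<and> \<omega> \<in> {A z..<A z + w z}"
      "\<forall>y. y \<in> Z \<and> \<omega> \<in> {A y..<A y + w y} \<longrightarrow> y = z" by (rule ex1E)
    note z = this[rule_format]
    show ?thesis
    proof (rule ex1I[of _ z])
      show "z \<in> insert a Z \<and> \<omega> \<in> {A' z..<A' z + w z}" using z(1) A' by simp
      show "y = z" if "y \<in> insert a Z \<and> \<omega> \<in> {A' y..<A' y + w y}" for y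
        using that True A' z(2)[of y] by (cases "y = a") auto
    qed
  next
    case False
    show ?thesis
    proof (rule ex1I[of _ a])
      show "a \<in> insert a Z \<and> \<omega> \<in> {A' a..<A' a + w a}" using False that by (auto simp: A' S)
      show "y = a" if "y \<in> insert a Z \<and> \<omega> \<in> {A' y..<A' y + w y}" for y
      proof (rule ccontr)
        assume "y \<noteq> a"
        then have "y \<in> Z" "\<omega> \<in> {A y..<A y + w y}" using that A' by auto
        then show False using A(1)[of y] False by auto
      qed
    qed
  qed
  ultimately show ?case by (intro exI[of _ A']) blast
qed auto

text \<open>Nested intervals \<open>I n y\<close> of length \<open>M n y\<close> represent the dyadic tree in \<open>[0,T)\<close>; the measure is the
  image of Lebesgue measure under the limit of the simple functions with value \<open>y\<close> on \<open>I n y\<close>.\<close>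

lemma tree_measure:
  fixes M :: "nat \<Rightarrow> real^'n \<Rightarrow> real"
  assumes nn: "\<And>n y. y \<in> gpts (dyadic n) \<Longrightarrow> 0 \<le> M n y"
    and cons: "\<And>n y. y \<in> gpts (dyadic n) \<Longrightarrow>
      M n y = (\<Sum>z | z \<in> gpts (dyadic (Suc n)) \<and> up (dyadic n) z = y. M (Suc n) z)"
  obtains \<mu> :: "(real^'n) measure" where "finite_measure \<mu>" "sets \<mu> = sets borel"
    "measure \<mu> UNIV = (\<Sum>y\<in>gpts (dyadic 0). M 0 y)"
    "\<And>x. x \<in> unit_cube \<Longrightarrow> (\<lambda>n. \<Sum>y | y \<in> gpts (dyadic n) \<and> y \<le> dyadic_above n x. M n y) \<longlonglongrightarrow> measure \<mu> (cbox 0 x)"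
proof -
  let ?G = "\<lambda>n. gpts (dyadic n) :: (real^'n) set"
  define T where "T = (\<Sum>y\<in>?G 0. M 0 y)"
  define seg where "seg L n y = {L y..<L y + M n y}" for L :: "real^'n \<Rightarrow> real" and n y
  define part where "part n L \<longleftrightarrow> (\<forall>y\<in>?G n. seg L n y \<subseteq> {0..<T}) \<and>
    (\<forall>\<omega>\<in>{0..<T}. \<exists>!y. y \<in> ?G n \<and> \<omega> \<in> seg L n y)" for n L
  define nest where "nest n L L' \<longleftrightarrow> (\<forall>z\<in>?G (Suc n). seg L' (Suc n) z \<subseteq> seg L n (up (dyadic n) z))" for n L L'
  have "\<exists>L. \<forall>n. part n (L n) \<and> nest n (L n) (L (Suc n))"
  proof (rule dependent_nat_choice)
    show "\<exists>L. part 0 L"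
      using interval_partition[of "?G 0" "M 0" 0, OF fin_dyadic nn] unfolding part_def seg_def T_def by simp
  next
    fix L n assume L: "part n L"
    define ch where "ch y = {z. z \<in> ?G (Suc n) \<and> up (dyadic n) z = y}" for y
    \<comment> \<open>Consistency of the family says that the children of \<open>y\<close> exactly
      fill its interval.\<close>
    have chM: "sum (M (Suc n)) (ch y) = M n y" if "y \<in> ?G n" for y
      using cons[OF that] by (simp add: ch_def)
    have "\<exists>A. (\<forall>z\<in>ch y. {A z..<A z + M (Suc n) z} \<subseteq> {L y..<L y + sum (M (Suc n)) (ch y)}) \<and>
      (\<forall>\<omega>\<in>{L y..<L y + sum (M (Suc n)) (ch y)}. \<exists>!z. z \<in> ch y \<and> \<omega> \<in> {A z..<A z + M (Suc n) z})" for y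
      by (rule interval_partition) (auto simp: ch_def nn)
    then obtain A where A: "\<And>y z. z \<in> ch y \<Longrightarrow> {A y z..<A y z + M (Suc n) z} \<subseteq> {L y..<L y + sum (M (Suc n)) (ch y)}"
      "\<And>y \<omega>. \<omega> \<in> {L y..<L y + sum (M (Suc n)) (ch y)} \<Longrightarrow> \<exists>!z. z \<in> ch y \<and> \<omega> \<in> {A y z..<A y z + M (Suc n) z}"
      by metis
    define L' where "L' z = A (up (dyadic n) z) z" for z
    have upG: "up (dyadic n) z \<in> ?G n" if "z \<in> ?G (Suc n)" for z using up_dyadic[OF dyadic_cube[OF that]] .
    have L': "seg L' (Suc n) z \<subseteq> seg L n (up (dyadic n) z)" if "z \<in> ?G (Suc n)" for z
      using A(1)[of z "up (dyadic n) z"] chM[OF upG[OF that]] that unfolding seg_def L'_def by (simp add: ch_def)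
    have ex: "\<exists>!z. z \<in> ?G (Suc n) \<and> \<omega> \<in> seg L' (Suc n) z" if \<omega>: "\<omega> \<in> {0..<T}" for \<omega>
    proof -
      have "\<exists>!y. y \<in> ?G n \<and> \<omega> \<in> seg L n y" using L \<omega> unfolding part_def by (elim conjE) (rule bspec)
      then obtain y where yy: "y \<in> ?G n \<and> \<omega> \<in> seg L n y" "\<forall>y'. y' \<in> ?G n \<and> \<omega> \<in> seg L n y' \<longrightarrow> y' = y"
        by (rule ex1E)
      note y = conjunct1[OF yy(1)] conjunct2[OF yy(1)] yy(2)[rule_format, OF conjI]
      have "\<omega> \<in> {L y..<L y + sum (M (Suc n)) (ch y)}" using y(1,2) by (simp add: seg_def chM)
      from A(2)[OF this] obtain z where zz: "z \<in> ch y \<and> \<omega> \<in> {A y z..<A y z + M (Suc n) z}"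
        "\<forall>z'. z' \<in> ch y \<and> \<omega> \<in> {A y z'..<A y z' + M (Suc n) z'} \<longrightarrow> z' = z"
        by (rule ex1E)
      note z = conjunct1[OF zz(1)] conjunct2[OF zz(1)] zz(2)[rule_format, OF conjI]
      have zG: "z \<in> ?G (Suc n)" "up (dyadic n) z = y" using z(1) by (simp_all add: ch_def)
      have "\<omega> \<in> seg L' (Suc n) z" using z(2) unfolding seg_def L'_def zG(2) .
      show ?thesis
      proof (rule ex1I[of _ z])
        show "z \<in> ?G (Suc n) \<and> \<omega> \<in> seg L' (Suc n) z" using zG(1) \<open>\<omega> \<in> seg L' (Suc n) z\<close> ..
        fix z' assume z': "z' \<in> ?G (Suc n) \<and> \<omega> \<in> seg L' (Suc n) z'"
        then have "up (dyadic n) z' = y" using L'[of z'] upG[of z'] y(3) by blast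
        then have "z' \<in> ch y" "\<omega> \<in> {A y z'..<A y z' + M (Suc n) z'}"
          using z' unfolding seg_def L'_def by (simp add: ch_def, simp only:)
        then show "z' = z" by (rule z(3))
      qed
    qed
    have sub: "seg L' (Suc n) z \<subseteq> {0..<T}" if "z \<in> ?G (Suc n)" for z
      using L'[OF that] L upG[OF that] unfolding part_def by blast
    have "part (Suc n) L'" unfolding part_def by (intro conjI ballI sub ex)
    moreover have "nest n L L'" unfolding nest_def by (intro ballI L')
    ultimately show "\<exists>L'. part (Suc n) L' \<and> nest n L L'" by blast
  qed
  then obtain L where L: "\<And>n. part n (L n)" "\<And>n. nest n (L n) (L (Suc n))" by blast
  define I where "I n y = seg (L n) n y" for n y
  have I_sub: "I n y \<subseteq> {0..<T}" if "y \<in> ?G n" for n y using L(1)[of n] that by (auto simp: part_def I_def)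
  have I_lim: "0 \<le> \<omega> \<and> \<omega> < T" if "y \<in> ?G n" "\<omega> \<in> I n y" for n y \<omega>
    using subsetD[OF I_sub[OF that(1)] that(2)] by simp
  have I_ex: "\<exists>!y. y \<in> ?G n \<and> \<omega> \<in> I n y" if "\<omega> \<in> {0..<T}" for n \<omega>
    using L(1)[of n] that unfolding part_def I_def by (elim conjE) (rule bspec)
  have I_nest: "I (Suc n) z \<subseteq> I n (up (dyadic n) z)" if "z \<in> ?G (Suc n)" for n z
    using L(2)[of n] that by (auto simp: nest_def I_def)
  have I_borel [measurable]: "I n y \<in> sets borel" for n y by (simp add: I_def seg_def)
  define X where "X n \<omega> = (\<Sum>y\<in>?G n. indicator (I n y) \<omega> *\<^sub>R y)" for n and \<omega> :: real
  have X_eq: "X n \<omega> = y" if "y \<in> ?G n" "\<omega> \<in> I n y" for n y \<omega>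
  proof -
    have "\<omega> \<in> {0..<T}" using I_sub[OF that(1)] that(2) by blast
    from I_ex[OF this, of n] obtain w where w: "\<forall>z. z \<in> ?G n \<and> \<omega> \<in> I n z \<longrightarrow> z = w"
      by (rule ex1E)
    have "\<omega> \<notin> I n z" if "z \<in> ?G n" "z \<noteq> y" for z
    proof
      assume "\<omega> \<in> I n z"
      then have "z = w" "y = w" using w \<open>z \<in> ?G n\<close> \<open>y \<in> ?G n\<close> \<open>\<omega> \<in> I n y\<close> by blast+
      then show False using \<open>z \<noteq> y\<close> by simp
    qed
    then have "X n \<omega> = (\<Sum>z\<in>?G n. if z = y then z else 0)"
      unfolding X_def using that by (intro sum.cong) (auto simp: indicator_def)
    also have "\<dots> = y" using that by simp
    finally show ?thesis .
  qed
  have X_in: "X n \<omega> \<in> ?G n" "\<omega> \<in> I n (X n \<omega>)" if "\<omega> \<in> {0..<T}" for n \<omega>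
  proof -
    from I_ex[OF that, of n] obtain y where y: "y \<in> ?G n \<and> \<omega> \<in> I n y" by (rule ex1E)
    then have "X n \<omega> = y" by (intro X_eq) auto
    then show "X n \<omega> \<in> ?G n" "\<omega> \<in> I n (X n \<omega>)" using y by simp_all
  qed
  \<comment> \<open>The default 0 outside \<open>[0,T)\<close> keeps all values in the cube and lets
    the limit exist everywhere.\<close>
  have X_0: "X n \<omega> = 0" if "\<omega> \<notin> {0..<T}" for n \<omega>
    unfolding X_def using that I_lim by (intro sum.neutral) (force simp: indicator_def)
  have X_cube: "X n \<omega> \<in> unit_cube" for n \<omega>
    using X_in[of \<omega> n] X_0[of \<omega> n] dyadic_cube by (cases "\<omega> \<in> {0..<T}") (auto simp: mem_cube)
  have X_Suc: "X n \<omega> = up (dyadic n) (X (Suc n) \<omega>)" if "\<omega> \<in> {0..<T}" for n \<omega>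
    using I_nest[OF X_in(1)[OF that]] X_in(2)[OF that, of "Suc n"] up_dyadic[OF X_cube]
    by (intro X_eq) auto
  have X_up: "X n \<omega> = up (dyadic n) (X m \<omega>)" if "\<omega> \<in> {0..<T}" "n < m" for n m \<omega>
    using that(2)
  proof (induction m)
    case (Suc m)
    show ?case
    proof (cases "n = m")
      case False
      then have "X n \<omega> = up (dyadic n) (up (dyadic m) (X (Suc m) \<omega>))" using Suc X_Suc[OF that(1), of m] by simp
      then show ?thesis using Suc.prems X_cube by (simp add: up_dyadic_up)
    next
      case True
      then show ?thesis using X_Suc[OF that(1), of m] by (simp only:)
    qed
  qed simp
  \<comment> \<open>Each value is the rounding of every later one, so coordinates decrease, and by
    at most one mesh width after level \<open>n\<close>; this gives the limit and its error.\<close>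
  have X_dec: "X m \<omega> $ i \<le> X n \<omega> $ i \<and> X n \<omega> $ i \<le> X m \<omega> $ i + 1 / 2 ^ n" if "n \<le> m" for n m \<omega> i
  proof (cases "n = m")
    case False
    then have nm: "n < m" using that by simp
    show ?thesis
    proof (cases "\<omega> \<in> {0..<T}")
      case True
      show ?thesis
        unfolding X_up[OF True nm] using up_dyadic_ge[OF X_cube] up_dyadic_le[OF X_cube] by blast
    qed (simp add: X_0)
  qed simp
  have "\<exists>l. (\<lambda>n. X n \<omega>) \<longlonglongrightarrow> l" for \<omega>
  proof -
    have "\<exists>l. (\<lambda>n. X n \<omega> $ i) \<longlonglongrightarrow> l" for i
    proof (rule decseq_convergent[of "\<lambda>n. X n \<omega> $ i" 0])
      show "decseq (\<lambda>n. X n \<omega> $ i)" using X_dec by (auto simp: decseq_def)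
      show "\<forall>n. 0 \<le> X n \<omega> $ i" using X_cube[of _ \<omega>] by (auto simp: mem_cube)
    qed blast
    then obtain l where "\<And>i. (\<lambda>n. X n \<omega> $ i) \<longlonglongrightarrow> l i" by metis
    then have "(\<lambda>n. X n \<omega>) \<longlonglongrightarrow> (\<chi> i. l i)" by (intro vec_tendstoI) simp
    then show ?thesis by blast
  qed
  then obtain Y where Y: "\<And>\<omega>. (\<lambda>n. X n \<omega>) \<longlonglongrightarrow> Y \<omega>" by metis
  have Yi: "(\<lambda>n. X n \<omega> $ i) \<longlonglongrightarrow> Y \<omega> $ i" for \<omega> i by (rule tendsto_vec_nth[OF Y])
  have Y_le: "Y \<omega> $ i \<le> X n \<omega> $ i" and Y_ge: "X n \<omega> $ i \<le> Y \<omega> $ i + 1 / 2 ^ n" for \<omega> i n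
  proof -
    show "Y \<omega> $ i \<le> X n \<omega> $ i"
      by (rule LIMSEQ_le_const2[OF Yi]) (use X_dec in blast)
    show "X n \<omega> $ i \<le> Y \<omega> $ i + 1 / 2 ^ n"
      by (rule LIMSEQ_le_const[OF tendsto_add[OF Yi tendsto_const]]) (use X_dec in blast)
  qed
  have Y_0: "0 \<le> Y \<omega> $ i" for \<omega> i
    by (rule LIMSEQ_le_const[OF Yi]) (use X_cube[of _ \<omega>] in \<open>auto simp: mem_cube\<close>)
  have X_meas [measurable]: "X n \<in> borel_measurable borel" for n unfolding X_def by measurable
  have Y_meas [measurable]: "Y \<in> borel_measurable borel"
    by (rule borel_measurable_LIMSEQ_metric[OF X_meas Y])
  define N where "N = restrict_space lborel {0..<T}"
  have N_sets: "A \<in> sets N \<longleftrightarrow> A \<in> sets borel \<and> A \<subseteq> {0..<T}" for A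
    unfolding N_def by (subst sets_restrict_space_iff) auto
  have N_space: "space N = {0..<T}" by (simp add: N_def space_restrict_space)
  have N_emeasure: "emeasure N A = emeasure lborel A" if "A \<subseteq> {0..<T}" for A
    unfolding N_def using that by (intro emeasure_restrict_space) auto
  have T0: "0 \<le> T" unfolding T_def using nn by (intro sum_nonneg) auto
  interpret N: finite_measure N
    by (rule finite_measureI) (use T0 in \<open>simp add: N_space N_emeasure\<close>)
  have NY [measurable]: "Y \<in> measurable N borel"
    unfolding N_def by (auto intro!: measurable_restrict_space1)
  define \<mu> where "\<mu> = distr N borel Y"
  have I_meas: "measure N (I n y) = M n y" if "y \<in> ?G n" for n y
    using N_emeasure[OF I_sub[OF that]] nn[OF that] by (simp add: measure_def I_def seg_def)
  show thesis
  proof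
    show "finite_measure \<mu>" unfolding \<mu>_def by (rule N.finite_measure_distr) simp
    show "sets \<mu> = sets borel" by (simp add: \<mu>_def)
    show "measure \<mu> UNIV = (\<Sum>y\<in>?G 0. M 0 y)"
    proof -
      have "measure \<mu> UNIV = measure N (Y -` UNIV \<inter> space N)" unfolding \<mu>_def by (rule measure_distr) auto
      also have "\<dots> = T" using T0 by (simp add: N_space measure_def N_emeasure)
      finally show ?thesis by (simp add: T_def)
    qed
    fix x :: "real^'n" assume x: "x \<in> unit_cube"
    define E where "E n = {\<omega>\<in>space N. X n \<omega> \<le> dyadic_above n x}" for n
    have E_eq: "E n = (\<Union>y\<in>{y. y \<in> ?G n \<and> y \<le> dyadic_above n x}. I n y)" for n
    proof (intro set_eqI iffI)
      fix \<omega> assume "\<omega> \<in> E n"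
      then show "\<omega> \<in> (\<Union>y\<in>{y. y \<in> ?G n \<and> y \<le> dyadic_above n x}. I n y)"
        using X_in[of \<omega> n] by (auto simp: E_def N_space)
    next
      fix \<omega> assume "\<omega> \<in> (\<Union>y\<in>{y. y \<in> ?G n \<and> y \<le> dyadic_above n x}. I n y)"
      then obtain y where "y \<in> ?G n" "y \<le> dyadic_above n x" "\<omega> \<in> I n y" by auto
      then show "\<omega> \<in> E n" using X_eq[of y n \<omega>] I_lim[of y n \<omega>] by (simp add: E_def N_space)
    qed
    have E_meas: "measure N (E n) = (\<Sum>y | y \<in> ?G n \<and> y \<le> dyadic_above n x. M n y)" for n
    proof -
      have "disjoint_family_on (I n) {y. y \<in> ?G n \<and> y \<le> dyadic_above n x}"
        unfolding disjoint_family_on_def using X_eq by (metis (no_types, lifting) disjoint_iff mem_Collect_eq)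
      then have "measure N (E n) = (\<Sum>y | y \<in> ?G n \<and> y \<le> dyadic_above n x. measure N (I n y))"
        unfolding E_eq using I_sub by (intro N.finite_measure_finite_Union) (auto simp: N_sets)
      also have "\<dots> = (\<Sum>y | y \<in> ?G n \<and> y \<le> dyadic_above n x. M n y)"
        using I_meas by (intro sum.cong) auto
      finally show ?thesis .
    qed
    have "decseq E"
    proof (rule decseq_SucI, rule subsetI)
      fix n \<omega> assume \<omega>: "\<omega> \<in> E (Suc n)"
      then have "X (Suc n) \<omega> \<le> dyadic_above n x" using dyadic_above_mono[OF x, of n] by (auto simp: E_def)
      then have "up (dyadic n) (X (Suc n) \<omega>) \<le> dyadic_above n x"
        using up_le_iff[OF grid_dyadic X_cube dyadic_above_in_gpts[OF x]] by blast
      then show "\<omega> \<in> E n" using \<omega> X_Suc[of \<omega> n] by (auto simp: E_def N_space)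
    qed
    moreover have "range E \<subseteq> sets N"
      using I_sub by (auto simp: E_eq N_sets)
    ultimately have "(\<lambda>n. measure N (E n)) \<longlonglongrightarrow> measure N (\<Inter>n. E n)"
      by (intro N.finite_Lim_measure_decseq)
    \<comment> \<open>If the limit is at most \<open>x\<close>, the value at level \<open>n\<close>
      is at most \<open>x\<close> plus one mesh width, hence below the enlarged corner; conversely
      the enlarged corners shrink to \<open>x\<close>.\<close>
    moreover have "(\<Inter>n. E n) = Y -` cbox 0 x \<inter> space N"
    proof (intro set_eqI iffI)
      fix \<omega> assume \<omega>: "\<omega> \<in> (\<Inter>n. E n)"
      have "Y \<omega> $ i \<le> x $ i" for i
      proof (rule LIMSEQ_le[OF Yi tendsto_vec_nth[OF dyadic_above_tendsto[OF x]]])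
        show "\<exists>N. \<forall>n\<ge>N. X n \<omega> $ i \<le> dyadic_above n x $ i" using \<omega> by (auto simp: E_def less_eq_vec_def)
      qed
      then show "\<omega> \<in> Y -` cbox 0 x \<inter> space N"
        using Y_0 \<omega> by (auto simp: E_def mem_box_cart)
    next
      fix \<omega> assume \<omega>: "\<omega> \<in> Y -` cbox 0 x \<inter> space N"
      have "X n \<omega> \<le> dyadic_above n x" for n
        unfolding less_eq_vec_def
      proof
        fix i
        have "Y \<omega> $ i \<le> x$i" using \<omega> by (auto simp: mem_box_cart)
        then have "X n \<omega> $ i \<le> up (dyadic n) x $ i + 1 / 2 ^ n"
          using Y_ge[of n \<omega> i] up_dyadic_ge[OF x, of i n] by linarith
        then show "X n \<omega> $ i \<le> dyadic_above n x $ i" using X_cube[of n \<omega>] by (auto simp: dyadic_above_def mem_cube)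
      qed
      then show "\<omega> \<in> (\<Inter>n. E n)" using \<omega> by (auto simp: E_def)
    qed
    ultimately show "(\<lambda>n. \<Sum>y | y \<in> ?G n \<and> y \<le> dyadic_above n x. M n y) \<longlonglongrightarrow> measure \<mu> (cbox 0 x)"
      by (simp add: \<mu>_def measure_distr E_meas)
  qed
qed

section \<open>Signed measures on the cube\<close>

lemma mem_borel_cube: "A \<in> borel_cube \<longleftrightarrow> A \<in> sets borel \<and> A \<subseteq> unit_cube"
  by (simp add: borel_cube_def)

lemma borel_cube_simps [simp]:
  "{} \<in> borel_cube" "unit_cube \<in> borel_cube"
  "A \<in> borel_cube \<Longrightarrow> B \<in> borel_cube \<Longrightarrow> A \<union> B \<in> borel_cube"
  "A \<in> borel_cube \<Longrightarrow> B \<in> borel_cube \<Longrightarrow> A - B \<in> borel_cube"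
  "A \<in> borel_cube \<Longrightarrow> B \<in> sets borel \<Longrightarrow> A \<inter> B \<in> borel_cube"
  by (auto simp: mem_borel_cube)

lemma borel_cube_Int [simp]: "A \<in> borel_cube \<Longrightarrow> B \<in> borel_cube \<Longrightarrow> A \<inter> B \<in> borel_cube"
  by (auto simp: mem_borel_cube)

lemma mem_cbox0: "z \<in> cbox 0 x \<longleftrightarrow> 0 \<le> z \<and> z \<le> x" for x z :: "real^'n"
  by (simp add: mem_box_cart less_eq_vec_def all_conj_distrib)

lemma cbox_subset_cube: "x \<in> unit_cube \<Longrightarrow> cbox 0 x \<subseteq> unit_cube"
proof
  fix z assume "x \<in> unit_cube" "z \<in> cbox 0 x"
  then have "0 \<le> z" "z \<le> 1" using le_vec_one[of x] by (auto simp only: mem_cbox0 intro: order_trans)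
  then show "z \<in> unit_cube" by (simp only: mem_cbox0)
qed

lemma cbox_borel_cube [simp]: "x \<in> unit_cube \<Longrightarrow> cbox 0 x \<in> borel_cube"
  using cbox_subset_cube by (simp add: mem_borel_cube)

lemma signed_measureD:
  assumes "signed_measure \<nu>"
  shows "\<nu> {} = 0" "\<And>A. range A \<subseteq> borel_cube \<Longrightarrow> disjoint_family A \<Longrightarrow> (\<lambda>n::nat. \<nu> (A n)) sums \<nu> (\<Union>n. A n)"
  using assms by (auto simp: signed_measure_def)

lemma signed_measure_Un:
  assumes \<nu>: "signed_measure \<nu>" and AB: "A \<in> borel_cube" "B \<in> borel_cube" "A \<inter> B = {}"
  shows "\<nu> (A \<union> B) = \<nu> A + \<nu> B"
proof -
  have "(\<lambda>n. \<nu> (binaryset A B n)) sums \<nu> (\<Union>n. binaryset A B n)"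
    using AB by (intro signed_measureD(2)[OF \<nu>]) (auto simp: binaryset_def disjoint_family_on_def)
  moreover have "(\<lambda>n. \<nu> (binaryset A B n)) sums (\<nu> A + \<nu> B)"
    by (rule binaryset_sums) (rule signed_measureD(1)[OF \<nu>])
  ultimately show ?thesis using sums_unique2 UN_binaryset_eq by metis
qed

lemma signed_measure_Diff:
  assumes "signed_measure \<nu>" "A \<in> borel_cube" "B \<in> borel_cube" "A \<subseteq> B"
  shows "\<nu> (B - A) = \<nu> B - \<nu> A"
  using signed_measure_Un[OF assms(1,2), of "B - A"] assms by (simp add: Un_absorb1)

lemma signed_measure_split:
  assumes "signed_measure \<nu>" "A \<in> borel_cube" "B \<in> borel_cube"
  shows "\<nu> A = \<nu> (A \<inter> B) + \<nu> (A - B)"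
proof -
  have "(A \<inter> B) \<union> (A - B) = A" "(A \<inter> B) \<inter> (A - B) = {}" by auto
  then show ?thesis using signed_measure_Un[OF assms(1), of "A \<inter> B" "A - B"] assms by simp
qed

lemma signed_measure_UN:
  assumes \<nu>: "signed_measure \<nu>" and "finite I" "\<And>i. i \<in> I \<Longrightarrow> A i \<in> borel_cube" "disjoint_family_on A I"
  shows "(\<Union>i\<in>I. A i) \<in> borel_cube \<and> \<nu> (\<Union>i\<in>I. A i) = (\<Sum>i\<in>I. \<nu> (A i))"
  using assms(2-)
proof (induction I rule: finite_induct)
  case (insert a I)
  then have IH: "(\<Union>i\<in>I. A i) \<in> borel_cube \<and> \<nu> (\<Union>i\<in>I. A i) = (\<Sum>i\<in>I. \<nu> (A i))"
    by (auto simp: disjoint_family_on_def)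
  have disj: "A a \<inter> (\<Union>i\<in>I. A i) = {}"
    using insert.prems(2) insert.hyps(2) by (fastforce simp: disjoint_family_on_def)
  show ?case using IH insert.prems(1)[of a] insert.hyps signed_measure_Un[OF \<nu> _ _ disj] by simp
qed (simp add: signed_measureD[OF \<nu>])

text \<open>Continuity from above without positivity: the differences of consecutive sets partition
  \<open>A 0\<close> minus the intersection, and countable additivity telescopes.\<close>

lemma signed_measure_decseq:
  assumes \<nu>: "signed_measure \<nu>" and A: "\<And>n. A n \<in> borel_cube" "decseq A"
  shows "(\<lambda>n. \<nu> (A n)) \<longlonglongrightarrow> \<nu> (\<Inter>n. A n)"
proof -
  define D where "D n = A n - A (Suc n)" for n
  have sub: "A m \<subseteq> A n" if "n \<le> m" for n m using A(2) that by (auto simp: decseq_def)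
  have I: "(\<Inter>n. A n) \<in> borel_cube"
    using A(1) by (auto simp: mem_borel_cube)
  have UD: "(\<Union>n. D n) = A 0 - (\<Inter>n. A n)"
  proof (intro set_eqI iffI)
    fix x assume "x \<in> (\<Union>n. D n)"
    then obtain n where "x \<in> A n" "x \<notin> A (Suc n)" by (auto simp: D_def)
    then show "x \<in> A 0 - (\<Inter>n. A n)" using sub[of 0 n] by auto
  next
    fix x assume x: "x \<in> A 0 - (\<Inter>n. A n)"
    show "x \<in> (\<Union>n. D n)"
    proof (rule ccontr)
      assume "x \<notin> (\<Union>n. D n)"
      then have step: "x \<in> A n \<Longrightarrow> x \<in> A (Suc n)" for n by (auto simp: D_def)
      have "x \<in> A n" for n by (induction n) (use x step in auto)
      then show False using x by auto
    qed
  qed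
  have "disjoint_family D"
    unfolding disjoint_family_on_def
  proof (intro ballI impI)
    fix m n :: nat assume "m \<noteq> n"
    then consider "Suc m \<le> n" | "Suc n \<le> m" by linarith
    then show "D m \<inter> D n = {}" using sub[of "Suc m" n] sub[of "Suc n" m] by cases (auto simp: D_def)
  qed
  moreover have "range D \<subseteq> borel_cube" using A(1) by (auto simp: D_def)
  ultimately have "(\<lambda>n. \<nu> (D n)) sums \<nu> (\<Union>n. D n)"
    by (intro signed_measureD(2)[OF \<nu>])
  moreover have "\<nu> (D n) = \<nu> (A n) - \<nu> (A (Suc n))" for n
    unfolding D_def using A sub by (intro signed_measure_Diff[OF \<nu>]) auto
  moreover have "\<nu> (\<Union>n. D n) = \<nu> (A 0) - \<nu> (\<Inter>n. A n)"
    unfolding UD using A I by (intro signed_measure_Diff[OF \<nu>]) auto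
  ultimately have "(\<lambda>n. \<Sum>k<n. \<nu> (A k) - \<nu> (A (Suc k))) \<longlonglongrightarrow> \<nu> (A 0) - \<nu> (\<Inter>n. A n)"
    by (simp add: sums_def)
  then have "(\<lambda>n. \<nu> (A 0) - \<nu> (A n)) \<longlonglongrightarrow> \<nu> (A 0) - \<nu> (\<Inter>n. A n)"
    by (simp only: sum_lessThan_telescope'[of "\<lambda>n. \<nu> (A n)"])
  from tendsto_diff[OF tendsto_const[of "\<nu> (A 0)"] this] show ?thesis by simp
qed

text \<open>If the values were unbounded, a set with subsets of arbitrarily large value could be
  split into two parts of large value, one of which inherits the unboundedness. Iterating yields
  nested sets with diverging values, against continuity from above.\<close>

lemma signed_measure_bounded:
  fixes \<nu> :: "(real^'n) set \<Rightarrow> real"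
  assumes \<nu>: "signed_measure \<nu>"
  shows "\<exists>B. \<forall>A\<in>borel_cube. \<bar>\<nu> A\<bar> \<le> B"
proof (rule ccontr)
  define bad where "bad E \<longleftrightarrow> E \<in> borel_cube \<and> (\<forall>K. \<exists>A\<in>borel_cube. A \<subseteq> E \<and> K < \<bar>\<nu> A\<bar>)" for E
  assume unb: "\<not> (\<exists>B. \<forall>A\<in>borel_cube. \<bar>\<nu> A\<bar> \<le> B)"
  have start: "bad unit_cube"
    unfolding bad_def using unb by (auto simp: not_le mem_borel_cube)
  have step: "\<exists>E'. (bad E' \<and> real n \<le> \<bar>\<nu> E'\<bar>) \<and> E' \<subseteq> E" if E: "bad E" for E n
  proof -
    have EB: "E \<in> borel_cube" using E by (simp add: bad_def)
    \<comment> \<open>Exceeding \<open>real n + \<bar>\<nu> E\<bar>\<close> makes both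
      \<open>F\<close> and \<open>E - F\<close> have modulus at least \<open>n\<close>, whichever of
      them is kept.\<close>
    obtain F where F: "F \<in> borel_cube" "F \<subseteq> E" "real n + \<bar>\<nu> E\<bar> < \<bar>\<nu> F\<bar>"
      using E unfolding bad_def by blast
    have "\<nu> (E - F) = \<nu> E - \<nu> F" using signed_measure_Diff[OF \<nu> F(1) EB F(2)] .
    then have large: "real n \<le> \<bar>\<nu> F\<bar>" "real n \<le> \<bar>\<nu> (E - F)\<bar>" using F(3) by linarith+
    have "bad F \<or> bad (E - F)"
    proof (rule ccontr)
      assume "\<not> (bad F \<or> bad (E - F))"
      then have nb: "\<not> bad F" "\<not> bad (E - F)" by auto
      have EF: "E - F \<in> borel_cube" using F(1) EB by simp
      obtain K1 where K1: "\<And>A. A \<in> borel_cube \<Longrightarrow> A \<subseteq> F \<Longrightarrow> \<bar>\<nu> A\<bar> \<le> K1"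
        using nb(1) F(1) unfolding bad_def by (meson not_less)
      obtain K2 where K2: "\<And>A. A \<in> borel_cube \<Longrightarrow> A \<subseteq> E - F \<Longrightarrow> \<bar>\<nu> A\<bar> \<le> K2"
        using nb(2) EF unfolding bad_def by (meson not_less)
      have "\<bar>\<nu> A\<bar> \<le> K1 + K2" if A: "A \<in> borel_cube" "A \<subseteq> E" for A
      proof -
        have "\<nu> A = \<nu> (A \<inter> F) + \<nu> (A - F)" using signed_measure_split[OF \<nu> A(1) F(1)] .
        moreover have "\<bar>\<nu> (A \<inter> F)\<bar> \<le> K1" using A F by (intro K1) auto
        moreover have "\<bar>\<nu> (A - F)\<bar> \<le> K2" using A F by (intro K2) auto
        ultimately show ?thesis by linarith
      qed
      then show False using E unfolding bad_def by (meson not_less)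
    qed
    then show ?thesis using large F(2) by blast
  qed
  have "\<exists>E. \<forall>n. (bad (E n) \<and> real n \<le> \<bar>\<nu> (E n)\<bar>) \<and> E (Suc n) \<subseteq> E n"
  proof (rule dependent_nat_choice)
    show "\<exists>E. bad E \<and> real 0 \<le> \<bar>\<nu> E\<bar>" using start by auto
    show "\<exists>E'. (bad E' \<and> real (Suc n) \<le> \<bar>\<nu> E'\<bar>) \<and> E' \<subseteq> E" if "bad E \<and> real n \<le> \<bar>\<nu> E\<bar>" for E n
      by (rule step) (use that in blast)
  qed
  then obtain E where E: "\<And>n. bad (E n)" "\<And>n. real n \<le> \<bar>\<nu> (E n)\<bar>" "\<And>n. E (Suc n) \<subseteq> E n" by blast
  have "(\<lambda>n. \<nu> (E n)) \<longlonglongrightarrow> \<nu> (\<Inter>n. E n)"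
    using E by (intro signed_measure_decseq[OF \<nu>] decseq_SucI) (auto simp: bad_def)
  then have "Bseq (\<lambda>n. \<nu> (E n))" by (intro convergent_imp_Bseq) (auto simp: convergent_def)
  then obtain K where K: "\<And>n. \<bar>\<nu> (E n)\<bar> \<le> K" by (auto simp: Bseq_def)
  obtain n where "K < real n" using reals_Archimedean2 by blast
  then show False using K[of n] E(2)[of n] by linarith
qed

section \<open>Cells of a grid and distribution functions\<close>

definition cell :: "('n \<Rightarrow> real set) \<Rightarrow> real^'n \<Rightarrow> (real^'n) set" where
  "cell P y = {x\<in>unit_cube. up P x = y}"

lemma cell_borel:
  assumes P: "grid P UNIV" and y: "y \<in> gpts P"
  shows "cell P y \<in> borel_cube"
proof -
  have yc: "y \<in> unit_cube" using y gpts_cube[OF P] by auto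
  \<comment> \<open>A point rounds to \<open>y\<close> when it lies in the box below
    \<open>y\<close> but in no box of a smaller grid point.\<close>
  have "cell P y = cbox 0 y - (\<Union>g\<in>{g\<in>gpts P. g \<le> y \<and> g \<noteq> y}. cbox 0 g)"
  proof (intro set_eqI iffI)
    fix x assume "x \<in> cell P y"
    then have x: "x \<in> unit_cube" "up P x = y" by (auto simp: cell_def)
    then have "x \<le> g \<longleftrightarrow> y \<le> g" if "g \<in> gpts P" for g using up_le_iff[OF P x(1) that] by simp
    then show "x \<in> cbox 0 y - (\<Union>g\<in>{g\<in>gpts P. g \<le> y \<and> g \<noteq> y}. cbox 0 g)"
      using x y by (auto simp: mem_cbox0 intro: order_antisym zero_le_vec)
  next
    fix x assume x: "x \<in> cbox 0 y - (\<Union>g\<in>{g\<in>gpts P. g \<le> y \<and> g \<noteq> y}. cbox 0 g)"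
    then have xc: "x \<in> unit_cube" using cbox_subset_cube[OF yc] by blast
    have x': "0 \<le> x" "x \<le> y" "\<And>g. g \<in> gpts P \<Longrightarrow> g \<le> y \<Longrightarrow> x \<le> g \<Longrightarrow> g = y"
      using x by (auto simp: mem_cbox0)
    have "up P x = y"
      using x'(3)[OF up_in_gpts[OF P xc]] up_le_iff[OF P xc] y x'(2) up_in_gpts[OF P xc] by blast
    then show "x \<in> cell P y" using xc by (simp add: cell_def)
  qed
  also have "\<dots> \<in> borel_cube"
  proof -
    have "(\<Union>g\<in>{g\<in>gpts P. g \<le> y \<and> g \<noteq> y}. cbox 0 g) \<in> sets borel"
      using finite_gpts[OF P] by (intro sets.finite_UN) auto
    then show ?thesis using cbox_subset_cube[OF yc] by (auto simp: mem_borel_cube)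
  qed
  finally show ?thesis .
qed

lemma disjoint_cells: "disjoint_family_on (cell P) I"
  by (auto simp: disjoint_family_on_def cell_def)

lemma UN_cells:
  assumes P: "grid P UNIV" and x: "x \<in> gpts P"
  shows "(\<Union>y\<in>{y \<in> gpts P. y \<le> x}. cell P y) = cbox 0 x"
proof (intro set_eqI iffI)
  fix z assume "z \<in> (\<Union>y\<in>{y \<in> gpts P. y \<le> x}. cell P y)"
  then have "z \<in> unit_cube" "up P z \<le> x" by (auto simp: cell_def)
  then show "z \<in> cbox 0 x" using up_le_iff[OF P _ x] by (auto simp: mem_cbox0 zero_le_vec)
next
  fix z assume z: "z \<in> cbox 0 x"
  have "x \<in> unit_cube" using x gpts_cube[OF P] by auto
  then have zc: "z \<in> unit_cube" using cbox_subset_cube z by blast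
  then have "up P z \<le> x" using up_le_iff[OF P zc x] z by (auto simp: mem_cbox0)
  then show "z \<in> (\<Union>y\<in>{y \<in> gpts P. y \<le> x}. cell P y)" using zc up_in_gpts[OF P zc] by (auto simp: cell_def)
qed

text \<open>By finite additivity the cell measures solve the equations that determine the
  masses.\<close>

lemma signed_measure_mass:
  assumes \<nu>: "signed_measure \<nu>" and f: "\<And>x. x \<in> unit_cube \<Longrightarrow> f x = \<nu> (cbox 0 x)"
    and P: "grid P UNIV" and y: "y \<in> gpts P"
  shows "mass f P y = \<nu> (cell P y)"
proof (rule mass_eqI[OF P _ y])
  fix x assume x: "x \<in> gpts P"
  have "\<nu> (\<Union>y\<in>{y \<in> gpts P. y \<le> x}. cell P y) = (\<Sum>y | y \<in> gpts P \<and> y \<le> x. \<nu> (cell P y))"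
    using signed_measure_UN[OF \<nu>, of "{y \<in> gpts P. y \<le> x}" "cell P"] cell_borel[OF P] disjoint_cells finite_gpts[OF P] by auto
  then show "(\<Sum>y | y \<in> gpts P \<and> y \<le> x. \<nu> (cell P y)) = f x"
    using UN_cells[OF P x] f x gpts_cube[OF P] by auto
qed

lemma signed_measure_sum_cells:
  assumes \<nu>: "signed_measure \<nu>" and P: "grid P UNIV"
  shows "(\<Sum>y\<in>gpts P. \<nu> (cell P y)) = \<nu> unit_cube"
proof -
  have "{y \<in> gpts P. y \<le> 1} = gpts P" using gpts_cube[OF P] le_vec_one by auto
  then show ?thesis
    using signed_measure_UN[OF \<nu> finite_gpts[OF P] cell_borel[OF P] disjoint_cells] UN_cells[OF P one_in_gpts[OF P]]
    by simp
qed

text \<open>The cells of nonnegative value and those of negative value have two Borel unions, each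
  of modulus at most \<open>B\<close>.\<close>

lemma signed_measure_total_var:
  assumes \<nu>: "signed_measure \<nu>" and f: "\<And>x. x \<in> unit_cube \<Longrightarrow> f x = \<nu> (cbox 0 x)"
    and B: "\<And>A. A \<in> borel_cube \<Longrightarrow> \<bar>\<nu> A\<bar> \<le> B" and P: "grid P UNIV"
  shows "total_var f P \<le> 2 * B"
proof -
  let ?p = "{y \<in> gpts P. 0 \<le> \<nu> (cell P y)}" and ?m = "{y \<in> gpts P. \<not> 0 \<le> \<nu> (cell P y)}"
  note fin = finite_gpts[OF P]
  have part: "\<bar>\<Sum>y\<in>I. \<nu> (cell P y)\<bar> \<le> B" if "I \<subseteq> gpts P" for I
    using signed_measure_UN[OF \<nu>, of I "cell P"] B that cell_borel[OF P] disjoint_cells finite_subset[OF that fin]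
    by (metis subset_iff)
  have "total_var f P = (\<Sum>y\<in>gpts P. \<bar>\<nu> (cell P y)\<bar>)"
    unfolding total_var_def by (intro sum.cong) (auto simp: signed_measure_mass[OF \<nu> f P])
  also have "\<dots> = (\<Sum>y\<in>?p \<union> ?m. \<bar>\<nu> (cell P y)\<bar>)" by (intro sum.cong) auto
  also have "\<dots> = (\<Sum>y\<in>?p. \<bar>\<nu> (cell P y)\<bar>) + (\<Sum>y\<in>?m. \<bar>\<nu> (cell P y)\<bar>)"
    using fin by (intro sum.union_disjoint) auto
  also have "\<dots> = (\<Sum>y\<in>?p. \<nu> (cell P y)) - (\<Sum>y\<in>?m. \<nu> (cell P y))"
    by (simp add: sum_negf[symmetric])
  also have "\<dots> \<le> 2 * B" using part[of ?p] part[of ?m] by auto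
  finally show ?thesis .
qed

text \<open>The boxes up to \<open>upd x i t\<close> shrink to the box up to \<open>x\<close> as
  \<open>t\<close> decreases to \<open>x$i\<close>, so continuity from above applies.\<close>

lemma signed_measure_right_cont:
  fixes f :: "real^'n \<Rightarrow> real"
  assumes \<nu>: "signed_measure \<nu>" and f: "\<And>x. x \<in> unit_cube \<Longrightarrow> f x = \<nu> (cbox 0 x)"
  shows "right_cont f"
  unfolding right_cont_def
proof (intro ballI allI)
  fix x :: "real^'n" and i assume x: "x \<in> unit_cube"
  then have xi: "0 \<le> x$i" "x$i \<le> 1" by (auto simp: mem_cube)
  show "((\<lambda>t. f (upd x i t)) \<longlongrightarrow> f x) (at (x$i) within {x$i..1})"
  proof (cases "x$i = 1")
    case True
    then have "at (x$i) within {x$i..1} = bot" by (simp add: at_within_def)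
    then show ?thesis by simp
  next
    case False
    then have lt: "x$i < 1" using xi by simp
    have "((\<lambda>t. f (upd x i t)) \<longlongrightarrow> f x) (at_right (x$i))"
    proof (rule tendsto_at_right_sequentially[OF lt])
      fix S :: "nat \<Rightarrow> real" assume S: "\<And>n. x$i < S n" "\<And>n. S n < 1" "decseq S" "S \<longlonglongrightarrow> x$i"
      have cube: "upd x i (S n) \<in> unit_cube" for n
        using x xi S(1,2)[of n] by (auto simp: mem_cube intro: less_imp_le order_trans)
      have mem_upd: "z \<in> cbox 0 (upd x i t) \<longleftrightarrow> z$i \<le> t \<and> (\<forall>j. 0 \<le> z$j \<and> (j \<noteq> i \<longrightarrow> z$j \<le> x$j))" for z t
        unfolding mem_box_cart by (auto split: if_splits)
      have mem_x: "z \<in> cbox 0 x \<longleftrightarrow> z$i \<le> x$i \<and> (\<forall>j. 0 \<le> z$j \<and> (j \<noteq> i \<longrightarrow> z$j \<le> x$j))" for z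
      proof -
        have "upd x i (x$i) = x" by (simp add: vec_eq_iff)
        then show ?thesis using mem_upd[of z "x$i"] by (simp only:)
      qed
      have dec: "decseq (\<lambda>n. cbox 0 (upd x i (S n)))"
        unfolding decseq_def
      proof (intro allI impI subsetI)
        fix m n z assume "m \<le> n" "z \<in> cbox 0 (upd x i (S n))"
        then show "z \<in> cbox 0 (upd x i (S m))"
          using decseqD[OF S(3) \<open>m \<le> n\<close>] unfolding mem_upd by auto
      qed
      have "(\<Inter>n. cbox 0 (upd x i (S n))) = cbox 0 x"
      proof (intro set_eqI iffI)
        fix z assume z: "z \<in> (\<Inter>n. cbox 0 (upd x i (S n)))"
        then have z: "z \<in> cbox 0 (upd x i (S n))" for n by blast
        then have "z$i \<le> x$i" using mem_upd by (intro LIMSEQ_le_const[OF S(4)]) blast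
        then show "z \<in> cbox 0 x" using z[of 0] unfolding mem_x mem_upd by blast
      next
        fix z assume "z \<in> cbox 0 x"
        then have "z \<in> cbox 0 (upd x i (S n))" for n using S(1)[of n] unfolding mem_x mem_upd by auto
        then show "z \<in> (\<Inter>n. cbox 0 (upd x i (S n)))" by blast
      qed
      then show "(\<lambda>n. f (upd x i (S n))) \<longlonglongrightarrow> f x"
        using signed_measure_decseq[OF \<nu> cbox_borel_cube[OF cube] dec] f[OF cube] f[OF x] by simp
    qed
    then show ?thesis using at_within_Icc_at_right[OF lt] by simp
  qed
qed

lemma bounded_HK_if_total_var_bounded:
  fixes f :: "real^'n \<Rightarrow> real"
  assumes "\<And>P. grid P UNIV \<Longrightarrow> total_var f P \<le> B"
  shows "bounded_HK f"
proof -
  have "Var_HK f \<le> (\<Sum>S\<in>{S :: 'n set. S \<noteq> {}}. ereal B)"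
    unfolding Var_HK_def by (rule sum_mono) (rule vitali_1_le[OF assms])
  also have "\<dots> < \<infinity>" by simp
  finally show ?thesis by (simp add: bounded_HK_def)
qed

section \<open>Uniqueness and Jordan decomposition of signed measures\<close>

lemma signed_measure_unique:
  fixes \<nu> \<nu>' :: "(real^'n) set \<Rightarrow> real"
  assumes \<nu>: "signed_measure \<nu>" "signed_measure \<nu>'"
    and eq: "\<And>x. x \<in> unit_cube \<Longrightarrow> \<nu> (cbox 0 x) = \<nu>' (cbox 0 x)" and A: "A \<in> borel_cube"
  shows "\<nu> A = \<nu>' A"
proof -
  let ?C = "unit_cube :: (real^'n) set" and ?G = "range (\<lambda>a. {..a}) :: (real^'n) set set"
  have cl: "sigma_sets UNIV ?G = sets (borel :: (real^'n) measure)"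
    by (simp add: borel_eq_atMost)
  have bc: "B \<inter> ?C \<in> borel_cube" if "B \<in> sigma_sets UNIV ?G" for B
    using that unfolding cl by (auto simp: mem_borel_cube)
  have "Int_stable ?G"
  proof (rule Int_stableI_image)
    show "\<exists>c\<in>UNIV. {..a} \<inter> {..b} = {..c}" for a b :: "real^'n"
      by (rule bexI[of _ "inf a b"]) auto
  qed
  moreover have "?G \<subseteq> Pow UNIV" by simp
  moreover have "A \<in> sigma_sets UNIV ?G" using A unfolding cl by (simp add: mem_borel_cube)
  ultimately have "\<nu> (A \<inter> ?C) = \<nu>' (A \<inter> ?C)"
  proof (induction rule: sigma_sets_induct_disjoint)
    case (basic B)
    then obtain a where a: "B = {..a}" by auto
    show ?case
    \<comment> \<open>The generators are lower orthants of the whole space; inside the cube such a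
      set is a box from 0 to \<open>a\<close> capped at 1, or empty if some coordinate of
      \<open>a\<close> is negative.\<close>
    proof (cases "\<forall>i. 0 \<le> a$i")
      case True
      define b where "b = (\<chi> i. min (a$i) 1)"
      have "b \<in> ?C" using True by (auto simp: mem_cube b_def)
      moreover have "B \<inter> ?C = cbox 0 b"
        by (auto simp: a mem_box_cart b_def less_eq_vec_def)
      ultimately show ?thesis using eq by simp
    next
      case False
      then have "B \<inter> ?C = {}" by (auto simp: a mem_cube less_eq_vec_def) (meson order_trans)
      then show ?thesis using \<nu> by (simp add: signed_measureD)
    qed
  next
    case empty
    then show ?case using \<nu> by (simp add: signed_measureD)
  next
    case (compl B)
    have "(UNIV - B) \<inter> ?C = ?C - B \<inter> ?C" by auto
    moreover have "\<nu> ?C = \<nu>' ?C" by (rule eq) (simp add: mem_cube)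
    ultimately show ?case
      using signed_measure_Diff[OF \<nu>(1) bc[OF compl(1)], of ?C] signed_measure_Diff[OF \<nu>(2) bc[OF compl(1)], of ?C] compl(2) by simp
  next
    case (union B)
    have dis: "disjoint_family (\<lambda>n. B n \<inter> ?C)" using union(1) by (auto simp: disjoint_family_on_def)
    have rng: "range (\<lambda>n. B n \<inter> ?C) \<subseteq> borel_cube" using bc union(2) by auto
    have Un: "(\<Union>n. B n) \<inter> ?C = (\<Union>n. B n \<inter> ?C)" by auto
    have "(\<lambda>n. \<nu> (B n \<inter> ?C)) sums \<nu> ((\<Union>n. B n) \<inter> ?C)"
      "(\<lambda>n. \<nu>' (B n \<inter> ?C)) sums \<nu>' ((\<Union>n. B n) \<inter> ?C)"
      unfolding Un by (rule signed_measureD(2)[OF _ rng dis] \<nu>)+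
    then show ?case unfolding union(3) by (rule sums_unique2)
  qed
  moreover have "A \<inter> ?C = A" using A by (auto simp: mem_borel_cube)
  ultimately show ?thesis by simp
qed

lemma signed_measure_of_measure:
  fixes \<mu> :: "(real^'n) measure"
  assumes "finite_measure \<mu>" "sets \<mu> = sets borel"
  shows "signed_measure (measure \<mu>)"
proof -
  interpret finite_measure \<mu> by fact
  show ?thesis
    unfolding signed_measure_def
    using assms(2) by (auto simp: mem_borel_cube subset_eq intro!: finite_measure_UNION)
qed

lemma signed_measure_diff: "signed_measure p \<Longrightarrow> signed_measure m \<Longrightarrow> signed_measure (\<lambda>A. p A - m A)"
  unfolding signed_measure_def by (auto intro: sums_diff)

lemma signed_measure_uminus: "signed_measure p \<Longrightarrow> signed_measure (\<lambda>A. - p A)"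
  unfolding signed_measure_def by (auto intro: sums_minus)

lemma signed_measure_restrict:
  assumes \<nu>: "signed_measure \<nu>" and Y: "Y \<in> sets borel"
  shows "signed_measure (\<lambda>A. \<nu> (A \<inter> Y))"
  unfolding signed_measure_def
proof (intro conjI allI impI)
  fix A :: "nat \<Rightarrow> (real^'a) set" assume A: "range A \<subseteq> borel_cube \<and> disjoint_family A"
  then have "(\<lambda>n. \<nu> (A n \<inter> Y)) sums \<nu> (\<Union>n. A n \<inter> Y)"
    using Y by (intro signed_measureD(2)[OF \<nu>]) (auto simp: disjoint_family_on_def)
  then show "(\<lambda>n. \<nu> (A n \<inter> Y)) sums \<nu> ((\<Union>n. A n) \<inter> Y)" by simp
qed (simp add: signed_measureD[OF \<nu>])

text \<open>On a Hahn set \<open>Y\<close> for the two measures their difference is nonnegative, and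
  off it nonpositive; its restrictions to \<open>Y\<close> and to the complement give the mutually
  singular parts.\<close>

lemma jordan_meas_exists:
  fixes \<mu>1 \<mu>2 :: "(real^'n) measure"
  assumes fin: "finite_measure \<mu>1" "finite_measure \<mu>2" and sets: "sets \<mu>1 = sets borel" "sets \<mu>2 = sets borel"
  shows "\<exists>p m. jordan_meas (\<lambda>A. measure \<mu>1 A - measure \<mu>2 A) p m"
proof -
  interpret m1: finite_measure \<mu>1 by fact
  interpret m2: finite_measure \<mu>2 by fact
  define \<nu> where "\<nu> A = measure \<mu>1 A - measure \<mu>2 A" for A
  have \<nu>: "signed_measure \<nu>"
    unfolding \<nu>_def using fin sets by (intro signed_measure_diff signed_measure_of_measure)
  obtain Y where Y: "Y \<in> sets borel"
    "\<And>X. X \<in> sets borel \<Longrightarrow> X \<subseteq> Y \<Longrightarrow> emeasure \<mu>2 X \<le> emeasure \<mu>1 X"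
    "\<And>X. X \<in> sets borel \<Longrightarrow> X \<inter> Y = {} \<Longrightarrow> emeasure \<mu>1 X \<le> emeasure \<mu>2 X"
    using finite_unsigned_Hahn_decomposition[OF fin] sets by auto
  have pos: "0 \<le> \<nu> X" if "X \<in> sets borel" "X \<subseteq> Y" for X
    using Y(2)[OF that] by (simp add: \<nu>_def m1.emeasure_eq_measure m2.emeasure_eq_measure)
  have neg: "\<nu> X \<le> 0" if "X \<in> sets borel" "X \<inter> Y = {}" for X
    using Y(3)[OF that] by (simp add: \<nu>_def m1.emeasure_eq_measure m2.emeasure_eq_measure)
  have "jordan_meas \<nu> (\<lambda>A. \<nu> (A \<inter> Y)) (\<lambda>A. - \<nu> (A \<inter> - Y))"
    unfolding jordan_meas_def
  proof (intro conjI ballI)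
    show "signed_measure (\<lambda>A. \<nu> (A \<inter> Y))" by (rule signed_measure_restrict[OF \<nu> Y(1)])
    show "signed_measure (\<lambda>A. - \<nu> (A \<inter> - Y))" using Y(1) by (intro signed_measure_uminus signed_measure_restrict[OF \<nu>]) auto
    fix A :: "(real^'n) set" assume A: "A \<in> borel_cube"
    show "0 \<le> \<nu> (A \<inter> Y)" "0 \<le> - \<nu> (A \<inter> - Y)"
      using pos[of "A \<inter> Y"] neg[of "A \<inter> - Y"] A Y(1) by (auto simp: mem_borel_cube)
    have "\<nu> ((A \<inter> Y) \<union> (A \<inter> - Y)) = \<nu> (A \<inter> Y) + \<nu> (A \<inter> - Y)"
      using A Y(1) by (intro signed_measure_Un[OF \<nu>]) auto
    moreover have "(A \<inter> Y) \<union> (A \<inter> - Y) = A" by auto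
    ultimately show "\<nu> A = \<nu> (A \<inter> Y) - - \<nu> (A \<inter> - Y)" by simp
  next
    have "(unit_cube - (unit_cube \<inter> Y)) \<inter> Y = {}" "(unit_cube \<inter> Y) \<inter> - Y = {}" by auto
    then show "\<exists>P\<in>borel_cube. \<nu> ((unit_cube - P) \<inter> Y) = 0 \<and> - \<nu> (P \<inter> - Y) = 0"
      using Y(1) signed_measureD(1)[OF \<nu>] by (intro bexI[of _ "unit_cube \<inter> Y"]) auto
  qed
  then show ?thesis unfolding \<nu>_def by blast
qed

lemma signed_measure_mono:
  assumes "signed_measure p" "\<And>A. A \<in> borel_cube \<Longrightarrow> 0 \<le> p A" "A \<in> borel_cube" "B \<in> borel_cube" "A \<subseteq> B"
  shows "p A \<le> p B"
  using signed_measure_Diff[OF assms(1,3,4,5)] assms(2)[of "B - A"] assms(3,4) by simp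

text \<open>The positive part is concentrated on \<open>P\<close>, where it equals
  \<open>\<nu>\<close> and so cannot exceed any competing positive part; the negative part is
  treated likewise on the complement.\<close>

lemma jordan_meas_minimal:
  assumes J: "jordan_meas \<nu> p m" and s: "signed_measure p'" "signed_measure m'"
    and nn: "\<And>A. A \<in> borel_cube \<Longrightarrow> 0 \<le> p' A \<and> 0 \<le> m' A \<and> \<nu> A = p' A - m' A"
  shows "p unit_cube \<le> p' unit_cube" "m unit_cube \<le> m' unit_cube"
proof -
  obtain P where P: "P \<in> borel_cube" "p (unit_cube - P) = 0" "m P = 0"
    and pm: "signed_measure p" "signed_measure m" "\<And>A. A \<in> borel_cube \<Longrightarrow> \<nu> A = p A - m A"
    using J unfolding jordan_meas_def by blast
  have sub: "P \<subseteq> unit_cube" using P by (simp add: mem_borel_cube)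
  have "p unit_cube = \<nu> P" using signed_measure_Diff[OF pm(1) P(1) _ sub] P pm(3)[of P] by simp
  also have "\<dots> \<le> p' P" using nn[OF P(1)] by simp
  also have "\<dots> \<le> p' unit_cube" using nn P sub by (intro signed_measure_mono[OF s(1)]) auto
  finally show "p unit_cube \<le> p' unit_cube" .
  have "m unit_cube = - \<nu> (unit_cube - P)"
    using signed_measure_Diff[OF pm(2) P(1) _ sub] P pm(3)[of "unit_cube - P"] by simp
  also have "\<dots> \<le> m' (unit_cube - P)" using nn[of "unit_cube - P"] P by simp
  also have "\<dots> \<le> m' unit_cube" using nn P by (intro signed_measure_mono[OF s(2)]) auto
  finally show "m unit_cube \<le> m' unit_cube" .
qed

text \<open>Two Jordan decompositions are minimal against each other, so their totals coincide, as
  the definite description requires.\<close>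

lemma Var_tot_eq:
  assumes J: "jordan_meas \<nu> p m"
  shows "Var_tot \<nu> = p unit_cube + m unit_cube"
  unfolding Var_tot_def
proof (rule the_equality)
  show "\<exists>p' m'. jordan_meas \<nu> p' m' \<and> p unit_cube + m unit_cube = p' unit_cube + m' unit_cube"
    using J by blast
  fix v assume "\<exists>p' m'. jordan_meas \<nu> p' m' \<and> v = p' unit_cube + m' unit_cube"
  then obtain p' m' where J': "jordan_meas \<nu> p' m'" "v = p' unit_cube + m' unit_cube" by blast
  have s: "signed_measure p" "signed_measure m" "signed_measure p'" "signed_measure m'"
    and nn: "\<And>A. A \<in> borel_cube \<Longrightarrow> 0 \<le> p A \<and> 0 \<le> m A \<and> \<nu> A = p A - m A"
      "\<And>A. A \<in> borel_cube \<Longrightarrow> 0 \<le> p' A \<and> 0 \<le> m' A \<and> \<nu> A = p' A - m' A"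
    using J J'(1) unfolding jordan_meas_def by simp_all
  have "p unit_cube = p' unit_cube" "m unit_cube = m' unit_cube"
    using jordan_meas_minimal[OF J s(3,4) nn(2)] jordan_meas_minimal[OF J'(1) s(1,2) nn(1)]
    by (simp_all add: order_antisym)
  then show "v = p unit_cube + m unit_cube" using J'(2) by simp
qed

section \<open>Representation by a measure\<close>

lemma up_self: "grid P UNIV \<Longrightarrow> g \<in> gpts P \<Longrightarrow> up P g = g"
  using gpts_cube by (intro up_eqI) auto

text \<open>Absolute masses of the descendants of \<open>y\<close> increase with depth and stay
  below \<open>B\<close>. The limit is additive because the descendants of \<open>y\<close> one
  level deeper are those of its children; the shift in depth disappears only in the limit.\<close>

lemma dyadic_limit_mass:
  fixes f :: "real^'n \<Rightarrow> real"
  assumes B: "\<And>P. grid P UNIV \<Longrightarrow> total_var f P \<le> B"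
  obtains A where
    "\<And>n y. y \<in> gpts (dyadic n) \<Longrightarrow> \<bar>mass f (dyadic n) y\<bar> \<le> A n y"
    "\<And>n y. y \<in> gpts (dyadic n) \<Longrightarrow> A n y = (\<Sum>z | z \<in> gpts (dyadic (Suc n)) \<and> up (dyadic n) z = y. A (Suc n) z)"
    "(\<Sum>y\<in>gpts (dyadic 0). A 0 y) \<le> B"
proof -
  define a where "a n y N = (\<Sum>z | z \<in> gpts (dyadic (n + N)) \<and> up (dyadic n) z = y. \<bar>mass f (dyadic (n + N)) z\<bar>)" for n N y
  have a_bound: "a n y N \<le> B" for n y N
  proof -
    have "a n y N \<le> total_var f (dyadic (n + N))"
      unfolding a_def total_var_def by (intro sum_mono2) auto
    then show ?thesis using B[OF grid_dyadic, of "n + N"] by linarith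
  qed
  have a_mono: "incseq (a n y)" for n y
  proof (rule incseq_SucI)
    fix N
    show "a n y N \<le> a n y (Suc N)"
      unfolding a_def
      by (rule mass_abs_mono[OF grid_dyadic grid_dyadic dyadic_mono, of "n + N" "n + Suc N" "\<lambda>z. up (dyadic n) z = y"])
        (use up_dyadic_up[of n "n + N"] dyadic_cube in auto)
  qed
  have "\<exists>l. a n y \<longlonglongrightarrow> l \<and> (\<forall>N. a n y N \<le> l)" for n y
  proof -
    obtain l where "a n y \<longlonglongrightarrow> l" "\<forall>N. a n y N \<le> l"
      by (rule incseq_convergent[OF a_mono]) (use a_bound in blast)
    then show ?thesis by (intro exI conjI)
  qed
  then obtain A where A: "\<And>n y. a n y \<longlonglongrightarrow> A n y" "\<And>n y N. a n y N \<le> A n y" by metis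
  show thesis
  proof
    fix n and y :: "real^'n" assume y: "y \<in> gpts (dyadic n)"
    have "\<bar>mass f (dyadic n) y\<bar> \<le> a n y 0"
      unfolding a_def add_0_right using y up_self[OF grid_dyadic y]
      by (intro member_le_sum[of y _ "\<lambda>z. \<bar>mass f (dyadic n) z\<bar>"]) auto
    then show "\<bar>mass f (dyadic n) y\<bar> \<le> A n y" using A(2)[of n y 0] by linarith
    let ?T = "{z. z \<in> gpts (dyadic (Suc n)) \<and> up (dyadic n) z = y}"
    have split: "a n y (Suc N) = (\<Sum>z\<in>?T. a (Suc n) z N)" for N
    proof -
      let ?G = "gpts (dyadic (n + Suc N)) :: (real^'n) set" and ?m = "\<lambda>w. \<bar>mass f (dyadic (n + Suc N)) w\<bar>"
      have uu: "up (dyadic n) (up (dyadic (Suc n)) w) = up (dyadic n) w" if "w \<in> ?G" for w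
        using that dyadic_cube by (intro up_dyadic_up) auto
      have "(\<Sum>z\<in>?T. a (Suc n) z N) = (\<Sum>z\<in>?T. \<Sum>w | w \<in> {w \<in> ?G. up (dyadic n) w = y} \<and> up (dyadic (Suc n)) w = z. ?m w)"
        unfolding a_def using uu by (intro sum.cong) auto
      also have "\<dots> = (\<Sum>w | w \<in> ?G \<and> up (dyadic n) w = y. ?m w)"
      proof (rule sum.group)
        show "up (dyadic (Suc n)) ` {w \<in> ?G. up (dyadic n) w = y} \<subseteq> ?T"
        proof (rule image_subsetI)
          fix w assume w: "w \<in> {w \<in> ?G. up (dyadic n) w = y}"
          then have "up (dyadic (Suc n)) w \<in> gpts (dyadic (Suc n))" by (intro up_dyadic dyadic_cube) auto
          then show "up (dyadic (Suc n)) w \<in> ?T" using uu[of w] w by simp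
        qed
      qed auto
      finally show ?thesis by (simp add: a_def)
    qed
    have "(\<lambda>N. a n y (Suc N)) \<longlonglongrightarrow> (\<Sum>z\<in>?T. A (Suc n) z)"
      unfolding split by (intro tendsto_sum A)
    then show "A n y = (\<Sum>z\<in>?T. A (Suc n) z)"
      using LIMSEQ_Suc[OF A(1)] LIMSEQ_unique by blast
  next
    have "(\<lambda>N. \<Sum>y\<in>gpts (dyadic 0). a 0 y N) \<longlonglongrightarrow> (\<Sum>y\<in>gpts (dyadic 0). A 0 y)"
      by (intro tendsto_sum A)
    moreover have "(\<Sum>y\<in>gpts (dyadic 0). a 0 y N) \<le> B" for N
    proof -
      have "(\<Sum>y\<in>gpts (dyadic 0). a 0 y N) = total_var f (dyadic N)"
      proof -
        have "up (dyadic 0) ` gpts (dyadic N) \<subseteq> (gpts (dyadic 0) :: (real^'n) set)"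
          by (rule image_subsetI) (intro up_dyadic dyadic_cube)
        then show ?thesis unfolding a_def total_var_def add_0 by (intro sum.group) auto
      qed
      then show ?thesis using B[OF grid_dyadic] by simp
    qed
    ultimately show "(\<Sum>y\<in>gpts (dyadic 0). A 0 y) \<le> B" by (intro LIMSEQ_le_const2) auto
  qed
qed

lemma right_cont_measures:
  fixes f :: "real^'n \<Rightarrow> real"
  assumes rc: "right_cont f" and B: "\<And>P. grid P UNIV \<Longrightarrow> total_var f P \<le> B"
  obtains \<mu>1 \<mu>2 :: "(real^'n) measure" where
    "finite_measure \<mu>1" "finite_measure \<mu>2" "sets \<mu>1 = sets borel" "sets \<mu>2 = sets borel"
    "\<And>x. x \<in> unit_cube \<Longrightarrow> f x = measure \<mu>1 (cbox 0 x) - measure \<mu>2 (cbox 0 x)"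
    "measure \<mu>1 UNIV + measure \<mu>2 UNIV \<le> B"
proof -
  obtain A where A: "\<And>n y. y \<in> gpts (dyadic n) \<Longrightarrow> \<bar>mass f (dyadic n) y\<bar> \<le> A n y"
    "\<And>n y. y \<in> gpts (dyadic n) \<Longrightarrow> A n y = (\<Sum>z | z \<in> gpts (dyadic (Suc n)) \<and> up (dyadic n) z = y. A (Suc n) z)"
    "(\<Sum>y\<in>gpts (dyadic 0). A 0 y) \<le> B"
    using dyadic_limit_mass[OF B] by blast
  define p where "p n y = (A n y + mass f (dyadic n) y) / 2" for n y
  define m where "m n y = (A n y - mass f (dyadic n) y) / 2" for n y
  note mr = mass_refine[OF grid_dyadic grid_dyadic dyadic_Suc]
  have nn: "0 \<le> p n y" "0 \<le> m n y" if "y \<in> gpts (dyadic n)" for n y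
    using A(1)[OF that] by (auto simp: p_def m_def)
  have cons: "p n y = (\<Sum>z | z \<in> gpts (dyadic (Suc n)) \<and> up (dyadic n) z = y. p (Suc n) z)"
    "m n y = (\<Sum>z | z \<in> gpts (dyadic (Suc n)) \<and> up (dyadic n) z = y. m (Suc n) z)" if "y \<in> gpts (dyadic n)" for n y
    using A(2)[OF that] mr[OF that, of f]
    by (simp_all add: p_def m_def sum.distrib sum_subtractf flip: sum_divide_distrib)
  obtain \<mu>1 :: "(real^'n) measure" where \<mu>1: "finite_measure \<mu>1" "sets \<mu>1 = sets borel"
    "measure \<mu>1 UNIV = (\<Sum>y\<in>gpts (dyadic 0). p 0 y)"
    "\<And>x. x \<in> unit_cube \<Longrightarrow> (\<lambda>n. \<Sum>y | y \<in> gpts (dyadic n) \<and> y \<le> dyadic_above n x. p n y) \<longlonglongrightarrow> measure \<mu>1 (cbox 0 x)"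
    using tree_measure[of p, OF nn(1) cons(1)] by blast
  obtain \<mu>2 :: "(real^'n) measure" where \<mu>2: "finite_measure \<mu>2" "sets \<mu>2 = sets borel"
    "measure \<mu>2 UNIV = (\<Sum>y\<in>gpts (dyadic 0). m 0 y)"
    "\<And>x. x \<in> unit_cube \<Longrightarrow> (\<lambda>n. \<Sum>y | y \<in> gpts (dyadic n) \<and> y \<le> dyadic_above n x. m n y) \<longlonglongrightarrow> measure \<mu>2 (cbox 0 x)"
    using tree_measure[of m, OF nn(2) cons(2)] by blast
  show thesis
  proof
    fix x :: "real^'n" assume x: "x \<in> unit_cube"
    \<comment> \<open>Below the enlarged corner the two families differ by the value of
      \<open>f\<close> at that corner. The corner tends to \<open>x\<close> in all coordinates
      together, which is where joint right-continuity enters.\<close>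
    have "(\<Sum>y | y \<in> gpts (dyadic n) \<and> y \<le> dyadic_above n x. p n y) - (\<Sum>y | y \<in> gpts (dyadic n) \<and> y \<le> dyadic_above n x. m n y) = f (dyadic_above n x)" for n
    proof -
      have "p n y - m n y = mass f (dyadic n) y" for y by (simp add: p_def m_def field_simps)
      then show ?thesis
        by (simp add: sum_subtractf[symmetric] sum_mass[OF grid_dyadic dyadic_above_in_gpts[OF x]])
    qed
    then have "(\<lambda>n. f (dyadic_above n x)) \<longlonglongrightarrow> measure \<mu>1 (cbox 0 x) - measure \<mu>2 (cbox 0 x)"
      using tendsto_diff[OF \<mu>1(4)[OF x] \<mu>2(4)[OF x]] by simp
    moreover have "(\<lambda>n. f (dyadic_above n x)) \<longlonglongrightarrow> f x"
      by (rule right_cont_joint[OF rc B x dyadic_cube[OF dyadic_above_in_gpts[OF x]] dyadic_above_ge[OF x] dyadic_above_tendsto[OF x]])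
    ultimately show "f x = measure \<mu>1 (cbox 0 x) - measure \<mu>2 (cbox 0 x)" using LIMSEQ_unique by blast
  next
    have "measure \<mu>1 UNIV + measure \<mu>2 UNIV = (\<Sum>y\<in>gpts (dyadic 0). A 0 y)"
      unfolding \<mu>1(3) \<mu>2(3) sum.distrib[symmetric] by (simp add: p_def m_def field_simps)
    then show "measure \<mu>1 UNIV + measure \<mu>2 UNIV \<le> B" using A(3) by simp
  qed (use \<mu>1 \<mu>2 in auto)
qed

lemma jordan_measD:
  assumes "jordan_meas \<nu> p m"
  shows "signed_measure p" "signed_measure m"
    "\<And>A. A \<in> borel_cube \<Longrightarrow> 0 \<le> p A" "\<And>A. A \<in> borel_cube \<Longrightarrow> 0 \<le> m A"
    "\<And>A. A \<in> borel_cube \<Longrightarrow> \<nu> A = p A - m A"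
  using assms unfolding jordan_meas_def by auto

text \<open>On each cell the mass is a difference of two nonnegative values, so its modulus is at
  most their sum, and the cells partition the cube.\<close>

lemma total_var_le_jordan:
  assumes J: "jordan_meas \<nu> p m" and \<nu>: "signed_measure \<nu>"
    and f: "\<And>x. x \<in> unit_cube \<Longrightarrow> f x = \<nu> (cbox 0 x)" and P: "grid P UNIV"
  shows "total_var f P \<le> p unit_cube + m unit_cube"
proof -
  note JD = jordan_measD[OF J]
  have "total_var f P \<le> (\<Sum>y\<in>gpts P. p (cell P y) + m (cell P y))"
    unfolding total_var_def
  proof (rule sum_mono)
    fix y assume y: "y \<in> gpts P"
    note c = cell_borel[OF P y]
    show "\<bar>mass f P y\<bar> \<le> p (cell P y) + m (cell P y)"
      using JD(3,4,5)[OF c] signed_measure_mass[OF \<nu> f P y] by simp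
  qed
  also have "\<dots> = p unit_cube + m unit_cube"
    using signed_measure_sum_cells[OF JD(1) P] signed_measure_sum_cells[OF JD(2) P] by (simp add: sum.distrib)
  finally show ?thesis .
qed

lemma grid_trivial: "grid (\<lambda>i. {0,1}) UNIV"
  by (simp add: grid_def)

lemma Var_HK0_nonneg: "0 \<le> Var_HK0 f"
proof -
  have "0 \<le> ereal (grid_var f (\<lambda>i. {0,1}))" by (simp add: grid_var_def sum_nonneg)
  also have "\<dots> \<le> Var_HK0 f"
    unfolding Var_HK0_eq_SUP by (rule SUP_upper) (simp add: grid_trivial)
  finally show ?thesis .
qed

lemma right_cont_bounded_HK_signed_measure:
  fixes f :: "real^'n \<Rightarrow> real"
  assumes rc: "right_cont f" and bv: "bounded_HK f"
  obtains \<nu> p m where "signed_measure \<nu>" "\<And>x. x \<in> unit_cube \<Longrightarrow> f x = \<nu> (cbox 0 x)"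
    "jordan_meas \<nu> p m" "ereal (Var_tot \<nu>) = Var_HK0 f + ereal \<bar>f 0\<bar>"
proof -
  obtain b where "\<forall>P. grid P UNIV \<longrightarrow> grid_var f P \<le> b" using bounded_HK_grid_var[OF bv] by blast
  then have "Var_HK0 f \<le> ereal b" by (simp add: Var_HK0_le_iff)
  then obtain w where w: "Var_HK0 f = ereal w" using Var_HK0_nonneg[of f] by (cases "Var_HK0 f") auto
  have tv: "total_var f P \<le> w + \<bar>f 0\<bar>" if "grid P UNIV" for P
    using Var_HK0_le_iff[of f w] that by (simp add: total_var_eq w)
  obtain \<mu>1 \<mu>2 :: "(real^'n) measure" where
    fin: "finite_measure \<mu>1" "finite_measure \<mu>2" and sets: "sets \<mu>1 = sets borel" "sets \<mu>2 = sets borel"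
    and f: "\<And>x. x \<in> unit_cube \<Longrightarrow> f x = measure \<mu>1 (cbox 0 x) - measure \<mu>2 (cbox 0 x)"
    and le: "measure \<mu>1 UNIV + measure \<mu>2 UNIV \<le> w + \<bar>f 0\<bar>"
    using right_cont_measures[OF rc tv] by blast
  define \<nu> where "\<nu> A = measure \<mu>1 A - measure \<mu>2 A" for A
  have s: "signed_measure (measure \<mu>1)" "signed_measure (measure \<mu>2)"
    using fin sets by (auto intro: signed_measure_of_measure)
  have \<nu>: "signed_measure \<nu>" unfolding \<nu>_def by (rule signed_measure_diff[OF s])
  obtain p m where J: "jordan_meas \<nu> p m"
    unfolding \<nu>_def using jordan_meas_exists[OF fin sets] by blast
  have f\<nu>: "f x = \<nu> (cbox 0 x)" if "x \<in> unit_cube" for x using f[OF that] by (simp add: \<nu>_def)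
  \<comment> \<open>The constructed pair need not be mutually singular; minimality transfers its
    bound to the Jordan parts.\<close>
  have "p unit_cube \<le> measure \<mu>1 unit_cube" "m unit_cube \<le> measure \<mu>2 unit_cube"
    by (rule jordan_meas_minimal[OF J s]; simp add: \<nu>_def)+
  moreover have "measure \<mu>1 unit_cube \<le> measure \<mu>1 UNIV" "measure \<mu>2 unit_cube \<le> measure \<mu>2 UNIV"
    by (rule finite_measure.finite_measure_mono[OF fin(1)], simp, simp add: sets)
      (rule finite_measure.finite_measure_mono[OF fin(2)], simp, simp add: sets)
  ultimately have upper: "p unit_cube + m unit_cube \<le> w + \<bar>f 0\<bar>" using le by linarith
  have "Var_HK0 f \<le> ereal (p unit_cube + m unit_cube - \<bar>f 0\<bar>)"
    unfolding Var_HK0_le_iff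
  proof (intro allI impI)
    fix P :: "'n \<Rightarrow> real set" assume "grid P UNIV"
    from total_var_le_jordan[OF J \<nu> f\<nu> this] total_var_eq[OF this, of f]
    show "grid_var f P \<le> p unit_cube + m unit_cube - \<bar>f 0\<bar>" by simp
  qed
  then have "Var_tot \<nu> = w + \<bar>f 0\<bar>" using upper by (simp add: w Var_tot_eq[OF J])
  then show thesis using that[OF \<nu> f\<nu> J] by (simp add: w)
qed

section \<open>Jordan decompositions\<close>

text \<open>Away from the origin a mass is a quasi-volume of positive dimension; at the origin it is
  \<open>g 0\<close>, whose sign is free.\<close>

lemma compl_mono_mass_nonneg:
  assumes g: "compl_mono g" and P: "grid P UNIV" and y: "y \<in> gpts P" "y \<noteq> 0"
  shows "0 \<le> mass g P y"
proof -
  obtain a where a: "a \<in> gpts P" "mass g P y = qvol g (supp y) a y y"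
    "\<And>i. i \<in> supp y \<Longrightarrow> a$i < y$i" "\<And>i. i \<notin> supp y \<Longrightarrow> a$i = y$i"
    using mass_eq_qvol[OF P y(1), of g] by metis
  have "a \<in> unit_cube" "y \<in> unit_cube" using a(1) y(1) gpts_cube[OF P] by auto
  moreover have "supp y \<noteq> {}" using y(2) by (simp add: supp_eq_empty_iff)
  ultimately show ?thesis
    using g a(3,4) unfolding compl_mono_def a(2) by (auto simp: less_imp_le)
qed

lemma sum_mass_nonzero:
  assumes P: "grid P UNIV" and x: "x \<in> gpts P"
  shows "(\<Sum>y | y \<in> gpts P \<and> y \<le> x \<and> y \<noteq> 0. mass g P y) = g x - g 0"
proof -
  have "0 \<le> x" using x gpts_cube[OF P] zero_le_vec by auto
  then have "{y \<in> gpts P. y \<le> x} = insert 0 {y. y \<in> gpts P \<and> y \<le> x \<and> y \<noteq> 0}"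
    using zero_in_gpts[OF P] by auto
  then have "g x = (\<Sum>y\<in>insert 0 {y. y \<in> gpts P \<and> y \<le> x \<and> y \<noteq> 0}. mass g P y)"
    using sum_mass[OF P x, of g] by simp
  also have "\<dots> = mass g P 0 + (\<Sum>y | y \<in> gpts P \<and> y \<le> x \<and> y \<noteq> 0. mass g P y)"
    using finite_gpts[OF P] by (subst sum.insert) auto
  finally show ?thesis by (simp add: mass_zero[OF P])
qed

lemma nonzero_le_one: "grid P UNIV \<Longrightarrow> {y. y \<in> gpts P \<and> y \<le> 1 \<and> y \<noteq> 0} = {y. y \<in> gpts P \<and> y \<noteq> 0}"
  using gpts_cube le_vec_one by blast

text \<open>With nonnegative masses nothing cancels, so every grid already yields the total
  increment.\<close>

lemma Var_HK0_compl_mono: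
  fixes g :: "real^'n \<Rightarrow> real"
  assumes g: "compl_mono g" shows "Var_HK0 g = ereal (g 1 - g 0)"
proof -
  have "grid_var g P = g 1 - g 0" if P: "grid P UNIV" for P
  proof -
    have "grid_var g P = (\<Sum>y | y \<in> gpts P \<and> y \<noteq> 0. mass g P y)"
      unfolding grid_var_def by (intro sum.cong) (auto simp: compl_mono_mass_nonneg[OF g P])
    then show ?thesis using sum_mass_nonzero[OF P one_in_gpts[OF P], of g] by (simp add: nonzero_le_one[OF P])
  qed
  then have "Var_HK0 g = (SUP P\<in>{P. grid P (UNIV :: 'n set)}. ereal (g 1 - g 0))"
    unfolding Var_HK0_eq_SUP by (intro SUP_cong) auto
  moreover have "{P. grid P (UNIV :: 'n set)} \<noteq> {}" using grid_trivial by blast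
  ultimately show ?thesis by simp
qed

text \<open>The constant \<open>f 0\<close> contributes only an atom at the origin, the
  \<open>of_bool\<close> term; elsewhere masses are linear in the function.\<close>

lemma jordan_fun_mass:
  assumes J: "jordan_fun f fp fm" and P: "grid P UNIV" and y: "y \<in> gpts P" "y \<noteq> 0"
  shows "mass f P y = mass fp P y - mass fm P y"
proof -
  have "mass f P y = of_bool (y = 0) * f 0 + mass fp P y - mass fm P y"
  proof (rule mass_eqI[OF P _ y(1)])
    fix x assume x: "x \<in> gpts P"
    have xc: "x \<in> unit_cube" using x gpts_cube[OF P] by auto
    have "(\<Sum>y | y \<in> gpts P \<and> y \<le> x. of_bool (y = 0) * f 0) = (\<Sum>y | y \<in> gpts P \<and> y \<le> x. if y = 0 then f 0 else 0)"
      by (intro sum.cong) auto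
    also have "\<dots> = f 0"
      using finite_gpts[OF P] zero_in_gpts[OF P] zero_le_vec[OF xc] by (subst sum.delta) auto
    finally show "(\<Sum>y | y \<in> gpts P \<and> y \<le> x. of_bool (y = 0) * f 0 + mass fp P y - mass fm P y) = f x"
      using J xc unfolding jordan_fun_def by (simp add: sum.distrib sum_subtractf sum_mass[OF P x])
  qed
  then show ?thesis using y(2) by simp
qed

text \<open>The excess \<open>d\<close> of the masses of both parts over the modulus is nonnegative,
  so its sum below \<open>x\<close> is at most its sum over the grid. The latter is the gap between
  \<open>Var_HK0 f\<close> and the grid variation, which good grids make arbitrarily small.\<close>

lemma jordan_fun_gap:
  assumes J: "jordan_fun f fp fm" and P: "grid P UNIV" and x: "x \<in> gpts P"
  defines "V \<equiv> (\<Sum>y | y \<in> gpts P \<and> y \<le> x \<and> y \<noteq> 0. \<bar>mass f P y\<bar>)"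
  shows "V \<le> fp x + fm x" "fp x + fm x - V \<le> fp 1 + fm 1 - grid_var f P"
proof -
  have cm: "compl_mono fp" "compl_mono fm" and z: "fp 0 = 0" "fm 0 = 0"
    using J by (auto simp: jordan_fun_def)
  define d where "d y = mass fp P y + mass fm P y - \<bar>mass f P y\<bar>" for y
  have d: "0 \<le> d y" if "y \<in> gpts P" "y \<noteq> 0" for y
    using jordan_fun_mass[OF J P that] compl_mono_mass_nonneg[OF cm(1) P that]
      compl_mono_mass_nonneg[OF cm(2) P that] by (simp add: d_def)
  have sx: "(\<Sum>y | y \<in> gpts P \<and> y \<le> x \<and> y \<noteq> 0. d y) = fp x + fm x - V"
    unfolding d_def V_def using sum_mass_nonzero[OF P x] z by (simp add: sum.distrib sum_subtractf)
  have s1: "(\<Sum>y | y \<in> gpts P \<and> y \<noteq> 0. d y) = fp 1 + fm 1 - grid_var f P"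
    unfolding d_def grid_var_def using sum_mass_nonzero[OF P one_in_gpts[OF P]] z
    by (simp add: sum.distrib sum_subtractf nonzero_le_one[OF P])
  have "0 \<le> (\<Sum>y | y \<in> gpts P \<and> y \<le> x \<and> y \<noteq> 0. d y)" using d by (intro sum_nonneg) auto
  then show "V \<le> fp x + fm x" by (simp add: sx)
  have "(\<Sum>y | y \<in> gpts P \<and> y \<le> x \<and> y \<noteq> 0. d y) \<le> (\<Sum>y | y \<in> gpts P \<and> y \<noteq> 0. d y)"
    using d finite_gpts[OF P] by (intro sum_mono2) auto
  then show "fp x + fm x - V \<le> fp 1 + fm 1 - grid_var f P" by (simp add: sx s1)
qed

text \<open>Both \<open>fp + fm\<close> and \<open>gp + gm\<close> equal the variation of \<open>f\<close> over \<open>[0,x]\<close>: on a grid through \<open>x\<close> that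
  nearly attains \<open>Var_HK0 f\<close>, neither can exceed the grid variation over \<open>[0,x]\<close> by more than the error.\<close>

lemma jordan_fun_unique:
  fixes f :: "real^'n \<Rightarrow> real"
  assumes Jf: "jordan_fun f fp fm" and Jg: "jordan_fun f gp gm" and x: "x \<in> unit_cube"
  shows "fp x = gp x" "fm x = gm x"
proof -
  define w where "w = fp 1 + fm 1"
  have VJ: "Var_HK0 f = ereal (hp 1 + hm 1)" if "jordan_fun f hp hm" for hp hm
    using that Var_HK0_compl_mono[of hp] Var_HK0_compl_mono[of hm] by (simp add: jordan_fun_def)
  have w: "Var_HK0 f = ereal w" "gp 1 + gm 1 = w"
    using VJ[OF Jf] VJ[OF Jg] by (auto simp: w_def)
  have "\<bar>(fp x + fm x) - (gp x + gm x)\<bar> \<le> 0 + e" if e: "e > 0" for e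
  proof -
    have "ereal (w - e) < Var_HK0 f" using e by (simp add: w)
    then obtain P where P: "grid P UNIV" "w - e < grid_var f P"
      unfolding Var_HK0_eq_SUP less_SUP_iff by auto
    \<comment> \<open>Adding the coordinates of \<open>x\<close> makes it a grid point, and
      refinement keeps the grid nearly optimal.\<close>
    define Q where "Q i = P i \<union> {0, 1, x$i}" for i
    have "grid (\<lambda>i. {0, 1, x$i}) UNIV" using x by (auto simp: grid_def mem_cube)
    then have Q: "grid Q UNIV" unfolding Q_def by (rule grid_Un[OF P(1)])
    have xQ: "x \<in> gpts Q" by (simp add: gpts_iff Q_def)
    have "total_var f P \<le> total_var f Q" by (rule total_var_mono[OF P(1) Q]) (auto simp: Q_def)
    then have "w - e < grid_var f Q" using P by (simp add: total_var_eq Q)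
    then show ?thesis
      using jordan_fun_gap[OF Jf Q xQ] jordan_fun_gap[OF Jg Q xQ] w(2) unfolding w_def by linarith
  qed
  then have "\<bar>(fp x + fm x) - (gp x + gm x)\<bar> \<le> 0" by (rule field_le_epsilon)
  moreover have "fp x - fm x = gp x - gm x" using Jf Jg x unfolding jordan_fun_def by force
  ultimately show "fp x = gp x" "fm x = gm x" by linarith+
qed

lemma compl_mono_of_measure:
  fixes p :: "(real^'n) set \<Rightarrow> real"
  assumes p: "signed_measure p" and nn: "\<And>A. A \<in> borel_cube \<Longrightarrow> 0 \<le> p A"
    and g: "\<And>x. x \<in> unit_cube \<Longrightarrow> g x = p (cbox 0 x)"
  shows "compl_mono g"
  unfolding compl_mono_def
proof (intro allI impI, elim conjE)
  fix S and a b :: "real^'n"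
  assume ab: "a \<in> unit_cube" "b \<in> unit_cube" "\<forall>i\<in>S. a$i \<le> b$i"
  \<comment> \<open>On a grid through the corners the quasi-volume is a sum of cell
    measures.\<close>
  define P where "P i = {0, 1, a$i, b$i}" for i
  have P: "grid P UNIV" using ab(1,2) by (auto simp: grid_def P_def mem_cube)
  show "0 \<le> qvol g S a b b"
    by (subst qvol_mass[OF P])
      (use ab(3) nn cell_borel[OF P] in \<open>auto simp: P_def[symmetric] signed_measure_mass[OF p g P] intro!: sum_nonneg, auto simp: P_def\<close>)
qed

text \<open>Removing the origin makes both parts vanish at 0; the term
  \<open>\<bar>f 0\<bar>\<close> in \<open>V\<close> is exactly the mass removed, so the variations
  still add up.\<close>

lemma jordan_fun_of_jordan_meas:
  fixes f :: "real^'n \<Rightarrow> real"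
  assumes J: "jordan_meas \<nu> p m" and f: "\<And>x. x \<in> unit_cube \<Longrightarrow> f x = \<nu> (cbox 0 x)"
    and V: "ereal (Var_tot \<nu>) = Var_HK0 f + ereal \<bar>f 0\<bar>"
  shows "jordan_fun f (\<lambda>x. p (cbox 0 x - {0})) (\<lambda>x. m (cbox 0 x - {0}))"
proof -
  note JD = jordan_measD[OF J]
  have z [simp]: "{0} \<in> borel_cube" "0 \<in> unit_cube" "1 \<in> unit_cube" "cbox 0 0 = {0 :: real^'n}"
    by (simp_all add: mem_borel_cube mem_box_cart)
  have f0: "f 0 = \<nu> {0}" using f[of 0] by simp
  have diff: "q (cbox 0 x - {0}) = q (cbox 0 x) - q {0}" if "signed_measure q" "x \<in> unit_cube" for q x
    using that by (intro signed_measure_Diff) (auto simp: mem_cbox0 zero_le_vec)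
  have cm: "compl_mono (\<lambda>x. q (cbox 0 x - {0}))"
    if q: "signed_measure q" "\<And>A. A \<in> borel_cube \<Longrightarrow> 0 \<le> q A" for q
  proof (rule compl_mono_of_measure)
    show "signed_measure (\<lambda>A. q (A \<inter> - {0}))" by (rule signed_measure_restrict[OF q(1)]) auto
    show "0 \<le> q (A \<inter> - {0})" if "A \<in> borel_cube" for A using that by (intro q(2)) auto
  qed (simp add: Diff_eq)
  have empty: "p {} = 0" "m {} = 0" using JD(1,2) by (auto dest: signed_measureD(1))
  obtain P where P: "P \<in> borel_cube" "p (unit_cube - P) = 0" "m P = 0"
    using J unfolding jordan_meas_def by blast
  \<comment> \<open>By mutual singularity at most one part charges the origin, which turns
    \<open>\<bar>f 0\<bar>\<close> into \<open>p {0} + m {0}\<close>.\<close>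
  have "p {0} = 0 \<or> m {0} = 0"
  proof (cases "0 \<in> P")
    case True
    then have "m {0} \<le> m P" using P(1) by (intro signed_measure_mono[OF JD(2,4)]) auto
    then show ?thesis using P(3) JD(4)[of "{0}"] by simp
  next
    case False
    then have "p {0} \<le> p (unit_cube - P)" using P(1) by (intro signed_measure_mono[OF JD(1,3)]) auto
    then show ?thesis using P(2) JD(3)[of "{0}"] by simp
  qed
  then have abs0: "\<bar>f 0\<bar> = p {0} + m {0}"
    using JD(3,4,5)[of "{0}"] by (auto simp: f0)
  have "Var_HK0 (\<lambda>x. p (cbox 0 x - {0})) + Var_HK0 (\<lambda>x. m (cbox 0 x - {0}))
      = ereal (p unit_cube + m unit_cube - \<bar>f 0\<bar>)"
  proof -
    have "Var_HK0 (\<lambda>x. q (cbox 0 x - {0})) = ereal (q unit_cube - q {0})"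
      if q: "signed_measure q" "\<And>A. A \<in> borel_cube \<Longrightarrow> 0 \<le> q A" for q
      using Var_HK0_compl_mono[OF cm[OF q]] signed_measureD(1)[OF q(1)] by (simp add: diff[OF q(1)])
    from this[OF JD(1,3)] this[OF JD(2,4)] show ?thesis by (simp add: abs0)
  qed
  also have "\<dots> = Var_HK0 f"
    using V unfolding Var_tot_eq[OF J] by (cases "Var_HK0 f") auto
  finally have var: "Var_HK0 f = Var_HK0 (\<lambda>x. p (cbox 0 x - {0})) + Var_HK0 (\<lambda>x. m (cbox 0 x - {0}))" ..
  have eq: "f x = f 0 + p (cbox 0 x - {0}) - m (cbox 0 x - {0})" if x: "x \<in> unit_cube" for x
    using JD(5)[OF cbox_borel_cube[OF x]] JD(5)[of "{0}"] f[OF x] f0 by (simp add: diff JD(1,2) x)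
  show ?thesis
    unfolding jordan_fun_def
    by (intro conjI ballI eq var cm[OF JD(1,3)] cm[OF JD(2,4)]) (simp_all add: empty)
qed

section \<open>Agreement of the Jordan decompositions and the correspondence\<close>

lemma jordan_decompositions_agree:
  fixes f :: "real^'n \<Rightarrow> real"
  assumes "\<And>x. x \<in> unit_cube \<Longrightarrow> f x = \<nu> (cbox 0 x)"
    and "ereal (Var_tot \<nu>) = Var_HK0 f + ereal \<bar>f 0\<bar>"
    and "jordan_fun f fp fm" "jordan_meas \<nu> p m" "x \<in> unit_cube"
  shows "fp x = p (cbox 0 x - {0}) \<and> fm x = m (cbox 0 x - {0})"
  using jordan_fun_unique[OF assms(3) jordan_fun_of_jordan_meas[OF assms(4,1,2)] assms(5)] by simp

lemma signed_measure_distribution_function: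
  fixes \<nu> :: "(real^'n) set \<Rightarrow> real"
  assumes \<nu>: "signed_measure \<nu>"
  defines "f \<equiv> \<lambda>x. \<nu> (cbox 0 x)"
  shows "right_cont f" "bounded_HK f" "ereal (Var_tot \<nu>) = Var_HK0 f + ereal \<bar>f 0\<bar>"
proof -
  have f: "f x = \<nu> (cbox 0 x)" for x by (simp add: f_def)
  obtain B where "\<forall>A\<in>borel_cube. \<bar>\<nu> A\<bar> \<le> B" using signed_measure_bounded[OF \<nu>] by blast
  then have "total_var f P \<le> 2 * B" if "grid P UNIV" for P
    using that by (intro signed_measure_total_var[OF \<nu> f]) auto
  then show bv: "bounded_HK f" by (rule bounded_HK_if_total_var_bounded)
  show rc: "right_cont f" by (rule signed_measure_right_cont[OF \<nu> f])
  obtain \<nu>' p m where \<nu>': "signed_measure \<nu>'" "\<And>x. x \<in> unit_cube \<Longrightarrow> f x = \<nu>' (cbox 0 x)"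
    "jordan_meas \<nu>' p m" "ereal (Var_tot \<nu>') = Var_HK0 f + ereal \<bar>f 0\<bar>"
    using right_cont_bounded_HK_signed_measure[OF rc bv] by blast
  have "\<nu> (cbox 0 x) = \<nu>' (cbox 0 x)" if "x \<in> unit_cube" for x using \<nu>'(2)[OF that] by (simp add: f)
  \<comment> \<open>The measure rebuilt from \<open>f\<close> agrees with \<open>\<nu>\<close> on
    the Borel subsets of the cube, the only sets a Jordan decomposition looks at, so the variation
    formula carries over.\<close>
  then have "\<nu> A = \<nu>' A" if "A \<in> borel_cube" for A
    by (rule signed_measure_unique[OF \<nu> \<nu>'(1) _ that])
  then have "jordan_meas \<nu> p m" using \<nu>'(3) by (simp add: jordan_meas_def)
  then show "ereal (Var_tot \<nu>) = Var_HK0 f + ereal \<bar>f 0\<bar>"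
    using \<nu>'(4) Var_tot_eq[OF \<nu>'(3)] Var_tot_eq[of \<nu> p m] by simp
qed

theorem theorem3:
  shows
  "(\<forall>f :: real^'n \<Rightarrow> real. right_cont f \<and> bounded_HK f \<longrightarrow>
     (\<exists>\<nu>. signed_measure \<nu> \<and> (\<forall>x\<in>unit_cube. f x = \<nu> (cbox 0 x)) \<and>
        (\<forall>\<nu>'. signed_measure \<nu>' \<and> (\<forall>x\<in>unit_cube. f x = \<nu>' (cbox 0 x)) \<longrightarrow>
           (\<forall>A\<in>borel_cube. \<nu>' A = \<nu> A)) \<and>
        ereal (Var_tot \<nu>) = Var_HK0 f + ereal \<bar>f 0\<bar> \<and>
        (\<forall>fp fm p m. jordan_fun f fp fm \<and> jordan_meas \<nu> p m \<longrightarrow>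
           (\<forall>x\<in>unit_cube. fp x = p (cbox 0 x - {0}) \<and> fm x = m (cbox 0 x - {0})))))
   \<and>
   (\<forall>\<nu> :: (real^'n) set \<Rightarrow> real. signed_measure \<nu> \<longrightarrow>
     (\<exists>f. right_cont f \<and> bounded_HK f \<and> (\<forall>x\<in>unit_cube. f x = \<nu> (cbox 0 x)) \<and>
        ereal (Var_tot \<nu>) = Var_HK0 f + ereal \<bar>f 0\<bar> \<and>
        (\<forall>g. right_cont g \<and> bounded_HK g \<and> (\<forall>x\<in>unit_cube. g x = \<nu> (cbox 0 x)) \<and>
            ereal (Var_tot \<nu>) = Var_HK0 g + ereal \<bar>g 0\<bar> \<longrightarrow> (\<forall>x\<in>unit_cube. g x = f x)) \<and>
        (\<forall>fp fm p m. jordan_fun f fp fm \<and> jordan_meas \<nu> p m \<longrightarrow>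
           (\<forall>x\<in>unit_cube. fp x = p (cbox 0 x - {0}) \<and> fm x = m (cbox 0 x - {0})))))"
proof (intro conjI allI impI)
  fix f :: "real^'n \<Rightarrow> real" assume "right_cont f \<and> bounded_HK f"
  then obtain \<nu> p m where \<nu>: "signed_measure \<nu>" "\<And>x. x \<in> unit_cube \<Longrightarrow> f x = \<nu> (cbox 0 x)"
    "jordan_meas \<nu> p m" "ereal (Var_tot \<nu>) = Var_HK0 f + ereal \<bar>f 0\<bar>"
    using right_cont_bounded_HK_signed_measure by metis
  show "\<exists>\<nu>. signed_measure \<nu> \<and> (\<forall>x\<in>unit_cube. f x = \<nu> (cbox 0 x)) \<and>
        (\<forall>\<nu>'. signed_measure \<nu>' \<and> (\<forall>x\<in>unit_cube. f x = \<nu>' (cbox 0 x)) \<longrightarrow>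
           (\<forall>A\<in>borel_cube. \<nu>' A = \<nu> A)) \<and>
        ereal (Var_tot \<nu>) = Var_HK0 f + ereal \<bar>f 0\<bar> \<and>
        (\<forall>fp fm p m. jordan_fun f fp fm \<and> jordan_meas \<nu> p m \<longrightarrow>
           (\<forall>x\<in>unit_cube. fp x = p (cbox 0 x - {0}) \<and> fm x = m (cbox 0 x - {0})))"
  proof (rule exI[of _ \<nu>], intro conjI allI impI ballI)
    fix \<nu>' and A :: "(real^'n) set"
    assume \<nu>': "signed_measure \<nu>' \<and> (\<forall>x\<in>unit_cube. f x = \<nu>' (cbox 0 x))" and A: "A \<in> borel_cube"
    \<comment> \<open>Set functions are unconstrained outside \<open>borel_cube\<close>, so
      uniqueness is asserted on that class only.\<close>
    have "\<nu>' (cbox 0 x) = \<nu> (cbox 0 x)" if "x \<in> unit_cube" for x using \<nu>' \<nu>(2)[OF that] that by simp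
    then show "\<nu>' A = \<nu> A" by (rule signed_measure_unique[OF conjunct1[OF \<nu>'] \<nu>(1) _ A])
  qed (use \<nu>(1,2,4) jordan_decompositions_agree[OF \<nu>(2,4)] in auto)
next
  fix \<nu> :: "(real^'n) set \<Rightarrow> real" assume \<nu>: "signed_measure \<nu>"
  define f where "f x = \<nu> (cbox 0 x)" for x
  have f: "right_cont f" "bounded_HK f" "ereal (Var_tot \<nu>) = Var_HK0 f + ereal \<bar>f 0\<bar>"
    unfolding f_def by (rule signed_measure_distribution_function[OF \<nu>])+
  show "\<exists>f. right_cont f \<and> bounded_HK f \<and> (\<forall>x\<in>unit_cube. f x = \<nu> (cbox 0 x)) \<and>
        ereal (Var_tot \<nu>) = Var_HK0 f + ereal \<bar>f 0\<bar> \<and>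
        (\<forall>g. right_cont g \<and> bounded_HK g \<and> (\<forall>x\<in>unit_cube. g x = \<nu> (cbox 0 x)) \<and>
            ereal (Var_tot \<nu>) = Var_HK0 g + ereal \<bar>g 0\<bar> \<longrightarrow> (\<forall>x\<in>unit_cube. g x = f x)) \<and>
        (\<forall>fp fm p m. jordan_fun f fp fm \<and> jordan_meas \<nu> p m \<longrightarrow>
           (\<forall>x\<in>unit_cube. fp x = p (cbox 0 x - {0}) \<and> fm x = m (cbox 0 x - {0})))"
    by (rule exI[of _ f], intro conjI allI impI ballI)
      (use f jordan_decompositions_agree[OF f_def f(3)] in \<open>auto simp: f_def\<close>)
qed

end
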